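(* Let $\mathcal{F}$ be a left linear track category admitting linearity tracks $\Gamma_a^{x,y}\colon a(x+y)\Rightarrow ax+ay$ (one for every object triple $X,A,B$ and all maps $x,y\colon X\to A$, $a\colon A\to B$ in $\mathcal{F}$) that satisfy the linearity track equations. Then $\mathcal{F}$ is weakly equivalent to a $1$-truncated DG-category. If moreover $p$ is a prime number such that every morphism in $\mathcal{F}$ is $p$-torsion (i.e. $px=0$ for every degree $0$ morphism $x$ of $\mathcal{F}$), then $\mathcal{F}$ is weakly equivalent to a $1$-truncated DG-category over $\mathbb{Z}/p^2$.
   Context: **Track categories.** Groupoids are small. Morphisms of a groupoid $G$ are called tracks, written $\alpha\colon x\Rightarrow y$; $G_0,G_1$ are the sets of objects and of tracks, $\delta_0,\delta_1\colon G_1\to G_0$ are source and target, $\beta\,\square\,\alpha$ is the composite (first $\alpha$, then $\beta$), $\alpha^{\boxminus}$ is the inverse, $\mathrm{id}^{\square}_x$ is the identity track. A track category $\mathcal{T}$ is a category enriched in $(\mathrm{Gpd},\times)$, groupoids with cartesian product. Its maps (degree $0$ morphisms) are the objects of the groupoids $\mathcal{T}(A,B)$, its tracks (degree $1$) are their morphisms. The homotopy category $\pi_0\mathcal{T}$ has the same objects and hom-sets $\pi_0(\mathcal{T}(A,B))$. For a map $x$ and a track $\alpha$ put $x\alpha:=\mathrm{id}^{\square}_x\alpha$ and $\alpha x:=\alpha\,\mathrm{id}^{\square}_x$ when composable. $\mathcal{T}$ is pointed if each $\mathcal{T}(A,B)$ has a chosen object $0$ such that $0y=0$, $x0=0$ for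 maps $x,y$, and composing any track with $\mathrm{id}^{\square}_0$ on either side gives $\mathrm{id}^{\square}_0$. A track functor is a $\mathrm{Gpd}$-enriched functor. **Linearity.** A locally linear track category is a pointed track category in which each $\mathcal{T}(A,B)$ is an abelian group object in groupoids, with zero $0_{A,B}$. It is left linear if composition satisfies $(a+a')x=ax+a'x$ (on maps and on tracks); right linear is defined analogously. **Linearity tracks.** A linearity track is a track $\Gamma_a^{x,y}\colon a(x+y)\Rightarrow ax+ay$ in $\mathcal{T}(X,B)$, for maps $x,y\colon X\to A$, $a\colon A\to B$. The linearity track equations, required for all (composable) maps $x,y,z,a,a',b$ and tracks $G\colon x\Rightarrow x'$, $H\colon y\Rightarrow y'$, $\alpha\colon a\Rightarrow a'$, are: 1. $\Gamma_a^{xz,yz}=\Gamma_a^{x,y}z$. 2. $\Gamma_{ba}^{x,y}=\Gamma_b^{ax,ay}\,\square\, b\Gamma_a^{x,y}$. 3. $\Gamma_a^{x,y}=\Gamma_a^{y,x}$. 4. $\Gamma_{a+a'}^{x,y}=\Gamma_a^{x,y}+\Gamma_{a'}^{x,y}$. 5. $(\Gamma_a^{x,y}+az)\,\square\,\Gamma_a^{x+y,z}=(ax+\Gamma_a^{y,z})\,\square\,\Gamma_a^{x,y+z}$. 6. $(aG+aH)\,\square\,\Gamma_a^{x,y}=\Gamma_a^{x',y'}\,\square\, a(G+H)$. 7. $(\alpha x+\alpha y)\,\square\,\Gamma_a^{x,y}=\Gamma_{a'}^{x,y}\,\square\,\alpha(x+y)$. (A map in place of a track denotes its identity track.) **DG-categories.**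 For a commutative ring $R$, a $1$-truncated DG-category over $R$ ($R=\mathbb{Z}$ if not mentioned) is a category enriched in chain complexes of $R$-modules (tensor product over $R$) whose hom-complexes $\mathcal{B}(A,B)=(\mathcal{B}(A,B)_1\xrightarrow{\partial}\mathcal{B}(A,B)_0)$ are concentrated in degrees $0,1$; thus composition $x\otimes y$ (for $\deg x+\deg y\le 1$) is associative, unital, bilinear and satisfies $\partial(x\otimes b)=x\otimes\partial b$, $\partial(a\otimes y)=(\partial a)\otimes y$, $(\partial a)\otimes b=a\otimes(\partial b)$ for $\deg x=\deg y=0$, $\deg a=\deg b=1$. It is regarded as a track category $\Theta\mathcal{B}$ with the same objects: the groupoid $\Theta\mathcal{B}(A,B)$ has objects $\mathcal{B}(A,B)_0$ and tracks $(x_1,x_0)\colon\partial x_1+x_0\Rightarrow x_0$ with $(x_1,x_0)\in\mathcal{B}(A,B)_1\oplus\mathcal{B}(A,B)_0$, composition $(x_1,x_0)\,\square\,(y_1,y_0)=(x_1+y_1,x_0)$ when $y_0=\partial x_1+x_0$; maps compose as in $\mathcal{B}$, and $x(b_1,b_0)=(xb_1,xb_0)$, $(a_1,a_0)y=(a_1y,a_0y)$, so that $(a_1,a_0)(b_1,b_0)=(a_1b_0+a_0b_1+(\partial a_1)b_1,\,a_0b_0)$. **Weak equivalence.** A track functor $F\colon\mathcal{S}\to\mathcal{T}$ is a Dwyer–Kan (DK) equivalence if every $F\colon\mathcal{S}(A,B)\to\mathcal{T}(FA,FB)$ is an equivalence of groupoids and $\pi_0F\colon\pi_0\mathcal{S}\to\pi_0\mathcal{T}$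 is an equivalence of categories. Track categories are weakly equivalent if there is a zigzag of DK-equivalences between them. *)

theory Defs
  imports
    "HOL-Algebra.Module"
    "HOL-Algebra.IntRing"
    "HOL-Number_Theory.Residues"
begin

section \<open>Categories and groupoids\<close>

text \<open>\<open>Comp C g f\<close> is the composite "first \<open>f\<close>, then \<open>g\<close>". As in HOL-Algebra, the structure
  maps are only meaningful on the carriers \<open>Obj C\<close> and \<open>Arr C\<close>.\<close>

record ('ob, 'ar) category =
  Obj :: "'ob set"
  Arr :: "'ar set"
  Src :: "'ar \<Rightarrow> 'ob"
  Tgt :: "'ar \<Rightarrow> 'ob"
  Ident :: "'ob \<Rightarrow> 'ar"
  Comp :: "'ar \<Rightarrow> 'ar \<Rightarrow> 'ar"

locale category =
  fixes C :: "('ob, 'ar) category"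
  assumes Src_closed: "f \<in> Arr C \<Longrightarrow> Src C f \<in> Obj C"
    and Tgt_closed: "f \<in> Arr C \<Longrightarrow> Tgt C f \<in> Obj C"
    and Ident_closed: "x \<in> Obj C \<Longrightarrow> Ident C x \<in> Arr C"
    and Src_Ident: "x \<in> Obj C \<Longrightarrow> Src C (Ident C x) = x"
    and Tgt_Ident: "x \<in> Obj C \<Longrightarrow> Tgt C (Ident C x) = x"
    and Comp_closed:
      "\<lbrakk>f \<in> Arr C; g \<in> Arr C; Tgt C f = Src C g\<rbrakk> \<Longrightarrow> Comp C g f \<in> Arr C"
    and Src_Comp:
      "\<lbrakk>f \<in> Arr C; g \<in> Arr C; Tgt C f = Src C g\<rbrakk> \<Longrightarrow> Src C (Comp C g f) = Src C f"
    and Tgt_Comp: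
      "\<lbrakk>f \<in> Arr C; g \<in> Arr C; Tgt C f = Src C g\<rbrakk> \<Longrightarrow> Tgt C (Comp C g f) = Tgt C g"
    and Comp_Ident_right: "f \<in> Arr C \<Longrightarrow> Comp C f (Ident C (Src C f)) = f"
    and Comp_Ident_left: "f \<in> Arr C \<Longrightarrow> Comp C (Ident C (Tgt C f)) f = f"
    and Comp_assoc:
      "\<lbrakk>f \<in> Arr C; g \<in> Arr C; h \<in> Arr C; Tgt C f = Src C g; Tgt C g = Src C h\<rbrakk>
        \<Longrightarrow> Comp C (Comp C h g) f = Comp C h (Comp C g f)"

definition arrow :: "('ob, 'ar) category \<Rightarrow> 'ar \<Rightarrow> 'ob \<Rightarrow> 'ob \<Rightarrow> bool" where
  "arrow C f x y \<longleftrightarrow> f \<in> Arr C \<and> Src C f = x \<and> Tgt C f = y"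

definition is_invertible :: "('ob, 'ar) category \<Rightarrow> 'ar \<Rightarrow> bool" where
  "is_invertible C f \<longleftrightarrow> f \<in> Arr C \<and>
    (\<exists>g. arrow C g (Tgt C f) (Src C f) \<and>
      Comp C g f = Ident C (Src C f) \<and> Comp C f g = Ident C (Tgt C f))"

locale groupoid = category G for G :: "('ob, 'ar) category" +
  assumes Arr_iso: "f \<in> Arr G \<Longrightarrow> is_invertible G f"

definition prod_category ::
  "('a, 'b) category \<Rightarrow> ('c, 'd) category \<Rightarrow> ('a \<times> 'c, 'b \<times> 'd) category" where
  "prod_category C D =
    \<lparr>Obj = Obj C \<times> Obj D,
     Arr = Arr C \<times> Arr D,
     Src = map_prod (Src C) (Src D),
     Tgt = map_prod (Tgt C) (Tgt D),
     Ident = map_prod (Ident C) (Ident D),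
     Comp = (\<lambda>(g, g') (f, f'). (Comp C g f, Comp D g' f'))\<rparr>"

definition is_functor ::
  "('a, 'b) category \<Rightarrow> ('c, 'd) category \<Rightarrow> ('a \<Rightarrow> 'c) \<Rightarrow> ('b \<Rightarrow> 'd) \<Rightarrow> bool" where
  "is_functor C D Fo Fa \<longleftrightarrow>
    category C \<and> category D \<and>
    (\<forall>x\<in>Obj C. Fo x \<in> Obj D) \<and>
    (\<forall>f\<in>Arr C. arrow D (Fa f) (Fo (Src C f)) (Fo (Tgt C f))) \<and>
    (\<forall>x\<in>Obj C. Fa (Ident C x) = Ident D (Fo x)) \<and>
    (\<forall>f\<in>Arr C. \<forall>g\<in>Arr C. Tgt C f = Src C g \<longrightarrow> Fa (Comp C g f) = Comp D (Fa g) (Fa f))"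

definition natural_iso ::
  "('a, 'b) category \<Rightarrow> ('c, 'd) category \<Rightarrow> ('a \<Rightarrow> 'c) \<Rightarrow> ('b \<Rightarrow> 'd) \<Rightarrow>
    ('a \<Rightarrow> 'c) \<Rightarrow> ('b \<Rightarrow> 'd) \<Rightarrow> ('a \<Rightarrow> 'd) \<Rightarrow> bool" where
  "natural_iso C D Fo Fa Go Ga \<eta> \<longleftrightarrow>
    is_functor C D Fo Fa \<and> is_functor C D Go Ga \<and>
    (\<forall>x\<in>Obj C. arrow D (\<eta> x) (Fo x) (Go x) \<and> is_invertible D (\<eta> x)) \<and>
    (\<forall>f\<in>Arr C. Comp D (\<eta> (Tgt C f)) (Fa f) = Comp D (Ga f) (\<eta> (Src C f)))"

definition is_equivalence ::
  "('a, 'b) category \<Rightarrow> ('c, 'd) category \<Rightarrow> ('a \<Rightarrow> 'c) \<Rightarrow> ('b \<Rightarrow> 'd) \<Rightarrow> bool" where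
  "is_equivalence C D Fo Fa \<longleftrightarrow>
    is_functor C D Fo Fa \<and>
    (\<exists>Go Ga \<eta> \<epsilon>. is_functor D C Go Ga \<and>
      natural_iso C C id id (Go \<circ> Fo) (Ga \<circ> Fa) \<eta> \<and>
      natural_iso D D (Fo \<circ> Go) (Fa \<circ> Ga) id id \<epsilon>)"

text \<open>\<open>conn G\<close> is an equivalence relation on \<open>Obj G\<close> when \<open>G\<close> is a groupoid;
  its classes form \<open>\<pi>\<^sub>0 G\<close>.\<close>

definition conn :: "('ob, 'ar) category \<Rightarrow> ('ob \<times> 'ob) set" where
  "conn G = {(x, y). \<exists>f. arrow G f x y \<and> x \<in> Obj G \<and> y \<in> Obj G}"


section \<open>Track categories\<close>

text \<open>\<open>Hom T A B\<close> is the groupoid of maps and tracks from \<open>A\<close> to \<open>B\<close>. For \<open>a\<close> from \<open>B\<close> to \<open>C\<close> and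
  \<open>x\<close> from \<open>A\<close> to \<open>B\<close>, the composite \<open>ax\<close> is \<open>mcomp T A B C a x\<close> on maps and
  \<open>tcomp T A B C a x\<close> on tracks. The hom-groupoids need not be disjoint, hence the indices.\<close>

record ('o, 'm, 't) track_category =
  TObj :: "'o set"
  Hom :: "'o \<Rightarrow> 'o \<Rightarrow> ('m, 't) category"
  mcomp :: "'o \<Rightarrow> 'o \<Rightarrow> 'o \<Rightarrow> 'm \<Rightarrow> 'm \<Rightarrow> 'm"
  tcomp :: "'o \<Rightarrow> 'o \<Rightarrow> 'o \<Rightarrow> 't \<Rightarrow> 't \<Rightarrow> 't"
  unit_map :: "'o \<Rightarrow> 'm"

abbreviation maps :: "('o, 'm, 't, 'e) track_category_scheme \<Rightarrow> 'o \<Rightarrow> 'o \<Rightarrow> 'm set" where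
  "maps T A B \<equiv> Obj (Hom T A B)"

abbreviation tracks :: "('o, 'm, 't, 'e) track_category_scheme \<Rightarrow> 'o \<Rightarrow> 'o \<Rightarrow> 't set" where
  "tracks T A B \<equiv> Arr (Hom T A B)"

abbreviation idtr :: "('o, 'm, 't, 'e) track_category_scheme \<Rightarrow> 'o \<Rightarrow> 'o \<Rightarrow> 'm \<Rightarrow> 't" where
  "idtr T A B \<equiv> Ident (Hom T A B)"

locale track_category =
  fixes T :: "('o, 'm, 't, 'e) track_category_scheme"
  assumes groupoid_Hom: "\<lbrakk>A \<in> TObj T; B \<in> TObj T\<rbrakk> \<Longrightarrow> groupoid (Hom T A B)"
    and comp_functor:
      "\<lbrakk>A \<in> TObj T; B \<in> TObj T; C \<in> TObj T\<rbrakk> \<Longrightarrow>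
        is_functor (prod_category (Hom T B C) (Hom T A B)) (Hom T A C)
          (\<lambda>(a, x). mcomp T A B C a x) (\<lambda>(\<alpha>, \<xi>). tcomp T A B C \<alpha> \<xi>)"
    and mcomp_assoc:
      "\<lbrakk>A \<in> TObj T; B \<in> TObj T; C \<in> TObj T; D \<in> TObj T;
        x \<in> maps T A B; y \<in> maps T B C; z \<in> maps T C D\<rbrakk> \<Longrightarrow>
        mcomp T A B D (mcomp T B C D z y) x = mcomp T A C D z (mcomp T A B C y x)"
    and tcomp_assoc:
      "\<lbrakk>A \<in> TObj T; B \<in> TObj T; C \<in> TObj T; D \<in> TObj T;
        \<xi> \<in> tracks T A B; \<eta> \<in> tracks T B C; \<zeta> \<in> tracks T C D\<rbrakk> \<Longrightarrow>
        tcomp T A B D (tcomp T B C D \<zeta> \<eta>) \<xi> = tcomp T A C D \<zeta> (tcomp T A B C \<eta> \<xi>)"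
    and unit_closed: "A \<in> TObj T \<Longrightarrow> unit_map T A \<in> maps T A A"
    and mcomp_unit_left:
      "\<lbrakk>A \<in> TObj T; B \<in> TObj T; x \<in> maps T A B\<rbrakk> \<Longrightarrow> mcomp T A B B (unit_map T B) x = x"
    and mcomp_unit_right:
      "\<lbrakk>A \<in> TObj T; B \<in> TObj T; x \<in> maps T A B\<rbrakk> \<Longrightarrow> mcomp T A A B x (unit_map T A) = x"
    and tcomp_unit_left:
      "\<lbrakk>A \<in> TObj T; B \<in> TObj T; \<xi> \<in> tracks T A B\<rbrakk> \<Longrightarrow>
        tcomp T A B B (idtr T B B (unit_map T B)) \<xi> = \<xi>"
    and tcomp_unit_right:
      "\<lbrakk>A \<in> TObj T; B \<in> TObj T; \<xi> \<in> tracks T A B\<rbrakk> \<Longrightarrow>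
        tcomp T A A B \<xi> (idtr T A A (unit_map T A)) = \<xi>"

definition whiskl ::
  "('o, 'm, 't, 'e) track_category_scheme \<Rightarrow> 'o \<Rightarrow> 'o \<Rightarrow> 'o \<Rightarrow> 'm \<Rightarrow> 't \<Rightarrow> 't" where
  "whiskl T A B C a \<xi> = tcomp T A B C (idtr T B C a) \<xi>"

definition whiskr ::
  "('o, 'm, 't, 'e) track_category_scheme \<Rightarrow> 'o \<Rightarrow> 'o \<Rightarrow> 'o \<Rightarrow> 't \<Rightarrow> 'm \<Rightarrow> 't" where
  "whiskr T A B C \<alpha> x = tcomp T A B C \<alpha> (idtr T A B x)"

locale pointed_track_category = track_category T
  for T :: "('o, 'm, 't, 'e) track_category_scheme" +
  fixes z :: "'o \<Rightarrow> 'o \<Rightarrow> 'm"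
  assumes zero_closed: "\<lbrakk>A \<in> TObj T; B \<in> TObj T\<rbrakk> \<Longrightarrow> z A B \<in> maps T A B"
    and zero_mcomp:
      "\<lbrakk>A \<in> TObj T; B \<in> TObj T; C \<in> TObj T; y \<in> maps T A B\<rbrakk> \<Longrightarrow>
        mcomp T A B C (z B C) y = z A C"
    and mcomp_zero:
      "\<lbrakk>A \<in> TObj T; B \<in> TObj T; C \<in> TObj T; x \<in> maps T B C\<rbrakk> \<Longrightarrow>
        mcomp T A B C x (z A B) = z A C"
    and zero_tcomp:
      "\<lbrakk>A \<in> TObj T; B \<in> TObj T; C \<in> TObj T; \<eta> \<in> tracks T A B\<rbrakk> \<Longrightarrow>
        tcomp T A B C (idtr T B C (z B C)) \<eta> = idtr T A C (z A C)"
    and tcomp_zero: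
      "\<lbrakk>A \<in> TObj T; B \<in> TObj T; C \<in> TObj T; \<xi> \<in> tracks T B C\<rbrakk> \<Longrightarrow>
        tcomp T A B C \<xi> (idtr T A B (z A B)) = idtr T A C (z A C)"


section \<open>Linearity\<close>

text \<open>Only the additive structure of the ring records \<open>P\<close> and \<open>Q\<close> is used. The zero functor from
  the terminal groupoid is given by the zero object and its identity.\<close>

locale abelian_group_groupoid =
  groupoid G + P: abelian_group P + Q: abelian_group Q
  for G :: "('m, 't) category" and P :: "'m ring" and Q :: "'t ring" +
  assumes carrier_P: "carrier P = Obj G"
    and carrier_Q: "carrier Q = Arr G"
    and add_functor:
      "is_functor (prod_category G G) G (\<lambda>(x, y). x \<oplus>\<^bsub>P\<^esub> y) (\<lambda>(\<alpha>, \<beta>). \<alpha> \<oplus>\<^bsub>Q\<^esub> \<beta>)"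
    and zero_functor: "Ident G \<zero>\<^bsub>P\<^esub> = \<zero>\<^bsub>Q\<^esub>"
    and minus_functor: "is_functor G G (\<lambda>x. \<ominus>\<^bsub>P\<^esub> x) (\<lambda>\<alpha>. \<ominus>\<^bsub>Q\<^esub> \<alpha>)"

record ('o, 'm, 't) linear_track_category = "('o, 'm, 't) track_category" +
  MGrp :: "'o \<Rightarrow> 'o \<Rightarrow> 'm ring"
  TGrp :: "'o \<Rightarrow> 'o \<Rightarrow> 't ring"

abbreviation madd ::
  "('o, 'm, 't, 'e) linear_track_category_scheme \<Rightarrow> 'o \<Rightarrow> 'o \<Rightarrow> 'm \<Rightarrow> 'm \<Rightarrow> 'm" where
  "madd T A B x y \<equiv> x \<oplus>\<^bsub>MGrp T A B\<^esub> y"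

abbreviation tadd ::
  "('o, 'm, 't, 'e) linear_track_category_scheme \<Rightarrow> 'o \<Rightarrow> 'o \<Rightarrow> 't \<Rightarrow> 't \<Rightarrow> 't" where
  "tadd T A B \<alpha> \<beta> \<equiv> \<alpha> \<oplus>\<^bsub>TGrp T A B\<^esub> \<beta>"

locale locally_linear_track_category =
  pointed_track_category T "\<lambda>A B. \<zero>\<^bsub>MGrp T A B\<^esub>"
  for T :: "('o, 'm, 't, 'e) linear_track_category_scheme" +
  assumes Hom_abelian_group:
    "\<lbrakk>A \<in> TObj T; B \<in> TObj T\<rbrakk> \<Longrightarrow>
      abelian_group_groupoid (Hom T A B) (MGrp T A B) (TGrp T A B)"

locale left_linear_track_category = locally_linear_track_category T
  for T :: "('o, 'm, 't, 'e) linear_track_category_scheme" +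
  assumes left_linear_maps:
      "\<lbrakk>A \<in> TObj T; B \<in> TObj T; C \<in> TObj T;
        a \<in> maps T B C; a' \<in> maps T B C; x \<in> maps T A B\<rbrakk> \<Longrightarrow>
        mcomp T A B C (madd T B C a a') x = madd T A C (mcomp T A B C a x) (mcomp T A B C a' x)"
    and left_linear_tracks:
      "\<lbrakk>A \<in> TObj T; B \<in> TObj T; C \<in> TObj T;
        \<alpha> \<in> tracks T B C; \<alpha>' \<in> tracks T B C; \<xi> \<in> tracks T A B\<rbrakk> \<Longrightarrow>
        tcomp T A B C (tadd T B C \<alpha> \<alpha>') \<xi> = tadd T A C (tcomp T A B C \<alpha> \<xi>) (tcomp T A B C \<alpha>' \<xi>)"

text \<open>\<open>\<Gamma> X A B a x y\<close> is the track from \<open>a(x + y)\<close> to \<open>ax + ay\<close>, for \<open>x, y\<close> from \<open>X\<close> to \<open>A\<close> and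
  \<open>a\<close> from \<open>A\<close> to \<open>B\<close>.\<close>

locale linearity_tracks = locally_linear_track_category T
  for T :: "('o, 'm, 't, 'e) linear_track_category_scheme" +
  fixes \<Gamma> :: "'o \<Rightarrow> 'o \<Rightarrow> 'o \<Rightarrow> 'm \<Rightarrow> 'm \<Rightarrow> 'm \<Rightarrow> 't"
  assumes linearity_track:
      "\<lbrakk>X \<in> TObj T; A \<in> TObj T; B \<in> TObj T;
        x \<in> maps T X A; y \<in> maps T X A; a \<in> maps T A B\<rbrakk> \<Longrightarrow>
        arrow (Hom T X B) (\<Gamma> X A B a x y)
          (mcomp T X A B a (madd T X A x y))
          (madd T X B (mcomp T X A B a x) (mcomp T X A B a y))"
    and precomposition:
      "\<lbrakk>W \<in> TObj T; X \<in> TObj T; A \<in> TObj T; B \<in> TObj T;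
        z \<in> maps T W X; x \<in> maps T X A; y \<in> maps T X A; a \<in> maps T A B\<rbrakk> \<Longrightarrow>
        \<Gamma> W A B a (mcomp T W X A x z) (mcomp T W X A y z) = whiskr T W X B (\<Gamma> X A B a x y) z"
    and postcomposition:
      "\<lbrakk>X \<in> TObj T; A \<in> TObj T; B \<in> TObj T; C \<in> TObj T;
        x \<in> maps T X A; y \<in> maps T X A; a \<in> maps T A B; b \<in> maps T B C\<rbrakk> \<Longrightarrow>
        \<Gamma> X A C (mcomp T A B C b a) x y =
          Comp (Hom T X C)
            (\<Gamma> X B C b (mcomp T X A B a x) (mcomp T X A B a y))
            (whiskl T X B C b (\<Gamma> X A B a x y))"
    and symmetry:
      "\<lbrakk>X \<in> TObj T; A \<in> TObj T; B \<in> TObj T;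
        x \<in> maps T X A; y \<in> maps T X A; a \<in> maps T A B\<rbrakk> \<Longrightarrow>
        \<Gamma> X A B a x y = \<Gamma> X A B a y x"
    and left_linearity:
      "\<lbrakk>X \<in> TObj T; A \<in> TObj T; B \<in> TObj T;
        x \<in> maps T X A; y \<in> maps T X A; a \<in> maps T A B; a' \<in> maps T A B\<rbrakk> \<Longrightarrow>
        \<Gamma> X A B (madd T A B a a') x y = tadd T X B (\<Gamma> X A B a x y) (\<Gamma> X A B a' x y)"
    and associativity:
      "\<lbrakk>X \<in> TObj T; A \<in> TObj T; B \<in> TObj T;
        x \<in> maps T X A; y \<in> maps T X A; z \<in> maps T X A; a \<in> maps T A B\<rbrakk> \<Longrightarrow>
        Comp (Hom T X B)
          (tadd T X B (\<Gamma> X A B a x y) (idtr T X B (mcomp T X A B a z)))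
          (\<Gamma> X A B a (madd T X A x y) z) =
        Comp (Hom T X B)
          (tadd T X B (idtr T X B (mcomp T X A B a x)) (\<Gamma> X A B a y z))
          (\<Gamma> X A B a x (madd T X A y z))"
    and naturality_right:
      "\<lbrakk>X \<in> TObj T; A \<in> TObj T; B \<in> TObj T; a \<in> maps T A B;
        arrow (Hom T X A) G x x'; arrow (Hom T X A) H y y'\<rbrakk> \<Longrightarrow>
        Comp (Hom T X B)
          (tadd T X B (whiskl T X A B a G) (whiskl T X A B a H))
          (\<Gamma> X A B a x y) =
        Comp (Hom T X B)
          (\<Gamma> X A B a x' y')
          (whiskl T X A B a (tadd T X A G H))"
    and naturality_left:
      "\<lbrakk>X \<in> TObj T; A \<in> TObj T; B \<in> TObj T; x \<in> maps T X A; y \<in> maps T X A;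
        arrow (Hom T A B) \<alpha> a a'\<rbrakk> \<Longrightarrow>
        Comp (Hom T X B)
          (tadd T X B (whiskr T X A B \<alpha> x) (whiskr T X A B \<alpha> y))
          (\<Gamma> X A B a x y) =
        Comp (Hom T X B)
          (\<Gamma> X A B a' x y)
          (whiskr T X A B \<alpha> (madd T X A x y))"


section \<open>Weak equivalence of track categories\<close>

definition is_track_functor ::
  "('o, 'm, 't, 'e) track_category_scheme \<Rightarrow> ('p, 'n, 's, 'd) track_category_scheme \<Rightarrow>
    ('o \<Rightarrow> 'p) \<Rightarrow> ('o \<Rightarrow> 'o \<Rightarrow> 'm \<Rightarrow> 'n) \<Rightarrow> ('o \<Rightarrow> 'o \<Rightarrow> 't \<Rightarrow> 's) \<Rightarrow> bool" where
  "is_track_functor S T Fo Fm Ft \<longleftrightarrow>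
    track_category S \<and> track_category T \<and>
    (\<forall>A\<in>TObj S. Fo A \<in> TObj T) \<and>
    (\<forall>A\<in>TObj S. \<forall>B\<in>TObj S.
      is_functor (Hom S A B) (Hom T (Fo A) (Fo B)) (Fm A B) (Ft A B)) \<and>
    (\<forall>A\<in>TObj S. Fm A A (unit_map S A) = unit_map T (Fo A)) \<and>
    (\<forall>A\<in>TObj S. \<forall>B\<in>TObj S. \<forall>C\<in>TObj S. \<forall>a\<in>maps S B C. \<forall>x\<in>maps S A B.
      Fm A C (mcomp S A B C a x) = mcomp T (Fo A) (Fo B) (Fo C) (Fm B C a) (Fm A B x)) \<and>
    (\<forall>A\<in>TObj S. \<forall>B\<in>TObj S. \<forall>C\<in>TObj S. \<forall>\<alpha>\<in>tracks S B C. \<forall>\<xi>\<in>tracks S A B.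
      Ft A C (tcomp S A B C \<alpha> \<xi>) = tcomp T (Fo A) (Fo B) (Fo C) (Ft B C \<alpha>) (Ft A B \<xi>))"

text \<open>A morphism of the homotopy category is a triple \<open>(A, B, c)\<close> with \<open>c\<close> a connected component of
  \<open>Hom T A B\<close>. The composite of two components is the component of the composites of
  representatives, written as a union over all of them.\<close>

definition homotopy_category ::
  "('o, 'm, 't, 'e) track_category_scheme \<Rightarrow> ('o, 'o \<times> 'o \<times> 'm set) category" where
  "homotopy_category T =
    \<lparr>Obj = TObj T,
     Arr = {(A, B, c). A \<in> TObj T \<and> B \<in> TObj T \<and> c \<in> maps T A B // conn (Hom T A B)},
     Src = (\<lambda>(A, B, c). A),
     Tgt = (\<lambda>(A, B, c). B),
     Ident = (\<lambda>A. (A, A, conn (Hom T A A) `` {unit_map T A})),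
     Comp = (\<lambda>(B, C, d) (A, B', c).
       (A, C, \<Union>a\<in>d. \<Union>x\<in>c. conn (Hom T A C) `` {mcomp T A B C a x}))\<rparr>"

definition homotopy_functor_arr ::
  "('p, 'n, 's, 'd) track_category_scheme \<Rightarrow> ('o \<Rightarrow> 'p) \<Rightarrow> ('o \<Rightarrow> 'o \<Rightarrow> 'm \<Rightarrow> 'n) \<Rightarrow>
    'o \<times> 'o \<times> 'm set \<Rightarrow> 'p \<times> 'p \<times> 'n set" where
  "homotopy_functor_arr T Fo Fm =
    (\<lambda>(A, B, c). (Fo A, Fo B, conn (Hom T (Fo A) (Fo B)) `` (Fm A B ` c)))"

definition DK_equivalence ::
  "('o, 'm, 't, 'e) track_category_scheme \<Rightarrow> ('p, 'n, 's, 'd) track_category_scheme \<Rightarrow>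
    ('o \<Rightarrow> 'p) \<Rightarrow> ('o \<Rightarrow> 'o \<Rightarrow> 'm \<Rightarrow> 'n) \<Rightarrow> ('o \<Rightarrow> 'o \<Rightarrow> 't \<Rightarrow> 's) \<Rightarrow> bool" where
  "DK_equivalence S T Fo Fm Ft \<longleftrightarrow>
    is_track_functor S T Fo Fm Ft \<and>
    (\<forall>A\<in>TObj S. \<forall>B\<in>TObj S.
      is_equivalence (Hom S A B) (Hom T (Fo A) (Fo B)) (Fm A B) (Ft A B)) \<and>
    is_equivalence (homotopy_category S) (homotopy_category T) Fo (homotopy_functor_arr T Fo Fm)"

definition DK_linked ::
  "('o, 'm, 't, 'e) track_category_scheme \<Rightarrow> ('p, 'n, 's, 'd) track_category_scheme \<Rightarrow> bool" where
  "DK_linked S T \<longleftrightarrow>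
    (\<exists>Fo Fm Ft. DK_equivalence S T Fo Fm Ft) \<or> (\<exists>Fo Fm Ft. DK_equivalence T S Fo Fm Ft)"

text \<open>A zigzag \<open>S - Z - \<dots> - T\<close> of DK-equivalences, each in either direction. HOL cannot quantify over
  the types of the intermediate track categories; they are taken to be those of the right end \<open>T\<close>.
  This only makes the relation more demanding. If \<open>S\<close> and \<open>T\<close> have the same types, it is the
  equivalence relation generated by DK-equivalences between track categories of these types.\<close>

definition weakly_equivalent ::
  "('o, 'm, 't, 'e) track_category_scheme \<Rightarrow> ('p, 'n, 's, 'd) track_category_scheme \<Rightarrow> bool" where
  "weakly_equivalent S T \<longleftrightarrow>
    (\<exists>Z :: ('p, 'n, 's, 'd) track_category_scheme. DK_linked S Z \<and> DK_linked\<^sup>*\<^sup>* Z T)"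


section \<open>Truncated DG-categories\<close>

text \<open>The fields \<open>dcomp00\<close>, \<open>dcomp01\<close>, \<open>dcomp10\<close> are the composition in bidegrees \<open>(0,0)\<close>, \<open>(0,1)\<close>,
  \<open>(1,0)\<close>; with indices \<open>A B C\<close> they compose an element of the hom-complex from \<open>B\<close> to \<open>C\<close> with one
  of the hom-complex from \<open>A\<close> to \<open>B\<close>. Only the module structure of the module records is used,
  not their multiplication.\<close>

record ('o, 'r, 'a, 'b) dg_category =
  DObj :: "'o set"
  Deg0 :: "'o \<Rightarrow> 'o \<Rightarrow> ('r, 'a) module"
  Deg1 :: "'o \<Rightarrow> 'o \<Rightarrow> ('r, 'b) module"
  bdry :: "'o \<Rightarrow> 'o \<Rightarrow> 'b \<Rightarrow> 'a"
  dcomp00 :: "'o \<Rightarrow> 'o \<Rightarrow> 'o \<Rightarrow> 'a \<Rightarrow> 'a \<Rightarrow> 'a"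
  dcomp01 :: "'o \<Rightarrow> 'o \<Rightarrow> 'o \<Rightarrow> 'a \<Rightarrow> 'b \<Rightarrow> 'b"
  dcomp10 :: "'o \<Rightarrow> 'o \<Rightarrow> 'o \<Rightarrow> 'b \<Rightarrow> 'a \<Rightarrow> 'b"
  dunit :: "'o \<Rightarrow> 'a"

definition is_linear_map ::
  "'r ring \<Rightarrow> ('r, 'a) module \<Rightarrow> ('r, 'b) module \<Rightarrow> ('a \<Rightarrow> 'b) \<Rightarrow> bool" where
  "is_linear_map R M N f \<longleftrightarrow>
    f \<in> carrier M \<rightarrow> carrier N \<and>
    (\<forall>x\<in>carrier M. \<forall>y\<in>carrier M. f (x \<oplus>\<^bsub>M\<^esub> y) = f x \<oplus>\<^bsub>N\<^esub> f y) \<and>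
    (\<forall>r\<in>carrier R. \<forall>x\<in>carrier M. f (r \<odot>\<^bsub>M\<^esub> x) = r \<odot>\<^bsub>N\<^esub> f x)"

definition is_bilinear_map ::
  "'r ring \<Rightarrow> ('r, 'a) module \<Rightarrow> ('r, 'b) module \<Rightarrow> ('r, 'c) module \<Rightarrow> ('a \<Rightarrow> 'b \<Rightarrow> 'c) \<Rightarrow> bool" where
  "is_bilinear_map R L M N f \<longleftrightarrow>
    (\<forall>x\<in>carrier L. is_linear_map R M N (f x)) \<and>
    (\<forall>y\<in>carrier M. is_linear_map R L N (\<lambda>x. f x y))"

locale truncated_dg_category = cring R
  for R :: "'r ring" +
  fixes \<B> :: "('o, 'r, 'a, 'b) dg_category"
  assumes Deg0_module: "\<lbrakk>A \<in> DObj \<B>; B \<in> DObj \<B>\<rbrakk> \<Longrightarrow> module R (Deg0 \<B> A B)"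
    and Deg1_module: "\<lbrakk>A \<in> DObj \<B>; B \<in> DObj \<B>\<rbrakk> \<Longrightarrow> module R (Deg1 \<B> A B)"
    and bdry_linear:
      "\<lbrakk>A \<in> DObj \<B>; B \<in> DObj \<B>\<rbrakk> \<Longrightarrow>
        is_linear_map R (Deg1 \<B> A B) (Deg0 \<B> A B) (bdry \<B> A B)"
    and dcomp00_bilinear:
      "\<lbrakk>A \<in> DObj \<B>; B \<in> DObj \<B>; C \<in> DObj \<B>\<rbrakk> \<Longrightarrow>
        is_bilinear_map R (Deg0 \<B> B C) (Deg0 \<B> A B) (Deg0 \<B> A C) (dcomp00 \<B> A B C)"
    and dcomp01_bilinear:
      "\<lbrakk>A \<in> DObj \<B>; B \<in> DObj \<B>; C \<in> DObj \<B>\<rbrakk> \<Longrightarrow>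
        is_bilinear_map R (Deg0 \<B> B C) (Deg1 \<B> A B) (Deg1 \<B> A C) (dcomp01 \<B> A B C)"
    and dcomp10_bilinear:
      "\<lbrakk>A \<in> DObj \<B>; B \<in> DObj \<B>; C \<in> DObj \<B>\<rbrakk> \<Longrightarrow>
        is_bilinear_map R (Deg1 \<B> B C) (Deg0 \<B> A B) (Deg1 \<B> A C) (dcomp10 \<B> A B C)"
    and assoc000:
      "\<lbrakk>A \<in> DObj \<B>; B \<in> DObj \<B>; C \<in> DObj \<B>; D \<in> DObj \<B>;
        z \<in> carrier (Deg0 \<B> C D); y \<in> carrier (Deg0 \<B> B C); x \<in> carrier (Deg0 \<B> A B)\<rbrakk> \<Longrightarrow>
        dcomp00 \<B> A B D (dcomp00 \<B> B C D z y) x = dcomp00 \<B> A C D z (dcomp00 \<B> A B C y x)"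
    and assoc001:
      "\<lbrakk>A \<in> DObj \<B>; B \<in> DObj \<B>; C \<in> DObj \<B>; D \<in> DObj \<B>;
        z \<in> carrier (Deg0 \<B> C D); y \<in> carrier (Deg0 \<B> B C); b \<in> carrier (Deg1 \<B> A B)\<rbrakk> \<Longrightarrow>
        dcomp01 \<B> A B D (dcomp00 \<B> B C D z y) b = dcomp01 \<B> A C D z (dcomp01 \<B> A B C y b)"
    and assoc010:
      "\<lbrakk>A \<in> DObj \<B>; B \<in> DObj \<B>; C \<in> DObj \<B>; D \<in> DObj \<B>;
        z \<in> carrier (Deg0 \<B> C D); b \<in> carrier (Deg1 \<B> B C); x \<in> carrier (Deg0 \<B> A B)\<rbrakk> \<Longrightarrow>
        dcomp10 \<B> A B D (dcomp01 \<B> B C D z b) x = dcomp01 \<B> A C D z (dcomp10 \<B> A B C b x)"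
    and assoc100:
      "\<lbrakk>A \<in> DObj \<B>; B \<in> DObj \<B>; C \<in> DObj \<B>; D \<in> DObj \<B>;
        b \<in> carrier (Deg1 \<B> C D); y \<in> carrier (Deg0 \<B> B C); x \<in> carrier (Deg0 \<B> A B)\<rbrakk> \<Longrightarrow>
        dcomp10 \<B> A B D (dcomp10 \<B> B C D b y) x = dcomp10 \<B> A C D b (dcomp00 \<B> A B C y x)"
    and dunit_closed: "A \<in> DObj \<B> \<Longrightarrow> dunit \<B> A \<in> carrier (Deg0 \<B> A A)"
    and dunit_left0:
      "\<lbrakk>A \<in> DObj \<B>; B \<in> DObj \<B>; x \<in> carrier (Deg0 \<B> A B)\<rbrakk> \<Longrightarrow>
        dcomp00 \<B> A B B (dunit \<B> B) x = x"
    and dunit_right0: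
      "\<lbrakk>A \<in> DObj \<B>; B \<in> DObj \<B>; x \<in> carrier (Deg0 \<B> A B)\<rbrakk> \<Longrightarrow>
        dcomp00 \<B> A A B x (dunit \<B> A) = x"
    and dunit_left1:
      "\<lbrakk>A \<in> DObj \<B>; B \<in> DObj \<B>; b \<in> carrier (Deg1 \<B> A B)\<rbrakk> \<Longrightarrow>
        dcomp01 \<B> A B B (dunit \<B> B) b = b"
    and dunit_right1:
      "\<lbrakk>A \<in> DObj \<B>; B \<in> DObj \<B>; a \<in> carrier (Deg1 \<B> A B)\<rbrakk> \<Longrightarrow>
        dcomp10 \<B> A A B a (dunit \<B> A) = a"
    and bdry_dcomp01:
      "\<lbrakk>A \<in> DObj \<B>; B \<in> DObj \<B>; C \<in> DObj \<B>;
        x \<in> carrier (Deg0 \<B> B C); b \<in> carrier (Deg1 \<B> A B)\<rbrakk> \<Longrightarrow>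
        bdry \<B> A C (dcomp01 \<B> A B C x b) = dcomp00 \<B> A B C x (bdry \<B> A B b)"
    and bdry_dcomp10:
      "\<lbrakk>A \<in> DObj \<B>; B \<in> DObj \<B>; C \<in> DObj \<B>;
        a \<in> carrier (Deg1 \<B> B C); y \<in> carrier (Deg0 \<B> A B)\<rbrakk> \<Longrightarrow>
        bdry \<B> A C (dcomp10 \<B> A B C a y) = dcomp00 \<B> A B C (bdry \<B> B C a) y"
    and bdry_exchange:
      "\<lbrakk>A \<in> DObj \<B>; B \<in> DObj \<B>; C \<in> DObj \<B>;
        a \<in> carrier (Deg1 \<B> B C); b \<in> carrier (Deg1 \<B> A B)\<rbrakk> \<Longrightarrow>
        dcomp01 \<B> A B C (bdry \<B> B C a) b = dcomp10 \<B> A B C a (bdry \<B> A B b)"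

definition \<Theta>_Hom ::
  "('o, 'r, 'a, 'b) dg_category \<Rightarrow> 'o \<Rightarrow> 'o \<Rightarrow> ('a, 'b \<times> 'a) category" where
  "\<Theta>_Hom \<B> A B =
    \<lparr>Obj = carrier (Deg0 \<B> A B),
     Arr = carrier (Deg1 \<B> A B) \<times> carrier (Deg0 \<B> A B),
     Src = (\<lambda>(x1, x0). bdry \<B> A B x1 \<oplus>\<^bsub>Deg0 \<B> A B\<^esub> x0),
     Tgt = (\<lambda>(x1, x0). x0),
     Ident = (\<lambda>x. (\<zero>\<^bsub>Deg1 \<B> A B\<^esub>, x)),
     Comp = (\<lambda>(x1, x0) (y1, y0). (x1 \<oplus>\<^bsub>Deg1 \<B> A B\<^esub> y1, x0))\<rparr>"

definition \<Theta> ::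
  "('o, 'r, 'a, 'b) dg_category \<Rightarrow> ('o, 'a, 'b \<times> 'a) track_category" where
  "\<Theta> \<B> =
    \<lparr>TObj = DObj \<B>,
     Hom = \<Theta>_Hom \<B>,
     mcomp = dcomp00 \<B>,
     tcomp = (\<lambda>A B C (a1, a0) (b1, b0).
       (dcomp10 \<B> A B C a1 b0 \<oplus>\<^bsub>Deg1 \<B> A C\<^esub> dcomp01 \<B> A B C a0 b1
          \<oplus>\<^bsub>Deg1 \<B> A C\<^esub> dcomp01 \<B> A B C (bdry \<B> B C a1) b1,
        dcomp00 \<B> A B C a0 b0)),
     unit_map = dunit \<B>\<rparr>"

end

(* Tracks in an abelian group object compose by beta + alpha - id, so each hom-groupoid is a two-term
   complex, and the linearity tracks become a symmetric cocycle measuring how far a(x + y) is from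
   ax + ay. Let B_0 be the free module on the maps of F and B_1 the pairs (u, k) with k a track from
   the evaluation ev u to 0. Evaluation is not multiplicative, but (ev u)(ev v) and ev (uv) are joined by
   a composite of linearity tracks, and correcting the actions on B_1 by these composites makes B a
   DG-category. A map x goes to the generator [x], and [x][y] = [xy] holds strictly, so
   F -> Theta B is a strict track functor and a DK-equivalence. For p-torsion F, tracks are also
   p-torsion because p k = (p 1) k = 0. The composites of linearity tracks live in an extension of one
   p-torsion group by another, which is killed by p^2, so coefficients can be taken modulo p^2. *)
theory Submission
  imports Defs
begin

section \<open>Additive maps between abelian groups\<close>

text \<open>The composite of linearity tracks from \<open>a\<close> applied to a sum of terms n_i
  x_i to the sum of the n_i (a x_i) must not depend on bracketing, order or cancellation of terms. A
  direct treatment would need a coherence theorem. Instead, for fixed \<open>a\<close>, the cocycle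
  twists the product of maps and tracks into an abelian group, and the composite is the second
  coordinate of the homomorphism from the free module that sends [x] to (x, 0). Symmetry and
  associativity of the linearity tracks become commutativity and associativity of that group, and
  identities between composites follow because homomorphisms are determined on generators. This also
  locates the square of p: a homomorphism out of a free module over Z/N can send generators only to
  elements killed by N, and p times (x, 0) need not vanish in the twisted group. Whiskering by
  \<open>a\<close> fails to be additive in the track by the same cocycle by which the composite
  fails to be additive in the formal sum. Their difference is therefore bilinear, which is what the
  composition of a DG-category has to be.\<close>

context abelian_group
begin

lemma int_add_pow_closed: "x \<in> carrier G \<Longrightarrow> [(k::int)] \<cdot> x \<in> carrier G"
  using group.int_pow_closed[OF a_group] by (simp add: add_pow_def)

lemma int_add_pow_zero: "[(0::int)] \<cdot> x = \<zero>"
  by (simp add: add_pow_def)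

lemma int_add_pow_one: "x \<in> carrier G \<Longrightarrow> [(1::int)] \<cdot> x = x"
  using group.int_pow_1[OF a_group] by (simp add: add_pow_def)

lemma int_add_pow_add: "x \<in> carrier G \<Longrightarrow> [(k + l::int)] \<cdot> x = [k] \<cdot> x \<oplus> [l] \<cdot> x"
  using group.int_pow_mult[OF a_group] by (simp add: add_pow_def)

lemma int_add_pow_minus: "x \<in> carrier G \<Longrightarrow> [(- k::int)] \<cdot> x = \<ominus> ([k] \<cdot> x)"
  using group.int_pow_neg[OF a_group] by (simp add: add_pow_def a_inv_def)

lemma int_add_pow_mult: "x \<in> carrier G \<Longrightarrow> [(k * l::int)] \<cdot> x = [k] \<cdot> ([l] \<cdot> x)"
  using group.int_pow_pow[OF a_group] by (simp add: add_pow_def mult.commute)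

lemma int_add_pow_distrib:
  "\<lbrakk>x \<in> carrier G; y \<in> carrier G\<rbrakk> \<Longrightarrow> [(k::int)] \<cdot> (x \<oplus> y) = [k] \<cdot> x \<oplus> [k] \<cdot> y"
  using comm_group.int_pow_distrib[OF a_comm_group] by (simp add: add_pow_def)

lemma int_add_pow_of_zero: "[(k::int)] \<cdot> \<zero> = \<zero>"
  using group.int_pow_one[OF a_group] by (simp add: add_pow_def)

lemma minus_eq_iff:
  assumes [simp]: "x \<in> carrier G" "y \<in> carrier G" "z \<in> carrier G"
  shows "(x \<ominus> y = z) = (x = z \<oplus> y)"
proof
  assume "x \<ominus> y = z"
  then have "z \<oplus> y = (x \<oplus> \<ominus> y) \<oplus> y" by (simp add: a_minus_def)
  then show "x = z \<oplus> y" by (simp add: a_assoc l_neg)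
next
  assume "x = z \<oplus> y"
  then have "x \<ominus> y = (z \<oplus> y) \<oplus> \<ominus> y" by (simp add: a_minus_def)
  then show "x \<ominus> y = z" by (simp add: a_assoc r_neg)
qed

lemma minus_add_cancel: "\<lbrakk>x \<in> carrier G; y \<in> carrier G\<rbrakk> \<Longrightarrow> (x \<ominus> y) \<oplus> y = x"
  by (simp add: a_minus_def a_assoc l_neg)

text \<open>Used as rewrite rules, these move every difference outwards and across equations, where
  \<open>a_ac\<close> finishes: the abelian group counterpart of \<open>algebra_simps\<close>,
  collected below as \<open>group_simps\<close>.\<close>

lemma add_diff_eqs:
  assumes [simp]: "x \<in> carrier G" "y \<in> carrier G" "z \<in> carrier G"
  shows "x \<oplus> (y \<ominus> z) = (x \<oplus> y) \<ominus> z"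
    and "(x \<ominus> y) \<oplus> z = (x \<oplus> z) \<ominus> y"
    and "(x \<ominus> y) \<ominus> z = x \<ominus> (y \<oplus> z)"
    and "x \<ominus> (y \<ominus> z) = (x \<oplus> z) \<ominus> y"
    and "(x \<ominus> y = z) = (x = z \<oplus> y)"
    and "(z = x \<ominus> y) = (z \<oplus> y = x)"
    and "x \<oplus> (\<ominus> y) = x \<ominus> y"
    and "(\<ominus> x) \<oplus> y = y \<ominus> x"
    and "x \<ominus> (\<ominus> y) = x \<oplus> y"
proof -
  show "(x \<ominus> y = z) = (x = z \<oplus> y)" by (simp add: minus_eq_iff)
  then show "(z = x \<ominus> y) = (z \<oplus> y = x)" by metis
  show "x \<oplus> (y \<ominus> z) = (x \<oplus> y) \<ominus> z"
    by (simp add: a_minus_def a_assoc)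
  show "(x \<ominus> y) \<oplus> z = (x \<oplus> z) \<ominus> y"
    by (simp add: a_minus_def a_assoc a_comm[of "\<ominus> y"])
  show "(x \<ominus> y) \<ominus> z = x \<ominus> (y \<oplus> z)"
    by (simp add: a_minus_def a_assoc minus_add)
  show "x \<ominus> (y \<ominus> z) = (x \<oplus> z) \<ominus> y"
    by (simp add: a_minus_def a_assoc minus_add minus_minus a_comm[of z])
  show "x \<oplus> (\<ominus> y) = x \<ominus> y" by (simp add: a_minus_def)
  show "(\<ominus> x) \<oplus> y = y \<ominus> x" by (simp add: a_minus_def a_comm)
  show "x \<ominus> (\<ominus> y) = x \<oplus> y" by (simp add: a_minus_def minus_minus)
qed

lemma zero_minus: "x \<in> carrier G \<Longrightarrow> \<zero> \<ominus> x = \<ominus> x"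
  by (simp add: a_minus_def)

lemma minus_self: "x \<in> carrier G \<Longrightarrow> x \<ominus> x = \<zero>"
  by (simp add: a_minus_def r_neg)

lemma minus_zero: "x \<in> carrier G \<Longrightarrow> x \<ominus> \<zero> = x"
  by (simp add: a_minus_def)

lemmas group_simps = add_diff_eqs zero_minus minus_self minus_zero a_ac

end

text \<open>A homomorphism of additive groups only, stated on ring records so that it applies to the
  groups of maps and tracks and to all groups built from them, before any scalars are
  chosen.\<close>

definition additive_map :: "('a, 'm) ring_scheme \<Rightarrow> ('b, 'n) ring_scheme \<Rightarrow> ('a \<Rightarrow> 'b) \<Rightarrow> bool" where
  "additive_map G H h \<longleftrightarrow> h \<in> carrier G \<rightarrow> carrier H \<and>
    (\<forall>x\<in>carrier G. \<forall>y\<in>carrier G. h (x \<oplus>\<^bsub>G\<^esub> y) = h x \<oplus>\<^bsub>H\<^esub> h y)"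

lemma additive_mapI:
  assumes "\<And>x. x \<in> carrier G \<Longrightarrow> h x \<in> carrier H"
    and "\<And>x y. \<lbrakk>x \<in> carrier G; y \<in> carrier G\<rbrakk> \<Longrightarrow> h (x \<oplus>\<^bsub>G\<^esub> y) = h x \<oplus>\<^bsub>H\<^esub> h y"
  shows "additive_map G H h"
  using assms by (auto simp: additive_map_def)

lemma additive_map_closed: "\<lbrakk>additive_map G H h; x \<in> carrier G\<rbrakk> \<Longrightarrow> h x \<in> carrier H"
  by (auto simp: additive_map_def)

lemma additive_map_add:
  "\<lbrakk>additive_map G H h; x \<in> carrier G; y \<in> carrier G\<rbrakk> \<Longrightarrow> h (x \<oplus>\<^bsub>G\<^esub> y) = h x \<oplus>\<^bsub>H\<^esub> h y"
  by (auto simp: additive_map_def)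

lemma additive_map_comp:
  "\<lbrakk>additive_map G H h; additive_map H K k\<rbrakk> \<Longrightarrow> additive_map G K (\<lambda>x. k (h x))"
  by (auto simp: additive_map_def Pi_iff)

lemma additive_map_group_hom:
  assumes "abelian_group G" "abelian_group H" "additive_map G H h"
  shows "group_hom (add_monoid G) (add_monoid H) h"
  using assms
  by (auto simp: group_hom_def group_hom_axioms_def abelian_group.a_group hom_def additive_map_def)

lemma additive_map_zero:
  "\<lbrakk>abelian_group G; abelian_group H; additive_map G H h\<rbrakk> \<Longrightarrow> h \<zero>\<^bsub>G\<^esub> = \<zero>\<^bsub>H\<^esub>"
  using group_hom.hom_one[OF additive_map_group_hom] by fastforce

lemma additive_map_minus:
  "\<lbrakk>abelian_group G; abelian_group H; additive_map G H h; x \<in> carrier G\<rbrakk> \<Longrightarrow>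
    h (\<ominus>\<^bsub>G\<^esub> x) = \<ominus>\<^bsub>H\<^esub> h x"
  using group_hom.hom_inv[OF additive_map_group_hom] by (fastforce simp: a_inv_def)

lemma additive_map_diff:
  "\<lbrakk>abelian_group G; abelian_group H; additive_map G H h; x \<in> carrier G; y \<in> carrier G\<rbrakk> \<Longrightarrow>
    h (x \<ominus>\<^bsub>G\<^esub> y) = h x \<ominus>\<^bsub>H\<^esub> h y"
  by (simp add: a_minus_def additive_map_add additive_map_minus abelian_group.a_inv_closed)

lemma additive_map_int_pow:
  "\<lbrakk>abelian_group G; abelian_group H; additive_map G H h; x \<in> carrier G\<rbrakk> \<Longrightarrow>
    h ([(k::int)] \<cdot>\<^bsub>G\<^esub> x) = [k] \<cdot>\<^bsub>H\<^esub> h x"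
  using group_hom.hom_int_pow[OF additive_map_group_hom] by (fastforce simp: add_pow_def)


section \<open>Free modules over the integers modulo \<open>N\<close>\<close>

text \<open>Everything is uniform in \<open>N\<close> because \<open>k mod 0 = k\<close>, so \<open>N = 0\<close> gives the integers.\<close>

locale torsion_group = abelian_group G for N :: int and G (structure) +
  assumes torsion: "x \<in> carrier G \<Longrightarrow> [N] \<cdot> x = \<zero>"
begin

text \<open>\<open>N\<close> kills the group, so only the residue of a coefficient matters. This
  permits coefficients to be kept as reduced integers.\<close>

lemma int_pow_mod: "x \<in> carrier G \<Longrightarrow> [(k mod N)] \<cdot> x = [k] \<cdot> x"
proof -
  assume x: "x \<in> carrier G"
  have "[k] \<cdot> x = [((k div N) * N + k mod N)] \<cdot> x" by simp
  also have "\<dots> = [(k mod N)] \<cdot> x"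
    using x by (simp only: int_add_pow_add int_add_pow_mult torsion int_add_pow_of_zero
        l_zero int_add_pow_closed)
  finally show ?thesis by simp
qed

end

text \<open>Coefficients are integers in normal form, that is, fixed by \<open>mod N\<close>.
  Equality in the free module is then equality of functions, and the integral and the modular case
  have the same type. \<open>mult\<close> and \<open>one\<close> are placeholders of the
  record.\<close>

definition free_group :: "int \<Rightarrow> 'x set \<Rightarrow> ('x \<Rightarrow> int) ring" where
  "free_group N S =
    \<lparr>carrier = {u. finite {x. u x \<noteq> 0} \<and> {x. u x \<noteq> 0} \<subseteq> S \<and> (\<forall>x. u x mod N = u x)},
     mult = (\<lambda>u v. u), one = (\<lambda>_. 0), zero = (\<lambda>_. 0),
     add = (\<lambda>u v x. (u x + v x) mod N)\<rparr>"

text \<open>The coefficient is \<open>1 mod N\<close> and not \<open>1\<close> because it must be a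
  normal form for every \<open>N\<close>; for \<open>N = 1\<close> the generator is 0.\<close>

definition single :: "int \<Rightarrow> 'x \<Rightarrow> 'x \<Rightarrow> int" where
  "single N x = (\<lambda>y. if y = x then 1 mod N else 0)"

definition linear_extension :: "('g, 'm) ring_scheme \<Rightarrow> ('x \<Rightarrow> 'g) \<Rightarrow> ('x \<Rightarrow> int) \<Rightarrow> 'g" where
  "linear_extension G f u = finsum G (\<lambda>x. [(u x)] \<cdot>\<^bsub>G\<^esub> f x) {x. u x \<noteq> 0}"

lemma free_group_add_closed:
  assumes "u \<in> carrier (free_group N S)" "v \<in> carrier (free_group N S)"
  shows "u \<oplus>\<^bsub>free_group N S\<^esub> v \<in> carrier (free_group N S)"
proof -
  have sub: "{x. (u x + v x) mod N \<noteq> 0} \<subseteq> {x. u x \<noteq> 0} \<union> {x. v x \<noteq> 0}" by auto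
  show ?thesis using assms finite_subset[OF sub] sub by (auto simp: free_group_def)
qed

lemma free_group_uminus_closed:
  assumes "u \<in> carrier (free_group N S)"
  shows "(\<lambda>x. (- u x) mod N) \<in> carrier (free_group N S)"
proof -
  have sub: "{x. (- u x) mod N \<noteq> 0} \<subseteq> {x. u x \<noteq> 0}" by auto
  show ?thesis using assms finite_subset[OF sub] sub by (auto simp: free_group_def)
qed

lemma free_group_abelian_group: "abelian_group (free_group N S)"
proof (rule abelian_groupI)
  fix u v w assume "u \<in> carrier (free_group N S)" "v \<in> carrier (free_group N S)"
    "w \<in> carrier (free_group N S)"
  then show "(u \<oplus>\<^bsub>free_group N S\<^esub> v) \<oplus>\<^bsub>free_group N S\<^esub> w =
      u \<oplus>\<^bsub>free_group N S\<^esub> (v \<oplus>\<^bsub>free_group N S\<^esub> w)"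
    by (simp add: free_group_def mod_simps add.assoc)
next
  fix u assume u: "u \<in> carrier (free_group N S)"
  show "\<exists>v \<in> carrier (free_group N S). v \<oplus>\<^bsub>free_group N S\<^esub> u = \<zero>\<^bsub>free_group N S\<^esub>"
    by (rule bexI[OF _ free_group_uminus_closed[OF u]]) (simp add: free_group_def mod_simps)
qed (auto simp: free_group_add_closed, auto simp: free_group_def add.commute)

lemma single_closed: "x \<in> S \<Longrightarrow> single N x \<in> carrier (free_group N S)"
  by (auto simp: free_group_def single_def)

text \<open>Integer multiples are defined through the abstract group power; induction from 0 in both
  directions identifies them with pointwise multiplication of coefficients.\<close>

lemma free_group_int_pow:
  assumes u: "u \<in> carrier (free_group N S)"
  shows "[(k::int)] \<cdot>\<^bsub>free_group N S\<^esub> u = (\<lambda>x. (k * u x) mod N)"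
proof -
  interpret abelian_group "free_group N S" by (rule free_group_abelian_group)
  have m: "x \<ominus>\<^bsub>free_group N S\<^esub> u = (\<lambda>y. (x y - u y) mod N)"
    if "x \<in> carrier (free_group N S)" for x
  proof -
    have "(\<lambda>y. (- u y) mod N) \<oplus>\<^bsub>free_group N S\<^esub> u = \<zero>\<^bsub>free_group N S\<^esub>"
      by (simp add: free_group_def mod_simps)
    then have "\<ominus>\<^bsub>free_group N S\<^esub> u = (\<lambda>y. (- u y) mod N)"
      using u free_group_uminus_closed[OF u] by (simp add: minus_equality)
    then show ?thesis
      by (simp add: a_minus_def) (simp add: free_group_def mod_simps)
  qed
  show ?thesis
  proof (induction k rule: int_induct[where k = 0])
    case base
    then show ?case by (simp add: int_add_pow_zero) (simp add: free_group_def)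
  next
    case (step1 i)
    then show ?case
      using u by (simp add: int_add_pow_add int_add_pow_one)
        (simp add: free_group_def mod_simps algebra_simps)
  next
    case (step2 i)
    have "[(i - 1)] \<cdot>\<^bsub>free_group N S\<^esub> u = [i] \<cdot>\<^bsub>free_group N S\<^esub> u \<ominus>\<^bsub>free_group N S\<^esub> u"
      using u int_add_pow_add[of u i "-1"]
      by (simp add: int_add_pow_minus int_add_pow_one a_minus_def)
    then show ?case
      using step2 u int_add_pow_closed[OF u, of i]
      by (simp add: m mod_simps algebra_simps)
  qed
qed

lemma free_group_torsion: "torsion_group N (free_group N S)"
proof -
  have "[N] \<cdot>\<^bsub>free_group N S\<^esub> u = \<zero>\<^bsub>free_group N S\<^esub>" if "u \<in> carrier (free_group N S)" for u
    using that by (simp add: free_group_int_pow) (simp add: free_group_def)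
  then show ?thesis
    by (simp add: torsion_group_def torsion_group_axioms_def free_group_abelian_group)
qed

text \<open>Every element is a finite sum of integer multiples of generators, so closure under
  addition and negation suffices. Identities that are additive in a variable are reduced by this
  rule to generators of that variable.\<close>

lemma free_group_induct [consumes 1, case_names zero single add minus]:
  assumes u: "u \<in> carrier (free_group N S)"
    and zero: "P \<zero>\<^bsub>free_group N S\<^esub>"
    and single: "\<And>x. x \<in> S \<Longrightarrow> P (single N x)"
    and add: "\<And>u v. \<lbrakk>u \<in> carrier (free_group N S); v \<in> carrier (free_group N S); P u; P v\<rbrakk> \<Longrightarrow>
        P (u \<oplus>\<^bsub>free_group N S\<^esub> v)"
    and minus: "\<And>u. \<lbrakk>u \<in> carrier (free_group N S); P u\<rbrakk> \<Longrightarrow> P (\<ominus>\<^bsub>free_group N S\<^esub> u)"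
  shows "P u"
proof -
  interpret abelian_group "free_group N S" by (rule free_group_abelian_group)
  have pow: "P ([k] \<cdot>\<^bsub>free_group N S\<^esub> single N x)" if x: "x \<in> S" for x and k :: int
  proof (induction k rule: int_induct[where k = 0])
    case base
    then show ?case using zero by (simp add: int_add_pow_zero)
  next
    case (step1 i)
    then show ?case using x
      by (simp add: int_add_pow_add int_add_pow_one add single single_closed int_add_pow_closed)
  next
    case (step2 i)
    have "[(i - 1)] \<cdot>\<^bsub>free_group N S\<^esub> single N x =
        [i] \<cdot>\<^bsub>free_group N S\<^esub> single N x \<oplus>\<^bsub>free_group N S\<^esub>
          (\<ominus>\<^bsub>free_group N S\<^esub> single N x)"
      using x int_add_pow_add[of "single N x" i "-1"]
      by (simp add: int_add_pow_minus int_add_pow_one single_closed)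
    then show ?case using x step2
      by (simp add: add minus single single_closed int_add_pow_closed)
  qed
  have "finite {x. u x \<noteq> 0}" using u by (simp add: free_group_def)
  then show ?thesis using u
  proof (induction "{x. u x \<noteq> 0}" arbitrary: u rule: finite_induct)
    case empty
    then have "u = \<zero>\<^bsub>free_group N S\<^esub>" by (auto simp: free_group_def)
    then show ?case using zero by simp
  next
    case (insert x A)
    have x: "x \<in> S" using insert.hyps(4) insert.prems by (auto simp: free_group_def)
    have "A = {y. (u(x := 0)) y \<noteq> 0}" using insert.hyps by auto
    moreover have c: "u(x := 0) \<in> carrier (free_group N S)"
    proof -
      have "{y. (u(x := 0)) y \<noteq> 0} \<subseteq> {x. u x \<noteq> 0}" by auto
      then have "finite {y. (u(x := 0)) y \<noteq> 0}"
        by (rule finite_subset) (use insert.prems in \<open>simp add: free_group_def\<close>)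
      then show ?thesis using insert.prems by (simp add: free_group_def subset_iff)
    qed
    ultimately have P0: "P (u(x := 0))" using insert.hyps(3) by blast
    have m: "u y mod N = u y" for y using insert.prems by (simp add: free_group_def)
    \<comment> \<open>The point \<open>x\<close> is split off: \<open>u\<close> is its restriction
      to the remaining support plus \<open>u x\<close> times the generator at \<open>x\<close>,
      where \<open>mod_mult_right_eq\<close> absorbs the reduced coefficient of
      \<open>single\<close>.\<close>
    have "u y = (u(x := 0) \<oplus>\<^bsub>free_group N S\<^esub> [(u x)] \<cdot>\<^bsub>free_group N S\<^esub> single N x) y" for y
    proof -
      have "(u(x := 0) \<oplus>\<^bsub>free_group N S\<^esub> [(u x)] \<cdot>\<^bsub>free_group N S\<^esub> single N x) y =
          ((if y = x then 0 else u y) + (u x * (if y = x then 1 mod N else 0)) mod N) mod N"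
        by (simp add: free_group_int_pow[OF single_closed[OF x]])
           (simp add: free_group_def single_def)
      also have "\<dots> = u y"
      proof (cases "y = x")
        case True
        then show ?thesis using m[of x] by (simp add: mod_mult_right_eq)
      qed (simp add: m)
      finally show ?thesis by simp
    qed
    then have eq: "u(x := 0) \<oplus>\<^bsub>free_group N S\<^esub> [(u x)] \<cdot>\<^bsub>free_group N S\<^esub> single N x = u"
      by (rule ext[OF sym])
    show ?case
      by (rule subst[where P = P, OF eq])
         (rule add[OF c int_add_pow_closed[OF single_closed[OF x]] P0 pow[OF x]])
  qed
qed

text \<open>Uniqueness half of the universal property of the free module, the source of most
  identities about evaluation and defects.\<close>

lemma additive_map_eqI:
  assumes "abelian_group G" "additive_map (free_group N S) G h" "additive_map (free_group N S) G k"
    and "\<And>x. x \<in> S \<Longrightarrow> h (single N x) = k (single N x)" "u \<in> carrier (free_group N S)"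
  shows "h u = k u"
  using assms(5)
proof (induction rule: free_group_induct)
  case zero
  show ?case using assms(1-3) additive_map_zero[OF free_group_abelian_group] by metis
next
  case (single x)
  then show ?case by (rule assms(4))
next
  case (add u v)
  then show ?case using assms(2,3) by (simp add: additive_map_add)
next
  case (minus u)
  then show ?case
    using assms(1-3) additive_map_minus[OF free_group_abelian_group] by metis
qed

context abelian_group
begin

text \<open>Zero coefficients contribute nothing, so the support may be enlarged; the extensions at
  two elements can then be summed over one common index set.\<close>

lemma linear_extension_superset:
  assumes "f \<in> S \<rightarrow> carrier G" "finite A" "{x. u x \<noteq> 0} \<subseteq> A" "A \<subseteq> S"
  shows "linear_extension G f u = finsum G (\<lambda>x. [(u x)] \<cdot> f x) A"
  unfolding linear_extension_def
  by (rule add.finprod_mono_neutral_cong_left)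
     (use assms in \<open>auto simp: Pi_iff int_add_pow_zero int_add_pow_closed\<close>)

lemma linear_extension_closed:
  assumes "f \<in> S \<rightarrow> carrier G" "u \<in> carrier (free_group N S)"
  shows "linear_extension G f u \<in> carrier G"
  unfolding linear_extension_def
  by (rule finsum_closed) (use assms in \<open>auto simp: Pi_iff int_add_pow_closed free_group_def\<close>)

lemma linear_extension_add_pointwise:
  assumes "f \<in> S \<rightarrow> carrier G" "g \<in> S \<rightarrow> carrier G" "u \<in> carrier (free_group N S)"
  shows "linear_extension G (\<lambda>x. f x \<oplus> g x) u = linear_extension G f u \<oplus> linear_extension G g u"
proof -
  have s: "{x. u x \<noteq> 0} \<subseteq> S" using assms(3) by (auto simp: free_group_def)
  have "linear_extension G (\<lambda>x. f x \<oplus> g x) u =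
      finsum G (\<lambda>x. [(u x)] \<cdot> f x \<oplus> [(u x)] \<cdot> g x) {x. u x \<noteq> 0}"
    unfolding linear_extension_def
    by (rule finsum_cong')
       (use assms s in \<open>auto simp: Pi_iff int_add_pow_closed int_add_pow_distrib subset_iff\<close>)
  also have "\<dots> = linear_extension G f u \<oplus> linear_extension G g u"
    unfolding linear_extension_def
    by (rule finsum_addf) (use assms s in \<open>auto simp: Pi_iff int_add_pow_closed subset_iff\<close>)
  finally show ?thesis .
qed

lemma linear_extension_cong:
  assumes "\<And>x. x \<in> S \<Longrightarrow> f x = g x" "g \<in> S \<rightarrow> carrier G" "u \<in> carrier (free_group N S)"
  shows "linear_extension G f u = linear_extension G g u"
  unfolding linear_extension_def
  by (rule finsum_cong')
     (use assms in \<open>auto simp: Pi_iff int_add_pow_closed free_group_def subset_iff\<close>)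

end

context torsion_group
begin

text \<open>Existence half of the universal property. Coefficients of a sum are reduced modulo
  \<open>N\<close>, which leaves the multiples of \<open>f x\<close> unchanged because
  \<open>N\<close> kills the group.\<close>

lemma linear_extension_additive:
  assumes f: "f \<in> S \<rightarrow> carrier G"
  shows "additive_map (free_group N S) G (linear_extension G f)"
proof (rule additive_mapI)
  fix u v assume u: "u \<in> carrier (free_group N S)" and v: "v \<in> carrier (free_group N S)"
  let ?A = "{x. u x \<noteq> 0} \<union> {x. v x \<noteq> 0}"
  have A: "finite ?A" "?A \<subseteq> S" using u v by (auto simp: free_group_def)
  let ?w = "u \<oplus>\<^bsub>free_group N S\<^esub> v"
  have "linear_extension G f ?w = finsum G (\<lambda>x. [(?w x)] \<cdot> f x) ?A"
    by (rule linear_extension_superset[OF f A(1) _ A(2)]) (auto simp: free_group_def)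
  also have "\<dots> = finsum G (\<lambda>x. [(u x)] \<cdot> f x \<oplus> [(v x)] \<cdot> f x) ?A"
  proof (rule finsum_cong')
    fix x assume "x \<in> ?A"
    then have "f x \<in> carrier G" using A f by auto
    then show "[(?w x)] \<cdot> f x = [(u x)] \<cdot> f x \<oplus> [(v x)] \<cdot> f x"
      by (simp add: free_group_def int_pow_mod int_add_pow_add)
  qed (use A f in \<open>auto simp: int_add_pow_closed Pi_iff subset_iff\<close>)
  also have "\<dots> = finsum G (\<lambda>x. [(u x)] \<cdot> f x) ?A \<oplus> finsum G (\<lambda>x. [(v x)] \<cdot> f x) ?A"
    by (rule finsum_addf) (use A f in \<open>auto simp: int_add_pow_closed Pi_iff subset_iff\<close>)
  also have "finsum G (\<lambda>x. [(u x)] \<cdot> f x) ?A = linear_extension G f u"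
    by (rule linear_extension_superset[OF f A(1) _ A(2), symmetric]) auto
  also have "finsum G (\<lambda>x. [(v x)] \<cdot> f x) ?A = linear_extension G f v"
    by (rule linear_extension_superset[OF f A(1) _ A(2), symmetric]) auto
  finally show "linear_extension G f ?w = linear_extension G f u \<oplus> linear_extension G f v" .
qed (rule linear_extension_closed[OF f])

lemma linear_extension_single:
  assumes "f \<in> S \<rightarrow> carrier G" "x \<in> S"
  shows "linear_extension G f (single N x) = f x"
proof -
  have fx: "f x \<in> carrier G" using assms by auto
  have "linear_extension G f (single N x) = finsum G (\<lambda>y. [(single N x y)] \<cdot> f y) {x}"
    by (rule linear_extension_superset[where S = S]) (use assms in \<open>auto simp: single_def\<close>)
  also have "\<dots> = [(1 mod N)] \<cdot> f x"
    by (simp add: single_def int_add_pow_closed fx)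
  finally show ?thesis using fx by (simp only: int_pow_mod int_add_pow_one)
qed

lemma additive_map_linear_extension_param:
  assumes H: "\<And>x. x \<in> S \<Longrightarrow> additive_map H G (\<lambda>y. f x y)" "u \<in> carrier (free_group N S)"
  shows "additive_map H G (\<lambda>y. linear_extension G (\<lambda>x. f x y) u)"
proof (rule additive_mapI)
  fix y assume y: "y \<in> carrier H"
  show "linear_extension G (\<lambda>x. f x y) u \<in> carrier G"
    by (rule linear_extension_closed[OF _ assms(2)]) (use H(1) y in \<open>auto intro: additive_map_closed\<close>)
next
  fix y z assume y: "y \<in> carrier H" and z: "z \<in> carrier H"
  have c: "(\<lambda>x. f x y) \<in> S \<rightarrow> carrier G" "(\<lambda>x. f x z) \<in> S \<rightarrow> carrier G"
    using H(1) y z by (auto intro: additive_map_closed)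
  have "linear_extension G (\<lambda>x. f x (y \<oplus>\<^bsub>H\<^esub> z)) u = linear_extension G (\<lambda>x. f x y \<oplus> f x z) u"
    by (rule linear_extension_cong[OF _ _ assms(2)]) (use c H(1) y z in \<open>auto simp: additive_map_add\<close>)
  also have "\<dots> = linear_extension G (\<lambda>x. f x y) u \<oplus> linear_extension G (\<lambda>x. f x z) u"
    by (rule linear_extension_add_pointwise[OF c assms(2)])
  finally show "linear_extension G (\<lambda>x. f x (y \<oplus>\<^bsub>H\<^esub> z)) u =
      linear_extension G (\<lambda>x. f x y) u \<oplus> linear_extension G (\<lambda>x. f x z) u" .
qed

end

definition bilinear_extension ::
  "('g, 'm) ring_scheme \<Rightarrow> ('x \<Rightarrow> 'y \<Rightarrow> 'g) \<Rightarrow> ('x \<Rightarrow> int) \<Rightarrow> ('y \<Rightarrow> int) \<Rightarrow> 'g" where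
  "bilinear_extension G f u v = linear_extension G (\<lambda>x. linear_extension G (f x) v) u"

context torsion_group
begin

lemma bilinear_extension_additive_left:
  assumes "\<And>x. x \<in> S \<Longrightarrow> f x \<in> S' \<rightarrow> carrier G" "v \<in> carrier (free_group N S')"
  shows "additive_map (free_group N S) G (\<lambda>u. bilinear_extension G f u v)"
  unfolding bilinear_extension_def
  by (rule linear_extension_additive) (use assms in \<open>auto intro: linear_extension_closed\<close>)

lemma bilinear_extension_additive_right:
  assumes "\<And>x. x \<in> S \<Longrightarrow> f x \<in> S' \<rightarrow> carrier G" "u \<in> carrier (free_group N S)"
  shows "additive_map (free_group N S') G (\<lambda>v. bilinear_extension G f u v)"
  unfolding bilinear_extension_def
  by (rule additive_map_linear_extension_param[OF _ assms(2)]) (use assms in \<open>auto intro: linear_extension_additive\<close>)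

lemma bilinear_extension_single_left:
  assumes "\<And>x. x \<in> S \<Longrightarrow> f x \<in> S' \<rightarrow> carrier G" "x \<in> S" "v \<in> carrier (free_group N S')"
  shows "bilinear_extension G f (single N x) v = linear_extension G (f x) v"
  unfolding bilinear_extension_def
  by (rule linear_extension_single[where S = S]) (use assms in \<open>auto intro: linear_extension_closed\<close>)

end

text \<open>An \<open>N\<close>-torsion group is a module with integer multiples as scalar action.
  Both coefficient rings of the theorem have integers as elements, so one formula serves
  both.\<close>

definition int_module :: "'g ring \<Rightarrow> (int, 'g) module" where
  "int_module G = ring.extend G \<lparr>smult = (\<lambda>k x. [k] \<cdot>\<^bsub>G\<^esub> x)\<rparr>"

lemma int_module_simps [simp]:
  "carrier (int_module G) = carrier G"
  "zero (int_module G) = zero G"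
  "add (int_module G) = add G"
  "smult (int_module G) k x = [k] \<cdot>\<^bsub>G\<^esub> x"
  by (simp_all add: int_module_def ring.defs)

lemma abelian_group_int_module: "abelian_group G \<Longrightarrow> abelian_group (int_module G)"
  by (rule abelian_groupI) (auto dest: abelian_groupE)

text \<open>Common interface of the integers (\<open>N = 0\<close>, since
  \<open>k mod 0 = k\<close>) and of the residue rings. The unit is the literal 1, which excludes
  the modulus 1.\<close>

locale integers_mod = cring R for N :: int and R :: "int ring" (structure) +
  assumes R_add: "r \<oplus> s = (r + s) mod N"
    and R_mult: "r \<otimes> s = (r * s) mod N"
    and R_one: "\<one> = 1"
begin

lemma int_module_module:
  assumes "torsion_group N G"
  shows "module R (int_module G)"
proof -
  interpret G: torsion_group N G by fact
  show ?thesis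
    by (rule module.intro[OF cring_axioms abelian_group_int_module[OF G.abelian_group_axioms]], unfold_locales)
       (auto simp: R_add R_mult R_one G.int_add_pow_closed G.int_add_pow_distrib
        G.int_add_pow_one G.int_pow_mod G.int_add_pow_add G.int_add_pow_mult)
qed

lemma additive_map_linear:
  assumes "abelian_group G" "abelian_group H" "additive_map G H h"
  shows "is_linear_map R (int_module G) (int_module H) h"
  using assms by (auto simp: is_linear_map_def additive_map_int_pow additive_map_closed additive_map_add)

end

lemma integers_mod_int: "integers_mod 0 \<Z>"
  using int_is_cring by (simp add: integers_mod_def integers_mod_axioms_def)

lemma integers_mod_residue_ring:
  assumes "m > 1"
  shows "integers_mod m (residue_ring m)"
proof -
  interpret residues m "residue_ring m" using assms by unfold_locales auto
  show ?thesis
    using cring_axioms by (simp add: integers_mod_def integers_mod_axioms_def residue_ring_def)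
qed

section \<open>Twisted sums by symmetric cocycles\<close>

text \<open>The extension of \<open>P\<close> with kernel \<open>Q\<close> determined by the
  2-cocycle \<open>g\<close>; \<open>mult\<close> and \<open>one\<close> are placeholders of the
  record.\<close>

definition twisted_sum :: "'a ring \<Rightarrow> 'b ring \<Rightarrow> ('a \<Rightarrow> 'a \<Rightarrow> 'b) \<Rightarrow> ('a \<times> 'b) ring" where
  "twisted_sum P Q g =
    \<lparr>carrier = carrier P \<times> carrier Q, mult = (\<lambda>p q. p), one = (\<zero>\<^bsub>P\<^esub>, \<zero>\<^bsub>Q\<^esub>),
     zero = (\<zero>\<^bsub>P\<^esub>, \<zero>\<^bsub>Q\<^esub>),
     add = (\<lambda>(x, k) (y, l). (x \<oplus>\<^bsub>P\<^esub> y, k \<oplus>\<^bsub>Q\<^esub> l \<oplus>\<^bsub>Q\<^esub> g x y))\<rparr>"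

lemma twisted_sum_simps:
  "carrier (twisted_sum P Q g) = carrier P \<times> carrier Q"
  "\<zero>\<^bsub>twisted_sum P Q g\<^esub> = (\<zero>\<^bsub>P\<^esub>, \<zero>\<^bsub>Q\<^esub>)"
  "(x, k) \<oplus>\<^bsub>twisted_sum P Q g\<^esub> (y, l) = (x \<oplus>\<^bsub>P\<^esub> y, k \<oplus>\<^bsub>Q\<^esub> l \<oplus>\<^bsub>Q\<^esub> g x y)"
  by (simp_all add: twisted_sum_def)

locale symmetric_cocycle = P: abelian_group P + Q: abelian_group Q
  for P :: "'a ring" and Q :: "'b ring" +
  fixes g :: "'a \<Rightarrow> 'a \<Rightarrow> 'b"
  assumes closed: "\<lbrakk>x \<in> carrier P; y \<in> carrier P\<rbrakk> \<Longrightarrow> g x y \<in> carrier Q"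
    and sym: "\<lbrakk>x \<in> carrier P; y \<in> carrier P\<rbrakk> \<Longrightarrow> g x y = g y x"
    and zero_right: "x \<in> carrier P \<Longrightarrow> g x \<zero>\<^bsub>P\<^esub> = \<zero>\<^bsub>Q\<^esub>"
    and cocycle: "\<lbrakk>x \<in> carrier P; y \<in> carrier P; z \<in> carrier P\<rbrakk> \<Longrightarrow>
      g x y \<oplus>\<^bsub>Q\<^esub> g (x \<oplus>\<^bsub>P\<^esub> y) z = g y z \<oplus>\<^bsub>Q\<^esub> g x (y \<oplus>\<^bsub>P\<^esub> z)"
begin

text \<open>The cocycle identity is associativity, \<open>sym\<close> is commutativity, and the
  normalisation \<open>zero_right\<close> makes the zero pair neutral.\<close>

lemma twisted_sum_abelian_group: "abelian_group (twisted_sum P Q g)"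
proof (rule abelian_groupI)
  fix p q r
  assume "p \<in> carrier (twisted_sum P Q g)" "q \<in> carrier (twisted_sum P Q g)"
    "r \<in> carrier (twisted_sum P Q g)"
  then obtain x k y l z m where p: "p = (x, k)" "q = (y, l)" "r = (z, m)"
    and [simp]: "x \<in> carrier P" "k \<in> carrier Q" "y \<in> carrier P" "l \<in> carrier Q"
    "z \<in> carrier P" "m \<in> carrier Q"
    by (cases p; cases q; cases r; auto simp: twisted_sum_simps)
  have "k \<oplus>\<^bsub>Q\<^esub> l \<oplus>\<^bsub>Q\<^esub> g x y \<oplus>\<^bsub>Q\<^esub> m \<oplus>\<^bsub>Q\<^esub> g (x \<oplus>\<^bsub>P\<^esub> y) z =
      k \<oplus>\<^bsub>Q\<^esub> l \<oplus>\<^bsub>Q\<^esub> m \<oplus>\<^bsub>Q\<^esub> (g x y \<oplus>\<^bsub>Q\<^esub> g (x \<oplus>\<^bsub>P\<^esub> y) z)"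
    by (simp add: Q.a_ac closed)
  also have "\<dots> = k \<oplus>\<^bsub>Q\<^esub> (l \<oplus>\<^bsub>Q\<^esub> m \<oplus>\<^bsub>Q\<^esub> g y z) \<oplus>\<^bsub>Q\<^esub> g x (y \<oplus>\<^bsub>P\<^esub> z)"
    by (simp only: cocycle \<open>x \<in> carrier P\<close> \<open>y \<in> carrier P\<close> \<open>z \<in> carrier P\<close>)
       (simp add: Q.a_ac closed)
  finally show "(p \<oplus>\<^bsub>twisted_sum P Q g\<^esub> q) \<oplus>\<^bsub>twisted_sum P Q g\<^esub> r =
      p \<oplus>\<^bsub>twisted_sum P Q g\<^esub> (q \<oplus>\<^bsub>twisted_sum P Q g\<^esub> r)"
    by (simp add: p twisted_sum_simps P.a_assoc)
next
  fix p assume "p \<in> carrier (twisted_sum P Q g)"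
  then obtain x k where p: "p = (x, k)" "x \<in> carrier P" "k \<in> carrier Q"
    by (cases p; auto simp: twisted_sum_simps)
  \<comment> \<open>Adding a pair over \<open>- x\<close> to \<open>(x, k)\<close> contributes the
    cocycle at \<open>- x\<close> and \<open>x\<close>, which the second component has to
    cancel.\<close>
  let ?q = "(\<ominus>\<^bsub>P\<^esub> x, \<ominus>\<^bsub>Q\<^esub> (k \<oplus>\<^bsub>Q\<^esub> g (\<ominus>\<^bsub>P\<^esub> x) x))"
  have "?q \<oplus>\<^bsub>twisted_sum P Q g\<^esub> p = \<zero>\<^bsub>twisted_sum P Q g\<^esub>"
    using p by (simp add: twisted_sum_simps P.l_neg Q.a_assoc closed) (simp add: Q.l_neg closed)
  then show "\<exists>q \<in> carrier (twisted_sum P Q g). q \<oplus>\<^bsub>twisted_sum P Q g\<^esub> p = \<zero>\<^bsub>twisted_sum P Q g\<^esub>"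
    using p by (intro bexI[of _ ?q]) (simp_all add: twisted_sum_simps closed)
qed (auto simp: twisted_sum_simps closed P.a_comm Q.a_comm sym zero_right sym[of "\<zero>\<^bsub>P\<^esub>"])

text \<open>Both sides are second components of \<open>(p,0) + (q,0) + (r,0) + (s,0) + (t,0)\<close> in the twisted sum,
  bracketed in two ways.\<close>

lemma cocycle_five:
  assumes [simp]: "p \<in> carrier P" "q \<in> carrier P" "r \<in> carrier P" "s \<in> carrier P" "t \<in> carrier P"
  shows "g p q \<oplus>\<^bsub>Q\<^esub> (g r s \<oplus>\<^bsub>Q\<^esub> g (r \<oplus>\<^bsub>P\<^esub> s) t) \<oplus>\<^bsub>Q\<^esub> g (p \<oplus>\<^bsub>P\<^esub> q) (r \<oplus>\<^bsub>P\<^esub> s \<oplus>\<^bsub>P\<^esub> t) =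
    g p r \<oplus>\<^bsub>Q\<^esub> g q s \<oplus>\<^bsub>Q\<^esub> g (p \<oplus>\<^bsub>P\<^esub> r) (q \<oplus>\<^bsub>P\<^esub> s) \<oplus>\<^bsub>Q\<^esub> g (p \<oplus>\<^bsub>P\<^esub> r \<oplus>\<^bsub>P\<^esub> (q \<oplus>\<^bsub>P\<^esub> s)) t"
proof -
  interpret T: abelian_group "twisted_sum P Q g" by (rule twisted_sum_abelian_group)
  let ?p = "\<lambda>x. (x, \<zero>\<^bsub>Q\<^esub>)"
  have [simp]: "?p x \<in> carrier (twisted_sum P Q g)" if "x \<in> carrier P" for x
    using that by (simp add: twisted_sum_simps)
  have "snd ((?p p \<oplus>\<^bsub>twisted_sum P Q g\<^esub> ?p q) \<oplus>\<^bsub>twisted_sum P Q g\<^esub>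
        ((?p r \<oplus>\<^bsub>twisted_sum P Q g\<^esub> ?p s) \<oplus>\<^bsub>twisted_sum P Q g\<^esub> ?p t)) =
      snd (((?p p \<oplus>\<^bsub>twisted_sum P Q g\<^esub> ?p r) \<oplus>\<^bsub>twisted_sum P Q g\<^esub>
        (?p q \<oplus>\<^bsub>twisted_sum P Q g\<^esub> ?p s)) \<oplus>\<^bsub>twisted_sum P Q g\<^esub> ?p t)"
    by (rule arg_cong[where f = snd]) (simp add: T.a_ac del: twisted_sum_simps)
  then show ?thesis by (simp add: twisted_sum_simps closed)
qed

text \<open>A first multiplication by \<open>k\<close> kills the \<open>P\<close>-coordinate and
  lands in the copy of \<open>Q\<close>; a second one kills that copy.\<close>

lemma twisted_sum_torsion:
  assumes P: "\<And>x. x \<in> carrier P \<Longrightarrow> [(k::int)] \<cdot>\<^bsub>P\<^esub> x = \<zero>\<^bsub>P\<^esub>"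
    and Q: "\<And>x. x \<in> carrier Q \<Longrightarrow> [(k::int)] \<cdot>\<^bsub>Q\<^esub> x = \<zero>\<^bsub>Q\<^esub>"
    and e: "e \<in> carrier (twisted_sum P Q g)"
  shows "[(k * k)] \<cdot>\<^bsub>twisted_sum P Q g\<^esub> e = \<zero>\<^bsub>twisted_sum P Q g\<^esub>"
proof -
  interpret T: abelian_group "twisted_sum P Q g" by (rule twisted_sum_abelian_group)
  have fst: "additive_map (twisted_sum P Q g) P fst"
    by (rule additive_mapI) (auto simp: twisted_sum_simps)
  \<comment> \<open>By \<open>zero_right\<close> the cocycle vanishes at two zeros, so
    \<open>Q\<close> embeds additively.\<close>
  have inc: "additive_map Q (twisted_sum P Q g) (Pair \<zero>\<^bsub>P\<^esub>)"
    by (rule additive_mapI) (auto simp: twisted_sum_simps zero_right)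
  have "fst ([k] \<cdot>\<^bsub>twisted_sum P Q g\<^esub> e) = \<zero>\<^bsub>P\<^esub>"
    using e by (subst additive_map_int_pow[OF T.abelian_group_axioms P.abelian_group_axioms fst])
      (auto simp: P twisted_sum_simps)
  moreover have "[k] \<cdot>\<^bsub>twisted_sum P Q g\<^esub> e \<in> carrier (twisted_sum P Q g)"
    using e by (rule T.int_add_pow_closed)
  ultimately obtain l where l: "[k] \<cdot>\<^bsub>twisted_sum P Q g\<^esub> e = (\<zero>\<^bsub>P\<^esub>, l)" "l \<in> carrier Q"
    by (cases "[k] \<cdot>\<^bsub>twisted_sum P Q g\<^esub> e") (auto simp: twisted_sum_simps)
  have "[(k * k)] \<cdot>\<^bsub>twisted_sum P Q g\<^esub> e = [k] \<cdot>\<^bsub>twisted_sum P Q g\<^esub> (\<zero>\<^bsub>P\<^esub>, l)"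
    using e by (simp add: T.int_add_pow_mult l)
  also have "\<dots> = (\<zero>\<^bsub>P\<^esub>, [k] \<cdot>\<^bsub>Q\<^esub> l)"
    using additive_map_int_pow[OF Q.abelian_group_axioms T.abelian_group_axioms inc l(2)] by simp
  finally show ?thesis using l by (simp add: Q twisted_sum_simps)
qed

end


section \<open>The DG-category of a linearity cocycle\<close>

text \<open>\<open>M\<close> are the maps and \<open>K\<close> the tracks with target \<open>0\<close>, with source \<open>d\<close>. The cocycle
  \<open>\<gamma> a x y\<close> is \<open>\<Gamma>\<close> translated to have target \<open>0\<close>.\<close>

locale linearity_cocycle =
  fixes N :: int
    and Ob :: "'o set"
    and M :: "'o \<Rightarrow> 'o \<Rightarrow> 'm ring"
    and K :: "'o \<Rightarrow> 'o \<Rightarrow> 't ring"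
    and d :: "'o \<Rightarrow> 'o \<Rightarrow> 't \<Rightarrow> 'm"
    and mm :: "'o \<Rightarrow> 'o \<Rightarrow> 'o \<Rightarrow> 'm \<Rightarrow> 'm \<Rightarrow> 'm"
    and ml :: "'o \<Rightarrow> 'o \<Rightarrow> 'o \<Rightarrow> 'm \<Rightarrow> 't \<Rightarrow> 't"
    and mr :: "'o \<Rightarrow> 'o \<Rightarrow> 'o \<Rightarrow> 't \<Rightarrow> 'm \<Rightarrow> 't"
    and un :: "'o \<Rightarrow> 'm"
    and \<gamma> :: "'o \<Rightarrow> 'o \<Rightarrow> 'o \<Rightarrow> 'm \<Rightarrow> 'm \<Rightarrow> 'm \<Rightarrow> 't"
  assumes M_torsion: "\<lbrakk>A \<in> Ob; B \<in> Ob\<rbrakk> \<Longrightarrow> torsion_group N (M A B)"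
    and K_torsion: "\<lbrakk>A \<in> Ob; B \<in> Ob\<rbrakk> \<Longrightarrow> torsion_group N (K A B)"
    and twisted_torsion: "\<lbrakk>X \<in> Ob; A \<in> Ob; B \<in> Ob; a \<in> carrier (M A B);
        e \<in> carrier (twisted_sum (M X A) (K X B) (\<gamma> X A B a))\<rbrakk> \<Longrightarrow>
        [N] \<cdot>\<^bsub>twisted_sum (M X A) (K X B) (\<gamma> X A B a)\<^esub> e =
          \<zero>\<^bsub>twisted_sum (M X A) (K X B) (\<gamma> X A B a)\<^esub>"
    and d_additive: "\<lbrakk>A \<in> Ob; B \<in> Ob\<rbrakk> \<Longrightarrow> additive_map (K A B) (M A B) (d A B)"
    and un_closed: "A \<in> Ob \<Longrightarrow> un A \<in> carrier (M A A)"
    and mm_additive: "\<lbrakk>X \<in> Ob; A \<in> Ob; B \<in> Ob; x \<in> carrier (M X A)\<rbrakk> \<Longrightarrow>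
        additive_map (M A B) (M X B) (\<lambda>a. mm X A B a x)"
    and mm_assoc: "\<lbrakk>A \<in> Ob; B \<in> Ob; C \<in> Ob; D \<in> Ob;
        x \<in> carrier (M A B); y \<in> carrier (M B C); z \<in> carrier (M C D)\<rbrakk> \<Longrightarrow>
        mm A B D (mm B C D z y) x = mm A C D z (mm A B C y x)"
    and mm_un_left: "\<lbrakk>A \<in> Ob; B \<in> Ob; x \<in> carrier (M A B)\<rbrakk> \<Longrightarrow> mm A B B (un B) x = x"
    and mm_un_right: "\<lbrakk>A \<in> Ob; B \<in> Ob; x \<in> carrier (M A B)\<rbrakk> \<Longrightarrow> mm A A B x (un A) = x"
    and mr_additive: "\<lbrakk>X \<in> Ob; A \<in> Ob; B \<in> Ob; x \<in> carrier (M X A)\<rbrakk> \<Longrightarrow>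
        additive_map (K A B) (K X B) (\<lambda>k. mr X A B k x)"
    and mr_assoc: "\<lbrakk>A \<in> Ob; B \<in> Ob; C \<in> Ob; D \<in> Ob;
        x \<in> carrier (M A B); y \<in> carrier (M B C); k \<in> carrier (K C D)\<rbrakk> \<Longrightarrow>
        mr A B D (mr B C D k y) x = mr A C D k (mm A B C y x)"
    and mr_un: "\<lbrakk>A \<in> Ob; B \<in> Ob; k \<in> carrier (K A B)\<rbrakk> \<Longrightarrow> mr A A B k (un A) = k"
    and d_mr: "\<lbrakk>X \<in> Ob; A \<in> Ob; B \<in> Ob; x \<in> carrier (M X A); k \<in> carrier (K A B)\<rbrakk> \<Longrightarrow>
        d X B (mr X A B k x) = mm X A B (d A B k) x"
    and ml_additive: "\<lbrakk>X \<in> Ob; A \<in> Ob; B \<in> Ob; k \<in> carrier (K X A)\<rbrakk> \<Longrightarrow>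
        additive_map (M A B) (K X B) (\<lambda>a. ml X A B a k)"
    and ml_assoc: "\<lbrakk>A \<in> Ob; B \<in> Ob; C \<in> Ob; D \<in> Ob;
        k \<in> carrier (K A B); y \<in> carrier (M B C); z \<in> carrier (M C D)\<rbrakk> \<Longrightarrow>
        ml A B D (mm B C D z y) k = ml A C D z (ml A B C y k)"
    and ml_mr: "\<lbrakk>A \<in> Ob; B \<in> Ob; C \<in> Ob; D \<in> Ob;
        x \<in> carrier (M A B); k \<in> carrier (K B C); z \<in> carrier (M C D)\<rbrakk> \<Longrightarrow>
        mr A B D (ml B C D z k) x = ml A C D z (mr A B C k x)"
    and ml_un: "\<lbrakk>A \<in> Ob; B \<in> Ob; k \<in> carrier (K A B)\<rbrakk> \<Longrightarrow> ml A B B (un B) k = k"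
    and d_ml: "\<lbrakk>X \<in> Ob; A \<in> Ob; B \<in> Ob; k \<in> carrier (K X A); a \<in> carrier (M A B)\<rbrakk> \<Longrightarrow>
        d X B (ml X A B a k) = mm X A B a (d X A k)"
    and exchange: "\<lbrakk>X \<in> Ob; A \<in> Ob; B \<in> Ob; l \<in> carrier (K X A); k \<in> carrier (K A B)\<rbrakk> \<Longrightarrow>
        ml X A B (d A B k) l = mr X A B k (d X A l)"
    and \<gamma>_cocycle: "\<lbrakk>X \<in> Ob; A \<in> Ob; B \<in> Ob; a \<in> carrier (M A B)\<rbrakk> \<Longrightarrow>
        symmetric_cocycle (M X A) (K X B) (\<gamma> X A B a)"
    and \<gamma>_additive: "\<lbrakk>X \<in> Ob; A \<in> Ob; B \<in> Ob; x \<in> carrier (M X A); y \<in> carrier (M X A)\<rbrakk> \<Longrightarrow>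
        additive_map (M A B) (K X B) (\<lambda>a. \<gamma> X A B a x y)"
    and d_\<gamma>: "\<lbrakk>X \<in> Ob; A \<in> Ob; B \<in> Ob; x \<in> carrier (M X A); y \<in> carrier (M X A); a \<in> carrier (M A B)\<rbrakk> \<Longrightarrow>
        mm X A B a (x \<oplus>\<^bsub>M X A\<^esub> y) =
          d X B (\<gamma> X A B a x y) \<oplus>\<^bsub>M X B\<^esub> (mm X A B a x \<oplus>\<^bsub>M X B\<^esub> mm X A B a y)"
    and \<gamma>_precomp: "\<lbrakk>W \<in> Ob; X \<in> Ob; A \<in> Ob; B \<in> Ob; z \<in> carrier (M W X);
        x \<in> carrier (M X A); y \<in> carrier (M X A); a \<in> carrier (M A B)\<rbrakk> \<Longrightarrow>
        \<gamma> W A B a (mm W X A x z) (mm W X A y z) = mr W X B (\<gamma> X A B a x y) z"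
    and \<gamma>_postcomp: "\<lbrakk>X \<in> Ob; A \<in> Ob; B \<in> Ob; C \<in> Ob; x \<in> carrier (M X A); y \<in> carrier (M X A);
        a \<in> carrier (M A B); b \<in> carrier (M B C)\<rbrakk> \<Longrightarrow>
        \<gamma> X A C (mm A B C b a) x y =
          \<gamma> X B C b (mm X A B a x) (mm X A B a y) \<oplus>\<^bsub>K X C\<^esub> ml X B C b (\<gamma> X A B a x y)
          \<oplus>\<^bsub>K X C\<^esub> \<gamma> X B C b (mm X A B a x \<oplus>\<^bsub>M X B\<^esub> mm X A B a y) (d X B (\<gamma> X A B a x y))"
    and mr_add: "\<lbrakk>X \<in> Ob; A \<in> Ob; B \<in> Ob; x \<in> carrier (M X A); y \<in> carrier (M X A); k \<in> carrier (K A B)\<rbrakk> \<Longrightarrow>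
        mr X A B k (x \<oplus>\<^bsub>M X A\<^esub> y) =
          mr X A B k x \<oplus>\<^bsub>K X B\<^esub> mr X A B k y \<oplus>\<^bsub>K X B\<^esub> \<gamma> X A B (d A B k) x y"
    and ml_add: "\<lbrakk>X \<in> Ob; A \<in> Ob; B \<in> Ob; k \<in> carrier (K X A); l \<in> carrier (K X A); a \<in> carrier (M A B)\<rbrakk> \<Longrightarrow>
        ml X A B a (k \<oplus>\<^bsub>K X A\<^esub> l) =
          ml X A B a k \<oplus>\<^bsub>K X B\<^esub> ml X A B a l \<oplus>\<^bsub>K X B\<^esub> \<gamma> X A B a (d X A k) (d X A l)"
begin

section \<open>Evaluation of formal sums and the defect of a map\<close>

abbreviation free :: "'o \<Rightarrow> 'o \<Rightarrow> ('m \<Rightarrow> int) ring" where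
  "free A B \<equiv> free_group N (carrier (M A B))"

definition ev :: "'o \<Rightarrow> 'o \<Rightarrow> ('m \<Rightarrow> int) \<Rightarrow> 'm" where
  "ev A B = linear_extension (M A B) (\<lambda>x. x)"

abbreviation twisted :: "'o \<Rightarrow> 'o \<Rightarrow> 'o \<Rightarrow> 'm \<Rightarrow> ('m \<times> 't) ring" where
  "twisted X A B a \<equiv> twisted_sum (M X A) (K X B) (\<gamma> X A B a)"

text \<open>The translated composite of linearity tracks from \<open>a (\<Sum> n\<^sub>i x\<^sub>i)\<close> to \<open>\<Sum> n\<^sub>i a x\<^sub>i\<close>.\<close>

definition defect :: "'o \<Rightarrow> 'o \<Rightarrow> 'o \<Rightarrow> 'm \<Rightarrow> ('m \<Rightarrow> int) \<Rightarrow> 't" where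
  "defect X A B a v = snd (linear_extension (twisted X A B a) (\<lambda>x. (x, \<zero>\<^bsub>K X B\<^esub>)) v)"

lemma M_group [simp]: "\<lbrakk>A \<in> Ob; B \<in> Ob\<rbrakk> \<Longrightarrow> abelian_group (M A B)"
  using M_torsion by (simp add: torsion_group_def)

lemma K_group [simp]: "\<lbrakk>A \<in> Ob; B \<in> Ob\<rbrakk> \<Longrightarrow> abelian_group (K A B)"
  using K_torsion by (simp add: torsion_group_def)

lemma twisted_torsion_group:
  "\<lbrakk>X \<in> Ob; A \<in> Ob; B \<in> Ob; a \<in> carrier (M A B)\<rbrakk> \<Longrightarrow> torsion_group N (twisted X A B a)"
  using twisted_torsion
  by (simp add: torsion_group_def torsion_group_axioms_def
      symmetric_cocycle.twisted_sum_abelian_group[OF \<gamma>_cocycle])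

lemmas twisted_group = twisted_torsion_group[THEN torsion_group.axioms(1)]

lemmas M_ops [simp] =
  abelian_monoid.a_closed[OF abelian_group.axioms(1)[OF M_group]]
  abelian_monoid.zero_closed[OF abelian_group.axioms(1)[OF M_group]]
  abelian_group.a_inv_closed[OF M_group] abelian_group.minus_closed[OF M_group]

lemmas K_ops [simp] =
  abelian_monoid.a_closed[OF abelian_group.axioms(1)[OF K_group]]
  abelian_monoid.zero_closed[OF abelian_group.axioms(1)[OF K_group]]
  abelian_group.a_inv_closed[OF K_group] abelian_group.minus_closed[OF K_group]

lemmas free_ops [simp] =
  abelian_monoid.a_closed[OF abelian_group.axioms(1)[OF free_group_abelian_group]]
  abelian_monoid.zero_closed[OF abelian_group.axioms(1)[OF free_group_abelian_group]]
  abelian_group.a_inv_closed[OF free_group_abelian_group]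
  abelian_group.minus_closed[OF free_group_abelian_group]
  single_closed

lemmas closed [simp] =
  un_closed additive_map_closed[OF mm_additive] additive_map_closed[OF mr_additive]
  additive_map_closed[OF ml_additive] additive_map_closed[OF d_additive]
  symmetric_cocycle.closed[OF \<gamma>_cocycle]

lemmas d_simps =
  additive_map_add[OF d_additive] additive_map_zero[OF K_group M_group d_additive]
  additive_map_minus[OF K_group M_group d_additive] additive_map_diff[OF K_group M_group d_additive]

lemma ev_additive: "\<lbrakk>A \<in> Ob; B \<in> Ob\<rbrakk> \<Longrightarrow> additive_map (free A B) (M A B) (ev A B)"
  unfolding ev_def by (rule torsion_group.linear_extension_additive[OF M_torsion]) auto

lemma ev_single [simp]:
  "\<lbrakk>A \<in> Ob; B \<in> Ob; x \<in> carrier (M A B)\<rbrakk> \<Longrightarrow> ev A B (single N x) = x"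
  unfolding ev_def by (subst torsion_group.linear_extension_single[OF M_torsion]) auto

lemmas ev_closed [simp] = additive_map_closed[OF ev_additive]

lemmas ev_simps =
  additive_map_add[OF ev_additive]
  additive_map_zero[OF free_group_abelian_group M_group ev_additive]
  additive_map_minus[OF free_group_abelian_group M_group ev_additive]
  additive_map_diff[OF free_group_abelian_group M_group ev_additive]

context
  fixes X A B a
  assumes Ob [simp]: "X \<in> Ob" "A \<in> Ob" "B \<in> Ob" and a [simp]: "a \<in> carrier (M A B)"
begin

interpretation T: torsion_group N "twisted X A B a"
  by (rule twisted_torsion_group) simp_all

lemma generator_twisted: "(\<lambda>x. (x, \<zero>\<^bsub>K X B\<^esub>)) \<in> carrier (M X A) \<rightarrow> carrier (twisted X A B a)"
  by (simp add: twisted_sum_simps)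

lemmas twisted_linear_extension_additive = T.linear_extension_additive[OF generator_twisted]

text \<open>Projection to maps is a homomorphism and takes the image of a generator back to the
  underlying map, as evaluation does. The first coordinate is therefore \<open>ev\<close>, and the
  new information is the defect.\<close>

lemma twisted_linear_extension:
  assumes v: "v \<in> carrier (free X A)"
  shows "linear_extension (twisted X A B a) (\<lambda>x. (x, \<zero>\<^bsub>K X B\<^esub>)) v = (ev X A v, defect X A B a v)"
proof -
  have "additive_map (twisted X A B a) (M X A) fst"
    by (rule additive_mapI) (auto simp: twisted_sum_simps)
  from additive_map_comp[OF twisted_linear_extension_additive this]
  have "fst (linear_extension (twisted X A B a) (\<lambda>x. (x, \<zero>\<^bsub>K X B\<^esub>)) v) = ev X A v"
    by (rule additive_map_eqI[where h = "\<lambda>v. fst (_ v)",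
          OF M_group[OF Ob(1,2)] _ ev_additive[OF Ob(1,2)] _ v])
       (simp_all add: T.linear_extension_single[OF generator_twisted])
  then show ?thesis by (simp add: defect_def prod_eq_iff)
qed

lemma defect_closed [simp]: "v \<in> carrier (free X A) \<Longrightarrow> defect X A B a v \<in> carrier (K X B)"
  using additive_map_closed[OF twisted_linear_extension_additive, of v]
  by (simp add: twisted_linear_extension twisted_sum_simps)

lemma defect_single: "x \<in> carrier (M X A) \<Longrightarrow> defect X A B a (single N x) = \<zero>\<^bsub>K X B\<^esub>"
  using T.linear_extension_single[OF generator_twisted, of x] by (simp add: defect_def)

text \<open>Additivity of the extension, read in the second coordinate of the twisted sum.\<close>

lemma defect_add:
  assumes "u \<in> carrier (free X A)" "v \<in> carrier (free X A)"
  shows "defect X A B a (u \<oplus>\<^bsub>free X A\<^esub> v) =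
    defect X A B a u \<oplus>\<^bsub>K X B\<^esub> defect X A B a v \<oplus>\<^bsub>K X B\<^esub> \<gamma> X A B a (ev X A u) (ev X A v)"
  using additive_map_add[OF twisted_linear_extension_additive assms] assms
  by (simp add: twisted_linear_extension twisted_sum_simps)

text \<open>Paired with evaluation, such an \<open>h\<close> is a homomorphism into the twisted sum
  with the same values on generators. Identities for defects are proved by verifying this twisted
  additivity for a candidate.\<close>

lemma defect_unique:
  assumes "\<And>v. v \<in> carrier (free X A) \<Longrightarrow> h v \<in> carrier (K X B)"
    and "\<And>u v. \<lbrakk>u \<in> carrier (free X A); v \<in> carrier (free X A)\<rbrakk> \<Longrightarrow>
      h (u \<oplus>\<^bsub>free X A\<^esub> v) = h u \<oplus>\<^bsub>K X B\<^esub> h v \<oplus>\<^bsub>K X B\<^esub> \<gamma> X A B a (ev X A u) (ev X A v)"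
    and "\<And>x. x \<in> carrier (M X A) \<Longrightarrow> h (single N x) = \<zero>\<^bsub>K X B\<^esub>"
    and v: "v \<in> carrier (free X A)"
  shows "h v = defect X A B a v"
proof -
  have "additive_map (free X A) (twisted X A B a) (\<lambda>v. (ev X A v, h v))"
    by (rule additive_mapI) (simp_all add: twisted_sum_simps assms ev_simps)
  then have "(ev X A v, h v) = linear_extension (twisted X A B a) (\<lambda>x. (x, \<zero>\<^bsub>K X B\<^esub>)) v"
    by (rule additive_map_eqI[where h = "\<lambda>v. (ev X A v, h v)",
          OF T.abelian_group_axioms _ twisted_linear_extension_additive _ v])
       (simp_all add: assms T.linear_extension_single[OF generator_twisted])
  then show ?thesis using v by (simp add: twisted_linear_extension)
qed

end

section \<open>Composition in degree 0\<close>

definition comp00 :: "'o \<Rightarrow> 'o \<Rightarrow> 'o \<Rightarrow> ('m \<Rightarrow> int) \<Rightarrow> ('m \<Rightarrow> int) \<Rightarrow> ('m \<Rightarrow> int)" where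
  "comp00 X A B = bilinear_extension (free X B) (\<lambda>a x. single N (mm X A B a x))"

lemma comp00_generators: "\<lbrakk>X \<in> Ob; A \<in> Ob; B \<in> Ob; a \<in> carrier (M A B)\<rbrakk> \<Longrightarrow>
    (\<lambda>x. single N (mm X A B a x)) \<in> carrier (M X A) \<rightarrow> carrier (free X B)"
  by simp

lemma comp00_additive_left: "\<lbrakk>X \<in> Ob; A \<in> Ob; B \<in> Ob; v \<in> carrier (free X A)\<rbrakk> \<Longrightarrow>
    additive_map (free A B) (free X B) (\<lambda>u. comp00 X A B u v)"
  unfolding comp00_def
  by (rule torsion_group.bilinear_extension_additive_left[OF free_group_torsion])
     (auto simp: comp00_generators)

lemma comp00_additive_right: "\<lbrakk>X \<in> Ob; A \<in> Ob; B \<in> Ob; u \<in> carrier (free A B)\<rbrakk> \<Longrightarrow>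
    additive_map (free X A) (free X B) (\<lambda>v. comp00 X A B u v)"
  unfolding comp00_def
  by (rule torsion_group.bilinear_extension_additive_right[OF free_group_torsion])
     (auto simp: comp00_generators)

lemma comp00_single [simp]:
  "\<lbrakk>X \<in> Ob; A \<in> Ob; B \<in> Ob; a \<in> carrier (M A B); x \<in> carrier (M X A)\<rbrakk> \<Longrightarrow>
    comp00 X A B (single N a) (single N x) = single N (mm X A B a x)"
  unfolding comp00_def
  by (subst torsion_group.bilinear_extension_single_left
        [OF free_group_torsion, where S = "carrier (M A B)" and S' = "carrier (M X A)"])
     (auto simp: comp00_generators
       intro!: torsion_group.linear_extension_single[OF free_group_torsion comp00_generators])

lemmas comp00_closed [simp] = additive_map_closed[OF comp00_additive_left]

lemmas comp00_simps =
  additive_map_add[OF comp00_additive_left] additive_map_add[OF comp00_additive_right]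
  additive_map_zero[OF free_group_abelian_group free_group_abelian_group comp00_additive_left]
  additive_map_zero[OF free_group_abelian_group free_group_abelian_group comp00_additive_right]
  additive_map_minus[OF free_group_abelian_group free_group_abelian_group comp00_additive_left]
  additive_map_minus[OF free_group_abelian_group free_group_abelian_group comp00_additive_right]

text \<open>Associativity is additive in each variable, so it is checked on generators; this lemma
  and the next two free the variables one at a time.\<close>

lemma comp00_assoc_single_single:
  assumes [simp]: "A \<in> Ob" "B \<in> Ob" "C \<in> Ob" "D \<in> Ob" "z \<in> carrier (M C D)" "y \<in> carrier (M B C)"
    and "x \<in> carrier (free A B)"
  shows "comp00 A B D (comp00 B C D (single N z) (single N y)) x =
    comp00 A C D (single N z) (comp00 A B C (single N y) x)"
  using assms(7) by (induction rule: free_group_induct) (simp_all add: comp00_simps mm_assoc)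

lemma comp00_assoc_single:
  assumes [simp]: "A \<in> Ob" "B \<in> Ob" "C \<in> Ob" "D \<in> Ob" "z \<in> carrier (M C D)" "x \<in> carrier (free A B)"
    and "y \<in> carrier (free B C)"
  shows "comp00 A B D (comp00 B C D (single N z) y) x =
    comp00 A C D (single N z) (comp00 A B C y x)"
  \<comment> \<open>\<open>comp00_single\<close> stays off so that the composite of two generators
    keeps the shape that \<open>comp00_assoc_single_single\<close> expects.\<close>
  using assms(7) by (induction rule: free_group_induct)
    (simp_all add: comp00_simps comp00_assoc_single_single del: comp00_single)

lemma comp00_assoc:
  assumes [simp]: "A \<in> Ob" "B \<in> Ob" "C \<in> Ob" "D \<in> Ob"
    "y \<in> carrier (free B C)" "x \<in> carrier (free A B)" and "z \<in> carrier (free C D)"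
  shows "comp00 A B D (comp00 B C D z y) x = comp00 A C D z (comp00 A B C y x)"
  using assms(7) by (induction rule: free_group_induct) (simp_all add: comp00_simps comp00_assoc_single)

lemma comp00_un_left:
  assumes [simp]: "A \<in> Ob" "B \<in> Ob" and "x \<in> carrier (free A B)"
  shows "comp00 A B B (single N (un B)) x = x"
  using assms(3) by (induction rule: free_group_induct) (simp_all add: comp00_simps mm_un_left)

lemma comp00_un_right:
  assumes [simp]: "A \<in> Ob" "B \<in> Ob" and "x \<in> carrier (free A B)"
  shows "comp00 A A B x (single N (un A)) = x"
  using assms(3) by (induction rule: free_group_induct) (simp_all add: comp00_simps mm_un_right)

section \<open>The defect under sums and composites of maps\<close>

lemmas mm_simps =
  additive_map_add[OF mm_additive] additive_map_zero[OF M_group M_group mm_additive]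
  additive_map_minus[OF M_group M_group mm_additive] additive_map_diff[OF M_group M_group mm_additive]

lemmas mr_simps =
  additive_map_add[OF mr_additive] additive_map_zero[OF K_group K_group mr_additive]
  additive_map_minus[OF K_group K_group mr_additive] additive_map_diff[OF K_group K_group mr_additive]

lemmas ml_simps =
  additive_map_add[OF ml_additive] additive_map_zero[OF M_group K_group ml_additive]
  additive_map_minus[OF M_group K_group ml_additive] additive_map_diff[OF M_group K_group ml_additive]

lemmas \<gamma>_simps =
  additive_map_add[OF \<gamma>_additive] additive_map_zero[OF M_group K_group \<gamma>_additive]

text \<open>The sum of the defects of \<open>a\<close> and \<open>b\<close> satisfies the twisted
  law of \<open>a + b\<close>, since the cocycle is additive in the map;
  \<open>defect_unique\<close> then applies.\<close>

lemma defect_additive: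
  assumes [simp]: "X \<in> Ob" "A \<in> Ob" "B \<in> Ob" "v \<in> carrier (free X A)"
  shows "additive_map (M A B) (K X B) (\<lambda>a. defect X A B a v)"
proof (rule additive_mapI)
  interpret abelian_group "K X B" by simp
  fix a b assume [simp]: "a \<in> carrier (M A B)" "b \<in> carrier (M A B)"
  show "defect X A B (a \<oplus>\<^bsub>M A B\<^esub> b) v = defect X A B a v \<oplus>\<^bsub>K X B\<^esub> defect X A B b v"
    by (rule defect_unique[symmetric])
       (simp_all add: defect_add defect_single \<gamma>_simps a_ac)
qed simp

lemmas defect_simps =
  additive_map_add[OF defect_additive] additive_map_zero[OF M_group K_group defect_additive]
  additive_map_minus[OF M_group K_group defect_additive]

text \<open>The boundary of the defect measures how far evaluation is from respecting composition.
  Both sides are additive in \<open>v\<close>, because the boundary of the cocycle in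
  \<open>d_\<gamma>\<close> cancels the one coming from \<open>defect_add\<close>.\<close>

lemma ev_comp00_single:
  assumes [simp]: "X \<in> Ob" "A \<in> Ob" "B \<in> Ob" "a \<in> carrier (M A B)" and v: "v \<in> carrier (free X A)"
  shows "ev X B (comp00 X A B (single N a) v) =
    mm X A B a (ev X A v) \<ominus>\<^bsub>M X B\<^esub> d X B (defect X A B a v)"
proof -
  interpret MXB: abelian_group "M X B" by simp
  have "additive_map (free X A) (M X B) (\<lambda>v. ev X B (comp00 X A B (single N a) v))"
    by (rule additive_map_comp[OF comp00_additive_right ev_additive]) simp_all
  moreover have "additive_map (free X A) (M X B)
      (\<lambda>v. mm X A B a (ev X A v) \<ominus>\<^bsub>M X B\<^esub> d X B (defect X A B a v))"
    by (rule additive_mapI) (simp_all add: ev_simps d_\<gamma> d_simps defect_add MXB.group_simps)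
  ultimately show ?thesis
    by (rule additive_map_eqI[where h = "\<lambda>v. ev X B (comp00 X A B (single N a) v)",
          OF M_group[OF assms(1,3)] _ _ _ v])
       (simp_all add: defect_single d_simps MXB.minus_zero)
qed

text \<open>Left linearity makes everything additive in \<open>u\<close>, so the defect of the
  single map \<open>ev u\<close> accounts for a formal sum on the left.\<close>

lemma ev_comp00:
  assumes [simp]: "X \<in> Ob" "A \<in> Ob" "B \<in> Ob" "v \<in> carrier (free X A)" and u: "u \<in> carrier (free A B)"
  shows "ev X B (comp00 X A B u v) =
    mm X A B (ev A B u) (ev X A v) \<ominus>\<^bsub>M X B\<^esub> d X B (defect X A B (ev A B u) v)"
proof -
  interpret MXB: abelian_group "M X B" by simp
  have "additive_map (free A B) (M X B) (\<lambda>u. ev X B (comp00 X A B u v))"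
    by (rule additive_map_comp[OF comp00_additive_left ev_additive]) simp_all
  moreover have "additive_map (free A B) (M X B)
      (\<lambda>u. mm X A B (ev A B u) (ev X A v) \<ominus>\<^bsub>M X B\<^esub> d X B (defect X A B (ev A B u) v))"
    by (rule additive_mapI) (simp_all add: ev_simps mm_simps d_simps defect_simps MXB.group_simps)
  ultimately show ?thesis
    by (rule additive_map_eqI[where h = "\<lambda>u. ev X B (comp00 X A B u v)",
          OF M_group[OF assms(1,3)] _ _ _ u])
       (simp_all add: ev_comp00_single)
qed

lemma ev_comp00_single_right [simp]:
  assumes [simp]: "X \<in> Ob" "A \<in> Ob" "B \<in> Ob" "x \<in> carrier (M X A)" "u \<in> carrier (free A B)"
  shows "ev X B (comp00 X A B u (single N x)) = mm X A B (ev A B u) x"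
  by (simp add: ev_comp00 defect_single d_simps abelian_group.minus_zero[OF M_group])

text \<open>The composite of linearity tracks for \<open>b a\<close> is the one for
  \<open>a\<close>, whiskered by \<open>b\<close>, followed by the one for \<open>b\<close>. The
  track for \<open>a\<close> ends at the evaluation of \<open>[a] v\<close>; translating it to end
  at 0 before whiskering costs the last cocycle term.\<close>

lemma defect_postcomp:
  assumes [simp]: "X \<in> Ob" "A \<in> Ob" "B \<in> Ob" "C \<in> Ob" "a \<in> carrier (M A B)" "b \<in> carrier (M B C)"
    and v: "v \<in> carrier (free X A)"
  shows "defect X A C (mm A B C b a) v =
    defect X B C b (comp00 X A B (single N a) v) \<oplus>\<^bsub>K X C\<^esub> ml X B C b (defect X A B a v)
    \<oplus>\<^bsub>K X C\<^esub> \<gamma> X B C b (ev X B (comp00 X A B (single N a) v)) (d X B (defect X A B a v))"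
proof (rule defect_unique[symmetric, OF _ _ _ _ _ _ _ v])
  interpret KXC: abelian_group "K X C" by simp
  interpret KXB: abelian_group "K X B" by simp
  interpret MXB: abelian_group "M X B" by simp
  interpret \<gamma>: symmetric_cocycle "M X B" "K X C" "\<gamma> X B C b" by (rule \<gamma>_cocycle) simp_all
  show "defect X B C b (comp00 X A B (single N a) v) \<oplus>\<^bsub>K X C\<^esub> ml X B C b (defect X A B a v)
      \<oplus>\<^bsub>K X C\<^esub> \<gamma> X B C b (ev X B (comp00 X A B (single N a) v)) (d X B (defect X A B a v))
      \<in> carrier (K X C)" if "v \<in> carrier (free X A)" for v
    using that by simp
  show "defect X B C b (comp00 X A B (single N a) (single N x)) \<oplus>\<^bsub>K X C\<^esub>
      ml X B C b (defect X A B a (single N x))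
      \<oplus>\<^bsub>K X C\<^esub> \<gamma> X B C b (ev X B (comp00 X A B (single N a) (single N x))) (d X B (defect X A B a (single N x)))
      = \<zero>\<^bsub>K X C\<^esub>" if [simp]: "x \<in> carrier (M X A)" for x
  proof -
    \<comment> \<open>Whiskering is not additive in the track, so its value at zero needs
      \<open>ml_add\<close>, whose cocycle term vanishes there.\<close>
    have "ml X B C b (\<zero>\<^bsub>K X B\<^esub> \<oplus>\<^bsub>K X B\<^esub> \<zero>\<^bsub>K X B\<^esub>) = ml X B C b \<zero>\<^bsub>K X B\<^esub> \<oplus>\<^bsub>K X C\<^esub> ml X B C b \<zero>\<^bsub>K X B\<^esub>"
      by (subst ml_add) (simp_all add: d_simps \<gamma>.zero_right)
    then have "ml X B C b \<zero>\<^bsub>K X B\<^esub> = \<zero>\<^bsub>K X C\<^esub>" by simp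
    then show ?thesis by (simp add: defect_single d_simps \<gamma>.zero_right)
  qed
  fix u v assume [simp]: "u \<in> carrier (free X A)" "v \<in> carrier (free X A)"
  define P Q k l x y
    where "P = comp00 X A B (single N a) u" and "Q = comp00 X A B (single N a) v"
      and "k = defect X A B a u" and "l = defect X A B a v"
      and "x = ev X A u" and "y = ev X A v"
  note defs = P_def Q_def k_def l_def x_def y_def
  have [simp]: "P \<in> carrier (free X B)" "Q \<in> carrier (free X B)" "k \<in> carrier (K X B)"
    "l \<in> carrier (K X B)" "x \<in> carrier (M X A)" "y \<in> carrier (M X A)"
    by (simp_all add: defs)
  define p q r s m where "p = ev X B P" and "q = ev X B Q" and "r = d X B k" and "s = d X B l"
    and "m = \<gamma> X A B a x y"
  have [simp]: "p \<in> carrier (M X B)" "q \<in> carrier (M X B)" "r \<in> carrier (M X B)"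
    "s \<in> carrier (M X B)" "m \<in> carrier (K X B)"
    by (simp_all add: p_def q_def r_def s_def m_def)
  define t where "t = d X B m"
  have [simp]: "t \<in> carrier (M X B)" by (simp add: t_def)
  \<comment> \<open>The formula of \<open>ev_comp00_single\<close> at \<open>u\<close> and at
    \<open>v\<close>, solved for the composites with \<open>a\<close>.\<close>
  have x: "mm X A B a x = p \<oplus>\<^bsub>M X B\<^esub> r" and y: "mm X A B a y = q \<oplus>\<^bsub>M X B\<^esub> s"
    unfolding p_def r_def q_def s_def defs by (simp_all add: ev_comp00_single MXB.minus_eq_iff)
      (simp_all add: MXB.group_simps)
  have ml: "ml X B C b (k \<oplus>\<^bsub>K X B\<^esub> l \<oplus>\<^bsub>K X B\<^esub> m) = ml X B C b k \<oplus>\<^bsub>K X C\<^esub> ml X B C b l \<oplus>\<^bsub>K X C\<^esub> ml X B C b m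
      \<oplus>\<^bsub>K X C\<^esub> (\<gamma> X B C b r s \<oplus>\<^bsub>K X C\<^esub> \<gamma> X B C b (r \<oplus>\<^bsub>M X B\<^esub> s) t)"
    by (simp add: ml_add d_simps KXC.a_ac flip: r_def s_def t_def)
  \<comment> \<open>\<open>?f\<close> collects the cocycle terms of the candidate at
    \<open>u + v\<close>; \<open>?g\<close> collects those of its values at \<open>u\<close> and
    \<open>v\<close> together with the expansion of the cocycle of \<open>b a\<close> by
    \<open>\<gamma>_postcomp\<close>. Both belong to the sum of the same five maps, bracketed
    differently, so \<open>cocycle_five\<close> identifies them.\<close>
  let ?f = "\<gamma> X B C b p q \<oplus>\<^bsub>K X C\<^esub> (\<gamma> X B C b r s \<oplus>\<^bsub>K X C\<^esub> \<gamma> X B C b (r \<oplus>\<^bsub>M X B\<^esub> s) t)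
      \<oplus>\<^bsub>K X C\<^esub> \<gamma> X B C b (p \<oplus>\<^bsub>M X B\<^esub> q) (r \<oplus>\<^bsub>M X B\<^esub> s \<oplus>\<^bsub>M X B\<^esub> t)"
  let ?g = "\<gamma> X B C b p r \<oplus>\<^bsub>K X C\<^esub> \<gamma> X B C b q s \<oplus>\<^bsub>K X C\<^esub> \<gamma> X B C b (p \<oplus>\<^bsub>M X B\<^esub> r) (q \<oplus>\<^bsub>M X B\<^esub> s)
      \<oplus>\<^bsub>K X C\<^esub> \<gamma> X B C b (p \<oplus>\<^bsub>M X B\<^esub> r \<oplus>\<^bsub>M X B\<^esub> (q \<oplus>\<^bsub>M X B\<^esub> s)) t"
  let ?base = "defect X B C b P \<oplus>\<^bsub>K X C\<^esub> defect X B C b Q \<oplus>\<^bsub>K X C\<^esub> ml X B C b k \<oplus>\<^bsub>K X C\<^esub> ml X B C b l \<oplus>\<^bsub>K X C\<^esub> ml X B C b m"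
  have "defect X B C b (P \<oplus>\<^bsub>free X B\<^esub> Q) \<oplus>\<^bsub>K X C\<^esub> ml X B C b (k \<oplus>\<^bsub>K X B\<^esub> l \<oplus>\<^bsub>K X B\<^esub> m)
      \<oplus>\<^bsub>K X C\<^esub> \<gamma> X B C b (ev X B (P \<oplus>\<^bsub>free X B\<^esub> Q)) (d X B (k \<oplus>\<^bsub>K X B\<^esub> l \<oplus>\<^bsub>K X B\<^esub> m)) = ?base \<oplus>\<^bsub>K X C\<^esub> ?f"
    by (simp add: ml defect_add ev_simps d_simps KXC.a_ac flip: p_def q_def r_def s_def t_def)
  also have "?f = ?g" by (rule \<gamma>.cocycle_five) simp_all
  also have "?base \<oplus>\<^bsub>K X C\<^esub> ?g =
      (defect X B C b P \<oplus>\<^bsub>K X C\<^esub> ml X B C b k \<oplus>\<^bsub>K X C\<^esub> \<gamma> X B C b p r) \<oplus>\<^bsub>K X C\<^esub>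
      (defect X B C b Q \<oplus>\<^bsub>K X C\<^esub> ml X B C b l \<oplus>\<^bsub>K X C\<^esub> \<gamma> X B C b q s) \<oplus>\<^bsub>K X C\<^esub>
      \<gamma> X A C (mm A B C b a) x y"
    by (simp add: \<gamma>_postcomp x y KXC.a_ac flip: m_def t_def)
  finally show "defect X B C b (comp00 X A B (single N a) (u \<oplus>\<^bsub>free X A\<^esub> v)) \<oplus>\<^bsub>K X C\<^esub>
      ml X B C b (defect X A B a (u \<oplus>\<^bsub>free X A\<^esub> v)) \<oplus>\<^bsub>K X C\<^esub>
      \<gamma> X B C b (ev X B (comp00 X A B (single N a) (u \<oplus>\<^bsub>free X A\<^esub> v)))
        (d X B (defect X A B a (u \<oplus>\<^bsub>free X A\<^esub> v))) =
      defect X B C b (comp00 X A B (single N a) u) \<oplus>\<^bsub>K X C\<^esub> ml X B C b (defect X A B a u) \<oplus>\<^bsub>K X C\<^esub>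
      \<gamma> X B C b (ev X B (comp00 X A B (single N a) u)) (d X B (defect X A B a u)) \<oplus>\<^bsub>K X C\<^esub>
      (defect X B C b (comp00 X A B (single N a) v) \<oplus>\<^bsub>K X C\<^esub> ml X B C b (defect X A B a v) \<oplus>\<^bsub>K X C\<^esub>
        \<gamma> X B C b (ev X B (comp00 X A B (single N a) v)) (d X B (defect X A B a v))) \<oplus>\<^bsub>K X C\<^esub>
      \<gamma> X A C (mm A B C b a) (ev X A u) (ev X A v)"
    by (simp add: comp00_simps defect_add flip: p_def q_def r_def s_def m_def defs)
qed simp_all

text \<open>Here the first coordinate is \<open>ev v\<close> composed with \<open>z\<close> and not
  \<open>ev v\<close>, so \<open>defect_unique\<close> does not fit. Instead both sides are
  completed to homomorphisms into the twisted sum over \<open>W\<close> and compared on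
  generators.\<close>

lemma defect_precomp:
  assumes [simp]: "W \<in> Ob" "X \<in> Ob" "A \<in> Ob" "B \<in> Ob" "a \<in> carrier (M A B)" "z \<in> carrier (M W X)"
    and v: "v \<in> carrier (free X A)"
  shows "defect W A B a (comp00 W X A v (single N z)) = mr W X B (defect X A B a v) z"
proof -
  have 1: "additive_map (free X A) (twisted W A B a)
      (\<lambda>v. (mm W X A (ev X A v) z, defect W A B a (comp00 W X A v (single N z))))"
    by (rule additive_mapI) (simp_all add: twisted_sum_simps comp00_simps defect_add ev_simps mm_simps)
  have 2: "additive_map (free X A) (twisted W A B a)
      (\<lambda>v. (mm W X A (ev X A v) z, mr W X B (defect X A B a v) z))"
    by (rule additive_mapI)
       (simp_all add: twisted_sum_simps defect_add ev_simps mm_simps mr_simps \<gamma>_precomp)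
  have "(mm W X A (ev X A v) z, defect W A B a (comp00 W X A v (single N z))) =
      (mm W X A (ev X A v) z, mr W X B (defect X A B a v) z)"
    by (rule additive_map_eqI[OF twisted_group 1 2 _ v]) (simp_all add: defect_single mr_simps)
  then show ?thesis by simp
qed

text \<open>The unit acts identically, so the boundary of the cocycle is zero, and
  \<open>\<gamma>_postcomp\<close> for the unit composed with itself says that the cocycle equals
  twice itself.\<close>

lemma \<gamma>_un:
  assumes [simp]: "X \<in> Ob" "A \<in> Ob" "x \<in> carrier (M X A)" "y \<in> carrier (M X A)"
  shows "\<gamma> X A A (un A) x y = \<zero>\<^bsub>K X A\<^esub>"
proof -
  interpret KXA: abelian_group "K X A" by simp
  interpret MXA: abelian_group "M X A" by simp
  interpret \<gamma>: symmetric_cocycle "M X A" "K X A" "\<gamma> X A A (un A)" by (rule \<gamma>_cocycle) simp_all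
  have "d X A (\<gamma> X A A (un A) x y) = \<zero>\<^bsub>M X A\<^esub>"
    using d_\<gamma>[of X A A x y "un A"] by (simp add: mm_un_left)
  then show ?thesis
    using \<gamma>_postcomp[of X A A A x y "un A" "un A"]
    by (simp add: mm_un_left ml_un \<gamma>.zero_right)
qed

lemma defect_un:
  assumes [simp]: "X \<in> Ob" "A \<in> Ob" "v \<in> carrier (free X A)"
  shows "defect X A A (un A) v = \<zero>\<^bsub>K X A\<^esub>"
proof -
  interpret KXA: abelian_group "K X A" by simp
  show ?thesis by (rule defect_unique[symmetric]) (simp_all add: \<gamma>_un)
qed

text \<open>The pullback of \<open>ev\<close> along \<open>d\<close>. Its first projection has the
  same kernel as \<open>d\<close> and, as \<open>ev\<close> is onto, the same cokernel, so replacing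
  maps by formal sums does not change the homology of the hom-complexes.\<close>

definition hom1 :: "'o \<Rightarrow> 'o \<Rightarrow> (('m \<Rightarrow> int) \<times> 't) ring" where
  "hom1 A B =
    \<lparr>carrier = {(u, k). u \<in> carrier (free A B) \<and> k \<in> carrier (K A B) \<and> d A B k = ev A B u},
     mult = (\<lambda>p q. p), one = (\<zero>\<^bsub>free A B\<^esub>, \<zero>\<^bsub>K A B\<^esub>),
     zero = (\<zero>\<^bsub>free A B\<^esub>, \<zero>\<^bsub>K A B\<^esub>),
     add = (\<lambda>(u, k) (v, l). (u \<oplus>\<^bsub>free A B\<^esub> v, k \<oplus>\<^bsub>K A B\<^esub> l))\<rparr>"

lemma hom1_simps:
  "p \<in> carrier (hom1 A B) \<longleftrightarrow> fst p \<in> carrier (free A B) \<and> snd p \<in> carrier (K A B) \<and>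
    d A B (snd p) = ev A B (fst p)"
  "\<zero>\<^bsub>hom1 A B\<^esub> = (\<zero>\<^bsub>free A B\<^esub>, \<zero>\<^bsub>K A B\<^esub>)"
  "p \<oplus>\<^bsub>hom1 A B\<^esub> q = (fst p \<oplus>\<^bsub>free A B\<^esub> fst q, snd p \<oplus>\<^bsub>K A B\<^esub> snd q)"
  by (auto simp: hom1_def split: prod.splits)

lemma hom1_group:
  assumes [simp]: "A \<in> Ob" "B \<in> Ob"
  shows "abelian_group (hom1 A B)"
proof (rule abelian_groupI)
  interpret K: abelian_group "K A B" by simp
  interpret F: abelian_group "free A B" by (rule free_group_abelian_group)
  fix p assume p: "p \<in> carrier (hom1 A B)"
  then show "\<exists>q \<in> carrier (hom1 A B). q \<oplus>\<^bsub>hom1 A B\<^esub> p = \<zero>\<^bsub>hom1 A B\<^esub>"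
    by (intro bexI[of _ "(\<ominus>\<^bsub>free A B\<^esub> fst p, \<ominus>\<^bsub>K A B\<^esub> snd p)"])
       (simp_all add: hom1_simps d_simps ev_simps K.l_neg F.l_neg)
  show "\<zero>\<^bsub>hom1 A B\<^esub> \<oplus>\<^bsub>hom1 A B\<^esub> p = p" using p by (simp add: hom1_simps prod_eq_iff)
  fix q assume q: "q \<in> carrier (hom1 A B)"
  show "p \<oplus>\<^bsub>hom1 A B\<^esub> q \<in> carrier (hom1 A B)" "p \<oplus>\<^bsub>hom1 A B\<^esub> q = q \<oplus>\<^bsub>hom1 A B\<^esub> p"
    using p q by (simp_all add: hom1_simps d_simps ev_simps K.a_comm F.a_comm)
  fix r assume r: "r \<in> carrier (hom1 A B)"
  show "(p \<oplus>\<^bsub>hom1 A B\<^esub> q) \<oplus>\<^bsub>hom1 A B\<^esub> r = p \<oplus>\<^bsub>hom1 A B\<^esub> (q \<oplus>\<^bsub>hom1 A B\<^esub> r)"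
    using p q r by (simp add: hom1_simps K.a_assoc F.a_assoc)
qed (simp add: hom1_simps d_simps ev_simps)

lemma fst_hom1_additive: "additive_map (hom1 A B) (free A B) fst"
  by (rule additive_mapI) (simp_all add: hom1_simps)

lemma snd_hom1_additive: "additive_map (hom1 A B) (K A B) snd"
  by (rule additive_mapI) (simp_all add: hom1_simps)

lemma hom1_torsion:
  assumes [simp]: "A \<in> Ob" "B \<in> Ob"
  shows "torsion_group N (hom1 A B)"
proof -
  interpret H: abelian_group "hom1 A B" by (rule hom1_group) simp_all
  have "[N] \<cdot>\<^bsub>hom1 A B\<^esub> p = \<zero>\<^bsub>hom1 A B\<^esub>" if p: "p \<in> carrier (hom1 A B)" for p
  proof (rule prod_eqI)
    have "fst p \<in> carrier (free A B)" "snd p \<in> carrier (K A B)" using p by (simp_all add: hom1_simps)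
    then show "fst ([N] \<cdot>\<^bsub>hom1 A B\<^esub> p) = fst \<zero>\<^bsub>hom1 A B\<^esub>" "snd ([N] \<cdot>\<^bsub>hom1 A B\<^esub> p) = snd \<zero>\<^bsub>hom1 A B\<^esub>"
      using additive_map_int_pow[OF H.abelian_group_axioms free_group_abelian_group fst_hom1_additive p]
        additive_map_int_pow[OF H.abelian_group_axioms K_group snd_hom1_additive p]
        torsion_group.torsion[OF free_group_torsion] torsion_group.torsion[OF K_torsion]
      by (simp_all add: hom1_simps)
  qed
  then show ?thesis
    by (simp add: torsion_group_def torsion_group_axioms_def H.abelian_group_axioms)
qed

text \<open>The subtracted defects correct the whiskered tracks, which end at \<open>0\<close> but start at
  \<open>ev u (ev v)\<close>, to start at \<open>ev (uv)\<close>.\<close>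

definition comp01 :: "'o \<Rightarrow> 'o \<Rightarrow> 'o \<Rightarrow> ('m \<Rightarrow> int) \<Rightarrow> ('m \<Rightarrow> int) \<times> 't \<Rightarrow> ('m \<Rightarrow> int) \<times> 't" where
  "comp01 X A B u = (\<lambda>(v, k). (comp00 X A B u v,
    ml X A B (ev A B u) k \<ominus>\<^bsub>K X B\<^esub> defect X A B (ev A B u) v))"

definition comp10 :: "'o \<Rightarrow> 'o \<Rightarrow> 'o \<Rightarrow> ('m \<Rightarrow> int) \<times> 't \<Rightarrow> ('m \<Rightarrow> int) \<Rightarrow> ('m \<Rightarrow> int) \<times> 't" where
  "comp10 X A B = (\<lambda>(u, k) v. (comp00 X A B u v,
    mr X A B k (ev X A v) \<ominus>\<^bsub>K X B\<^esub> defect X A B (d A B k) v))"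

lemma fst_comp01: "fst (comp01 X A B u p) = comp00 X A B u (fst p)"
  by (cases p) (simp add: comp01_def)

lemma fst_comp10: "fst (comp10 X A B p v) = comp00 X A B (fst p) v"
  by (cases p) (simp add: comp10_def)

text \<open>Membership in the pullback holds because the boundary of the subtracted defect is
  exactly the discrepancy in \<open>ev_comp00\<close>.\<close>

lemma comp01_closed:
  "\<lbrakk>X \<in> Ob; A \<in> Ob; B \<in> Ob; u \<in> carrier (free A B); p \<in> carrier (hom1 X A)\<rbrakk> \<Longrightarrow>
    comp01 X A B u p \<in> carrier (hom1 X B)"
  by (cases p) (auto simp: comp01_def hom1_simps d_simps d_ml ev_comp00)

lemma comp10_closed:
  "\<lbrakk>X \<in> Ob; A \<in> Ob; B \<in> Ob; v \<in> carrier (free X A); p \<in> carrier (hom1 A B)\<rbrakk> \<Longrightarrow>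
    comp10 X A B p v \<in> carrier (hom1 X B)"
  by (cases p) (auto simp: comp10_def hom1_simps d_simps d_mr ev_comp00)

section \<open>Bilinearity of the corrected actions\<close>

lemma comp01_additive_left:
  assumes [simp]: "X \<in> Ob" "A \<in> Ob" "B \<in> Ob" and p: "p \<in> carrier (hom1 X A)"
  shows "additive_map (free A B) (hom1 X B) (\<lambda>u. comp01 X A B u p)"
proof (rule additive_mapI)
  interpret KXB: abelian_group "K X B" by simp
  fix u v assume "u \<in> carrier (free A B)" "v \<in> carrier (free A B)"
  then show "comp01 X A B (u \<oplus>\<^bsub>free A B\<^esub> v) p = comp01 X A B u p \<oplus>\<^bsub>hom1 X B\<^esub> comp01 X A B v p"
    using p by (cases p)
      (simp add: comp01_def hom1_simps comp00_simps ev_simps ml_simps defect_simps KXB.group_simps)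
qed (simp add: comp01_closed p)

text \<open>Neither whiskering nor the defect is additive here. By \<open>ml_add\<close> and
  \<open>defect_add\<close> both deviate by the cocycle of \<open>ev u\<close> at the same two maps,
  because boundary and evaluation agree on \<open>hom1\<close>, so the deviations cancel.\<close>

lemma comp01_additive_right:
  assumes [simp]: "X \<in> Ob" "A \<in> Ob" "B \<in> Ob" "u \<in> carrier (free A B)"
  shows "additive_map (hom1 X A) (hom1 X B) (comp01 X A B u)"
proof (rule additive_mapI)
  interpret KXB: abelian_group "K X B" by simp
  fix p q assume "p \<in> carrier (hom1 X A)" "q \<in> carrier (hom1 X A)"
  then show "comp01 X A B u (p \<oplus>\<^bsub>hom1 X A\<^esub> q) = comp01 X A B u p \<oplus>\<^bsub>hom1 X B\<^esub> comp01 X A B u q"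
    by (cases p; cases q)
      (simp add: comp01_def hom1_simps comp00_simps ml_add defect_add KXB.group_simps)
qed (simp add: comp01_closed)

lemma comp10_additive_left:
  assumes [simp]: "X \<in> Ob" "A \<in> Ob" "B \<in> Ob" "v \<in> carrier (free X A)"
  shows "additive_map (hom1 A B) (hom1 X B) (\<lambda>p. comp10 X A B p v)"
proof (rule additive_mapI)
  interpret KXB: abelian_group "K X B" by simp
  fix p q assume "p \<in> carrier (hom1 A B)" "q \<in> carrier (hom1 A B)"
  then show "comp10 X A B (p \<oplus>\<^bsub>hom1 A B\<^esub> q) v = comp10 X A B p v \<oplus>\<^bsub>hom1 X B\<^esub> comp10 X A B q v"
    by (cases p; cases q)
      (simp add: comp10_def hom1_simps comp00_simps mr_simps d_additive[THEN additive_map_add]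
        defect_simps KXB.group_simps)
qed (simp add: comp10_closed)

text \<open>The same cancellation, now between \<open>mr_add\<close> and \<open>defect_add\<close>,
  for the cocycle of \<open>d A B k\<close>.\<close>

lemma comp10_additive_right:
  assumes [simp]: "X \<in> Ob" "A \<in> Ob" "B \<in> Ob" and p: "p \<in> carrier (hom1 A B)"
  shows "additive_map (free X A) (hom1 X B) (comp10 X A B p)"
proof (rule additive_mapI)
  interpret KXB: abelian_group "K X B" by simp
  fix u v assume "u \<in> carrier (free X A)" "v \<in> carrier (free X A)"
  then show "comp10 X A B p (u \<oplus>\<^bsub>free X A\<^esub> v) = comp10 X A B p u \<oplus>\<^bsub>hom1 X B\<^esub> comp10 X A B p v"
    using p by (cases p)
      (simp add: comp10_def hom1_simps comp00_simps ev_simps mr_add defect_add KXB.group_simps)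
qed (simp add: comp10_closed p)

section \<open>Associativity with one factor in degree 1\<close>

lemma comp01_single: "\<lbrakk>A \<in> Ob; B \<in> Ob; a \<in> carrier (M A B)\<rbrakk> \<Longrightarrow>
    comp01 X A B (single N a) (v, k) =
      (comp00 X A B (single N a) v, ml X A B a k \<ominus>\<^bsub>K X B\<^esub> defect X A B a v)"
  by (simp add: comp01_def)

lemma comp10_single: "\<lbrakk>X \<in> Ob; A \<in> Ob; B \<in> Ob; x \<in> carrier (M X A); k \<in> carrier (K A B)\<rbrakk> \<Longrightarrow>
    comp10 X A B (u, k) (single N x) = (comp00 X A B u (single N x), mr X A B k x)"
  by (simp add: comp10_def defect_single abelian_group.minus_zero[OF K_group])

text \<open>The associativity in which two corrections interact. The defect on the left is that of a
  composite map, and the cocycle term in \<open>defect_postcomp\<close> is exactly the failure of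
  whiskering by \<open>z\<close> to respect the corrected track of the inner composite.\<close>

lemma comp001_assoc_single_single:
  assumes [simp]: "A \<in> Ob" "B \<in> Ob" "C \<in> Ob" "D \<in> Ob" "z \<in> carrier (M C D)" "y \<in> carrier (M B C)"
    and p: "p \<in> carrier (hom1 A B)"
  shows "comp01 A B D (comp00 B C D (single N z) (single N y)) p =
    comp01 A C D (single N z) (comp01 A B C (single N y) p)"
proof -
  interpret KAD: abelian_group "K A D" by simp
  interpret KAC: abelian_group "K A C" by simp
  obtain v k where vk [simp]: "p = (v, k)" "v \<in> carrier (free A B)" "k \<in> carrier (K A B)"
    and dk: "d A B k = ev A B v"
    using p by (cases p) (auto simp: hom1_simps)
  define l m where "l = ml A B C y k" and "m = defect A B C y v"
  have [simp]: "l \<in> carrier (K A C)" "m \<in> carrier (K A C)" by (simp_all add: l_def m_def)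
  \<comment> \<open>Splitting \<open>l\<close> lets \<open>ml_add\<close> compare \<open>z\<close>
    acting on \<open>l\<close> with \<open>z\<close> acting on \<open>l - m\<close>, the second
    component of the inner composite, whose boundary is the evaluation of
    \<open>[y] v\<close>.\<close>
  have "l = (l \<ominus>\<^bsub>K A C\<^esub> m) \<oplus>\<^bsub>K A C\<^esub> m" by (simp add: KAC.group_simps)
  moreover have "ml A C D z ((l \<ominus>\<^bsub>K A C\<^esub> m) \<oplus>\<^bsub>K A C\<^esub> m) =
      ml A C D z (l \<ominus>\<^bsub>K A C\<^esub> m) \<oplus>\<^bsub>K A D\<^esub> ml A C D z m \<oplus>\<^bsub>K A D\<^esub>
      \<gamma> A C D z (d A C (l \<ominus>\<^bsub>K A C\<^esub> m)) (d A C m)"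
    by (rule ml_add) simp_all
  moreover have "d A C (l \<ominus>\<^bsub>K A C\<^esub> m) = ev A C (comp00 A B C (single N y) v)"
    by (simp add: d_simps ev_comp00 l_def m_def d_ml dk)
  ultimately have "ml A C D z l = ml A C D z (l \<ominus>\<^bsub>K A C\<^esub> m) \<oplus>\<^bsub>K A D\<^esub> ml A C D z m \<oplus>\<^bsub>K A D\<^esub>
      \<gamma> A C D z (ev A C (comp00 A B C (single N y) v)) (d A C m)"
    by simp
  then have "ml A B D (mm B C D z y) k \<ominus>\<^bsub>K A D\<^esub> defect A B D (mm B C D z y) v =
      ml A C D z (l \<ominus>\<^bsub>K A C\<^esub> m) \<ominus>\<^bsub>K A D\<^esub> defect A C D z (comp00 A B C (single N y) v)"
    by (simp add: ml_assoc defect_postcomp KAD.group_simps flip: l_def m_def)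
  then show ?thesis
    by (simp add: comp01_single comp00_assoc_single_single flip: l_def m_def)
       (simp flip: comp00_assoc_single_single)
qed

lemmas comp01_simps =
  additive_map_add[OF comp01_additive_left] additive_map_add[OF comp01_additive_right]
  additive_map_zero[OF free_group_abelian_group hom1_group comp01_additive_left]
  additive_map_zero[OF hom1_group hom1_group comp01_additive_right]
  additive_map_minus[OF free_group_abelian_group hom1_group comp01_additive_left]
  additive_map_minus[OF hom1_group hom1_group comp01_additive_right]

lemmas comp10_simps =
  additive_map_add[OF comp10_additive_left] additive_map_add[OF comp10_additive_right]
  additive_map_zero[OF hom1_group hom1_group comp10_additive_left]
  additive_map_zero[OF free_group_abelian_group hom1_group comp10_additive_right]
  additive_map_minus[OF hom1_group hom1_group comp10_additive_left]
  additive_map_minus[OF free_group_abelian_group hom1_group comp10_additive_right]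

lemma comp001_assoc_single:
  assumes [simp]: "A \<in> Ob" "B \<in> Ob" "C \<in> Ob" "D \<in> Ob" "z \<in> carrier (M C D)"
    "p \<in> carrier (hom1 A B)" and y: "y \<in> carrier (free B C)"
  shows "comp01 A B D (comp00 B C D (single N z) y) p =
    comp01 A C D (single N z) (comp01 A B C y p)"
  using y by (induction rule: free_group_induct)
    (simp_all add: comp00_simps comp01_simps comp01_closed comp001_assoc_single_single del: comp00_single)

lemma comp001_assoc:
  assumes [simp]: "A \<in> Ob" "B \<in> Ob" "C \<in> Ob" "D \<in> Ob" "y \<in> carrier (free B C)"
    "p \<in> carrier (hom1 A B)" and z: "z \<in> carrier (free C D)"
  shows "comp01 A B D (comp00 B C D z y) p = comp01 A C D z (comp01 A B C y p)"
  using z by (induction rule: free_group_induct)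
    (simp_all add: comp00_simps comp01_simps comp01_closed comp001_assoc_single)

text \<open>A generator on the right carries no correction, so only the commutation
  \<open>ml_mr\<close> of the two whiskerings and \<open>defect_precomp\<close> are left.\<close>

lemma comp010_assoc_single_single:
  assumes [simp]: "A \<in> Ob" "B \<in> Ob" "C \<in> Ob" "D \<in> Ob" "z \<in> carrier (M C D)" "x \<in> carrier (M A B)"
    and p: "p \<in> carrier (hom1 B C)"
  shows "comp10 A B D (comp01 B C D (single N z) p) (single N x) =
    comp01 A C D (single N z) (comp10 A B C p (single N x))"
  using p by (cases p)
    (simp add: hom1_simps comp01_single comp10_single mr_simps ml_mr defect_precomp comp00_assoc)

lemma comp010_assoc_single:
  assumes [simp]: "A \<in> Ob" "B \<in> Ob" "C \<in> Ob" "D \<in> Ob" "z \<in> carrier (M C D)"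
    "p \<in> carrier (hom1 B C)" and x: "x \<in> carrier (free A B)"
  shows "comp10 A B D (comp01 B C D (single N z) p) x =
    comp01 A C D (single N z) (comp10 A B C p x)"
  using x by (induction rule: free_group_induct)
    (simp_all add: comp10_simps comp01_simps comp01_closed comp10_closed comp010_assoc_single_single)

lemma comp010_assoc:
  assumes [simp]: "A \<in> Ob" "B \<in> Ob" "C \<in> Ob" "D \<in> Ob" "x \<in> carrier (free A B)"
    "p \<in> carrier (hom1 B C)" and z: "z \<in> carrier (free C D)"
  shows "comp10 A B D (comp01 B C D z p) x = comp01 A C D z (comp10 A B C p x)"
  using z by (induction rule: free_group_induct)
    (simp_all add: comp10_simps comp01_simps comp01_closed comp10_closed comp010_assoc_single)

text \<open>With generators in both right-hand places no defect occurs, and \<open>mr_assoc\<close>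
  suffices.\<close>

lemma comp100_assoc_single_single:
  assumes [simp]: "A \<in> Ob" "B \<in> Ob" "C \<in> Ob" "D \<in> Ob" "y \<in> carrier (M B C)" "x \<in> carrier (M A B)"
    and p: "p \<in> carrier (hom1 C D)"
  shows "comp10 A B D (comp10 B C D p (single N y)) (single N x) =
    comp10 A C D p (comp00 A B C (single N y) (single N x))"
  using p by (cases p) (simp add: hom1_simps comp10_single mr_assoc comp00_assoc)

lemma comp100_assoc_single:
  assumes [simp]: "A \<in> Ob" "B \<in> Ob" "C \<in> Ob" "D \<in> Ob" "y \<in> carrier (M B C)"
    "p \<in> carrier (hom1 C D)" and x: "x \<in> carrier (free A B)"
  shows "comp10 A B D (comp10 B C D p (single N y)) x =
    comp10 A C D p (comp00 A B C (single N y) x)"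
  using x by (induction rule: free_group_induct)
    (simp_all add: comp00_simps comp10_simps comp10_closed comp100_assoc_single_single del: comp00_single)

lemma comp100_assoc:
  assumes [simp]: "A \<in> Ob" "B \<in> Ob" "C \<in> Ob" "D \<in> Ob" "x \<in> carrier (free A B)"
    "p \<in> carrier (hom1 C D)" and y: "y \<in> carrier (free B C)"
  shows "comp10 A B D (comp10 B C D p y) x = comp10 A C D p (comp00 A B C y x)"
  using y by (induction rule: free_group_induct)
    (simp_all add: comp00_simps comp10_simps comp10_closed comp100_assoc_single)

section \<open>Assembling the DG-category\<close>

definition dg :: "('o, int, 'm \<Rightarrow> int, ('m \<Rightarrow> int) \<times> 't) dg_category" where
  "dg =
    \<lparr>DObj = Ob,
     Deg0 = (\<lambda>A B. int_module (free A B)),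
     Deg1 = (\<lambda>A B. int_module (hom1 A B)),
     bdry = (\<lambda>A B. fst),
     dcomp00 = comp00,
     dcomp01 = comp01,
     dcomp10 = comp10,
     dunit = (\<lambda>A. single N (un A))\<rparr>"

lemma truncated_dg_category_dg:
  assumes "integers_mod N R"
  shows "truncated_dg_category R dg"
proof -
  interpret R: integers_mod N R by fact
  note lin = R.additive_map_linear[OF free_group_abelian_group free_group_abelian_group]
    R.additive_map_linear[OF free_group_abelian_group hom1_group]
    R.additive_map_linear[OF hom1_group hom1_group]
    R.additive_map_linear[OF hom1_group free_group_abelian_group]
  show ?thesis
  proof (intro truncated_dg_category.intro truncated_dg_category_axioms.intro R.cring_axioms,
      simp_all add: dg_def)
    fix A B C D assume [simp]: "A \<in> Ob" "B \<in> Ob" "C \<in> Ob" "D \<in> Ob"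
    show "module R (int_module (free A B))"
      by (rule R.int_module_module[OF free_group_torsion])
    show "module R (int_module (hom1 A B))"
      by (rule R.int_module_module[OF hom1_torsion]) simp_all
    show "is_linear_map R (int_module (hom1 A B)) (int_module (free A B)) fst"
      by (rule lin) (simp_all add: fst_hom1_additive)
    show "is_bilinear_map R (int_module (free B C)) (int_module (free A B))
        (int_module (free A C)) (comp00 A B C)"
      by (auto simp: is_bilinear_map_def intro!: lin comp00_additive_left comp00_additive_right)
    show "is_bilinear_map R (int_module (free B C)) (int_module (hom1 A B))
        (int_module (hom1 A C)) (comp01 A B C)"
      by (auto simp: is_bilinear_map_def intro!: lin comp01_additive_left comp01_additive_right)
    show "is_bilinear_map R (int_module (hom1 B C)) (int_module (free A B))
        (int_module (hom1 A C)) (comp10 A B C)"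
      by (auto simp: is_bilinear_map_def intro!: lin comp10_additive_left comp10_additive_right)
    fix p assume p: "p \<in> carrier (hom1 A B)"
    \<comment> \<open>The left unit subtracts the defect of the unit map, which vanishes by
      \<open>defect_un\<close>; the right unit is a generator and carries no correction.\<close>
    show "comp01 A B B (single N (un B)) p = p" "comp10 A A B p (single N (un A)) = p"
      using p by (cases p; simp add: hom1_simps comp01_single comp10_single comp00_un_left
        comp00_un_right ml_un mr_un defect_un abelian_group.minus_zero[OF K_group])+
  next
    fix A B C p q assume [simp]: "A \<in> Ob" "B \<in> Ob" "C \<in> Ob"
      and p: "p \<in> carrier (hom1 B C)" and q: "q \<in> carrier (hom1 A B)"
    \<comment> \<open>On \<open>hom1\<close> the evaluation of the first component is the boundary
      of the second, so both sides subtract the same defect and \<open>exchange\<close> gives the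
      rest.\<close>
    show "comp01 A B C (fst p) q = comp10 A B C p (fst q)"
      using p q exchange[of A B C "snd q" "snd p"]
      by (auto simp: comp01_def comp10_def hom1_simps split: prod.splits)
  qed (auto simp: comp00_assoc comp001_assoc comp010_assoc comp100_assoc comp00_un_left
      comp00_un_right fst_comp01 fst_comp10 hom1_simps(1))
qed

end

section \<open>Tracks as differences\<close>

text \<open>A track amounts to its target together with its difference from the identity of that
  target. The differences form this group, and the source map restricts to the differential of a
  two-term complex.\<close>

definition kernel_group :: "('m, 't) category \<Rightarrow> 'm ring \<Rightarrow> 't ring \<Rightarrow> 't ring" where
  "kernel_group G P Q =
    \<lparr>carrier = {\<alpha> \<in> Arr G. Tgt G \<alpha> = \<zero>\<^bsub>P\<^esub>}, mult = add Q, one = \<zero>\<^bsub>Q\<^esub>,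
     zero = \<zero>\<^bsub>Q\<^esub>, add = add Q\<rparr>"

lemma kernel_group_simps [simp]:
  "\<alpha> \<in> carrier (kernel_group G P Q) \<longleftrightarrow> \<alpha> \<in> Arr G \<and> Tgt G \<alpha> = \<zero>\<^bsub>P\<^esub>"
  "\<zero>\<^bsub>kernel_group G P Q\<^esub> = \<zero>\<^bsub>Q\<^esub>"
  "\<alpha> \<oplus>\<^bsub>kernel_group G P Q\<^esub> \<beta> = \<alpha> \<oplus>\<^bsub>Q\<^esub> \<beta>"
  by (simp_all add: kernel_group_def)

context abelian_group_groupoid
begin

lemma Q_closed [simp]: "\<alpha> \<in> Arr G \<Longrightarrow> \<alpha> \<in> carrier Q" and P_closed [simp]: "x \<in> Obj G \<Longrightarrow> x \<in> carrier P"
  by (simp_all add: carrier_Q carrier_P)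

lemmas G_closed [simp] = Src_closed Tgt_closed Ident_closed Src_Ident Tgt_Ident
  P.a_closed[unfolded carrier_P] P.zero_closed[unfolded carrier_P] P.minus_closed[unfolded carrier_P]
  Q.a_closed[unfolded carrier_Q] Q.zero_closed[unfolded carrier_Q] Q.minus_closed[unfolded carrier_Q]
  Q.a_inv_closed[unfolded carrier_Q]

lemma add_arrow:
  assumes "\<alpha> \<in> Arr G" "\<beta> \<in> Arr G"
  shows "Src G (\<alpha> \<oplus>\<^bsub>Q\<^esub> \<beta>) = Src G \<alpha> \<oplus>\<^bsub>P\<^esub> Src G \<beta>"
    and "Tgt G (\<alpha> \<oplus>\<^bsub>Q\<^esub> \<beta>) = Tgt G \<alpha> \<oplus>\<^bsub>P\<^esub> Tgt G \<beta>"
  using add_functor assms unfolding is_functor_def prod_category_def arrow_def by auto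

lemma Ident_add:
  "\<lbrakk>x \<in> Obj G; y \<in> Obj G\<rbrakk> \<Longrightarrow> Ident G (x \<oplus>\<^bsub>P\<^esub> y) = Ident G x \<oplus>\<^bsub>Q\<^esub> Ident G y"
  using add_functor unfolding is_functor_def prod_category_def by auto

lemma Comp_add:
  assumes "\<alpha> \<in> Arr G" "\<beta> \<in> Arr G" "\<alpha>' \<in> Arr G" "\<beta>' \<in> Arr G"
    "Tgt G \<alpha> = Src G \<beta>" "Tgt G \<alpha>' = Src G \<beta>'"
  shows "Comp G (\<beta> \<oplus>\<^bsub>Q\<^esub> \<beta>') (\<alpha> \<oplus>\<^bsub>Q\<^esub> \<alpha>') = Comp G \<beta> \<alpha> \<oplus>\<^bsub>Q\<^esub> Comp G \<beta>' \<alpha>'"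
  using add_functor assms unfolding is_functor_def prod_category_def by auto

lemma Src_additive: "additive_map Q P (Src G)"
  by (rule additive_mapI) (simp_all add: carrier_P carrier_Q add_arrow)

lemma Tgt_additive: "additive_map Q P (Tgt G)"
  by (rule additive_mapI) (simp_all add: carrier_P carrier_Q add_arrow)

lemmas groups = P.abelian_group_axioms Q.abelian_group_axioms

lemma Src_zero [simp]: "Src G \<zero>\<^bsub>Q\<^esub> = \<zero>\<^bsub>P\<^esub>" and Tgt_zero [simp]: "Tgt G \<zero>\<^bsub>Q\<^esub> = \<zero>\<^bsub>P\<^esub>"
  by (simp_all add: zero_functor[symmetric])

lemma Src_diff:
  "\<lbrakk>\<alpha> \<in> Arr G; \<beta> \<in> Arr G\<rbrakk> \<Longrightarrow> Src G (\<alpha> \<ominus>\<^bsub>Q\<^esub> \<beta>) = Src G \<alpha> \<ominus>\<^bsub>P\<^esub> Src G \<beta>"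
  using additive_map_diff[OF groups(2,1) Src_additive] by (simp add: carrier_Q)

lemma Tgt_diff:
  "\<lbrakk>\<alpha> \<in> Arr G; \<beta> \<in> Arr G\<rbrakk> \<Longrightarrow> Tgt G (\<alpha> \<ominus>\<^bsub>Q\<^esub> \<beta>) = Tgt G \<alpha> \<ominus>\<^bsub>P\<^esub> Tgt G \<beta>"
  using additive_map_diff[OF groups(2,1) Tgt_additive] by (simp add: carrier_Q)

lemma Tgt_minus: "\<alpha> \<in> Arr G \<Longrightarrow> Tgt G (\<ominus>\<^bsub>Q\<^esub> \<alpha>) = \<ominus>\<^bsub>P\<^esub> Tgt G \<alpha>"
  using additive_map_minus[OF groups(2,1) Tgt_additive] by (simp add: carrier_Q)

text \<open>By interchange, \<open>\<beta> \<box> \<alpha> = ((\<beta> - id) + id) \<box> (id + \<alpha>) = (\<beta> - id) + \<alpha>\<close>.\<close>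

lemma Comp_eq:
  assumes [simp]: "\<alpha> \<in> Arr G" "\<beta> \<in> Arr G" and eq: "Tgt G \<alpha> = Src G \<beta>"
  shows "Comp G \<beta> \<alpha> = \<beta> \<oplus>\<^bsub>Q\<^esub> (\<alpha> \<ominus>\<^bsub>Q\<^esub> Ident G (Tgt G \<alpha>))"
proof -
  let ?i = "Ident G (Tgt G \<alpha>)"
  have "Comp G \<beta> \<alpha> = Comp G ((\<beta> \<ominus>\<^bsub>Q\<^esub> ?i) \<oplus>\<^bsub>Q\<^esub> ?i) (\<zero>\<^bsub>Q\<^esub> \<oplus>\<^bsub>Q\<^esub> \<alpha>)"
    by (simp add: Q.minus_add_cancel)
  also have "\<dots> = Comp G (\<beta> \<ominus>\<^bsub>Q\<^esub> ?i) \<zero>\<^bsub>Q\<^esub> \<oplus>\<^bsub>Q\<^esub> Comp G ?i \<alpha>"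
    by (rule Comp_add) (simp_all add: Src_diff eq P.minus_self)
  also have "Comp G (\<beta> \<ominus>\<^bsub>Q\<^esub> ?i) \<zero>\<^bsub>Q\<^esub> = \<beta> \<ominus>\<^bsub>Q\<^esub> ?i"
    using Comp_Ident_right[of "\<beta> \<ominus>\<^bsub>Q\<^esub> ?i"] by (simp add: Src_diff eq P.minus_self zero_functor)
  also have "Comp G ?i \<alpha> = \<alpha>" by (rule Comp_Ident_left) simp
  finally show ?thesis by (simp add: Q.group_simps)
qed

lemma kernel_group_abelian: "abelian_group (kernel_group G P Q)"
proof (rule abelian_groupI)
  fix \<alpha> assume "\<alpha> \<in> carrier (kernel_group G P Q)"
  then show "\<exists>\<beta> \<in> carrier (kernel_group G P Q). \<beta> \<oplus>\<^bsub>kernel_group G P Q\<^esub> \<alpha> = \<zero>\<^bsub>kernel_group G P Q\<^esub>"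
    by (intro bexI[of _ "\<ominus>\<^bsub>Q\<^esub> \<alpha>"]) (simp_all add: Tgt_minus Q.l_neg)
qed (simp_all add: add_arrow Q.a_ac)

end


section \<open>The cocycle of linearity tracks\<close>

locale left_linear_with_linearity_tracks = left_linear_track_category F + linearity_tracks F \<Gamma>
  for F :: "('o, 'm, 't) linear_track_category" and \<Gamma>
begin

definition kernel :: "'o \<Rightarrow> 'o \<Rightarrow> 't ring" where
  "kernel A B = kernel_group (Hom F A B) (MGrp F A B) (TGrp F A B)"

definition source :: "'o \<Rightarrow> 'o \<Rightarrow> 't \<Rightarrow> 'm" where
  "source A B = Src (Hom F A B)"

definition cocycle :: "'o \<Rightarrow> 'o \<Rightarrow> 'o \<Rightarrow> 'm \<Rightarrow> 'm \<Rightarrow> 'm \<Rightarrow> 't" where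
  "cocycle X A B a x y = \<Gamma> X A B a x y \<ominus>\<^bsub>TGrp F X B\<^esub>
    idtr F X B (madd F X B (mcomp F X A B a x) (mcomp F X A B a y))"

lemma kernel_simps [simp]:
  "\<alpha> \<in> carrier (kernel A B) \<longleftrightarrow> \<alpha> \<in> tracks F A B \<and> Tgt (Hom F A B) \<alpha> = \<zero>\<^bsub>MGrp F A B\<^esub>"
  "\<zero>\<^bsub>kernel A B\<^esub> = \<zero>\<^bsub>TGrp F A B\<^esub>"
  "\<alpha> \<oplus>\<^bsub>kernel A B\<^esub> \<beta> = tadd F A B \<alpha> \<beta>"
  by (simp_all add: kernel_def)

lemma kernel_abelian_group: "\<lbrakk>A \<in> TObj F; B \<in> TObj F\<rbrakk> \<Longrightarrow> abelian_group (kernel A B)"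
  unfolding kernel_def by (rule abelian_group_groupoid.kernel_group_abelian[OF Hom_abelian_group])

lemma carrier_MGrp: "\<lbrakk>A \<in> TObj F; B \<in> TObj F\<rbrakk> \<Longrightarrow> carrier (MGrp F A B) = maps F A B"
  using abelian_group_groupoid.carrier_P[OF Hom_abelian_group] .

lemma mem_MGrp [simp]: "\<lbrakk>A \<in> TObj F; B \<in> TObj F\<rbrakk> \<Longrightarrow> x \<in> carrier (MGrp F A B) \<longleftrightarrow> x \<in> maps F A B"
  by (simp add: carrier_MGrp)

lemma MGrp_abelian_group: "\<lbrakk>A \<in> TObj F; B \<in> TObj F\<rbrakk> \<Longrightarrow> abelian_group (MGrp F A B)"
  using abelian_group_groupoid.groups(1)[OF Hom_abelian_group] .

lemma carrier_TGrp: "\<lbrakk>A \<in> TObj F; B \<in> TObj F\<rbrakk> \<Longrightarrow> carrier (TGrp F A B) = tracks F A B"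
  using abelian_group_groupoid.carrier_Q[OF Hom_abelian_group] .

lemmas Hom_closed [simp] = abelian_group_groupoid.G_closed[OF Hom_abelian_group]
lemmas TGrp_closed [simp] = abelian_group_groupoid.Q_closed[OF Hom_abelian_group]
lemmas [simp] = abelian_group_groupoid.Src_zero[OF Hom_abelian_group]
  abelian_group_groupoid.Tgt_zero[OF Hom_abelian_group]
lemmas Hom_arrow = abelian_group_groupoid.add_arrow[OF Hom_abelian_group]
  abelian_group_groupoid.Src_diff[OF Hom_abelian_group]
  abelian_group_groupoid.Tgt_diff[OF Hom_abelian_group]
lemmas idtr_add = abelian_group_groupoid.Ident_add[OF Hom_abelian_group]
lemmas idtr_zero = abelian_group_groupoid.zero_functor[OF Hom_abelian_group]
lemmas Hom_Comp_eq = abelian_group_groupoid.Comp_eq[OF Hom_abelian_group]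
lemmas M_simps = abelian_group.group_simps[OF MGrp_abelian_group, simplified]
lemmas M_zero [simp] = abelian_monoid.l_zero[OF abelian_group.axioms(1)[OF MGrp_abelian_group], simplified]
  abelian_monoid.r_zero[OF abelian_group.axioms(1)[OF MGrp_abelian_group], simplified]

section \<open>Composition and whiskering\<close>

lemma composition:
  assumes "A \<in> TObj F" "B \<in> TObj F" "C \<in> TObj F"
  shows mcomp_closed: "\<lbrakk>a \<in> maps F B C; x \<in> maps F A B\<rbrakk> \<Longrightarrow> mcomp F A B C a x \<in> maps F A C"
    and tcomp_closed: "\<lbrakk>\<alpha> \<in> tracks F B C; \<xi> \<in> tracks F A B\<rbrakk> \<Longrightarrow> tcomp F A B C \<alpha> \<xi> \<in> tracks F A C"
    and Src_tcomp: "\<lbrakk>\<alpha> \<in> tracks F B C; \<xi> \<in> tracks F A B\<rbrakk> \<Longrightarrow>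
      Src (Hom F A C) (tcomp F A B C \<alpha> \<xi>) = mcomp F A B C (Src (Hom F B C) \<alpha>) (Src (Hom F A B) \<xi>)"
    and Tgt_tcomp: "\<lbrakk>\<alpha> \<in> tracks F B C; \<xi> \<in> tracks F A B\<rbrakk> \<Longrightarrow>
      Tgt (Hom F A C) (tcomp F A B C \<alpha> \<xi>) = mcomp F A B C (Tgt (Hom F B C) \<alpha>) (Tgt (Hom F A B) \<xi>)"
    and tcomp_idtr: "\<lbrakk>a \<in> maps F B C; x \<in> maps F A B\<rbrakk> \<Longrightarrow>
      tcomp F A B C (idtr F B C a) (idtr F A B x) = idtr F A C (mcomp F A B C a x)"
    and tcomp_Comp: "\<lbrakk>\<alpha> \<in> tracks F B C; \<xi> \<in> tracks F A B; \<beta> \<in> tracks F B C; \<eta> \<in> tracks F A B;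
        Tgt (Hom F B C) \<alpha> = Src (Hom F B C) \<beta>; Tgt (Hom F A B) \<xi> = Src (Hom F A B) \<eta>\<rbrakk> \<Longrightarrow>
      tcomp F A B C (Comp (Hom F B C) \<beta> \<alpha>) (Comp (Hom F A B) \<eta> \<xi>) =
        Comp (Hom F A C) (tcomp F A B C \<beta> \<eta>) (tcomp F A B C \<alpha> \<xi>)"
  using comp_functor[OF assms] unfolding is_functor_def prod_category_def arrow_def by auto

lemmas composition_simps [simp] = mcomp_closed tcomp_closed Src_tcomp Tgt_tcomp tcomp_idtr

lemma category_Hom: "\<lbrakk>A \<in> TObj F; B \<in> TObj F\<rbrakk> \<Longrightarrow> category (Hom F A B)"
  using groupoid_Hom by (simp add: groupoid_def)

lemmas Hom_Ident = category.Comp_Ident_left[OF category_Hom] category.Comp_Ident_right[OF category_Hom]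

text \<open>Interchange: a horizontal composite factors through the two whiskerings, in either
  order.\<close>

lemma tcomp_right_left:
  assumes "A \<in> TObj F" "B \<in> TObj F" "C \<in> TObj F" "\<alpha> \<in> tracks F B C" "\<xi> \<in> tracks F A B"
  shows "tcomp F A B C \<alpha> \<xi> = Comp (Hom F A C)
    (whiskr F A B C \<alpha> (Tgt (Hom F A B) \<xi>)) (whiskl F A B C (Src (Hom F B C) \<alpha>) \<xi>)"
  using assms unfolding whiskr_def whiskl_def
  by (subst tcomp_Comp[symmetric]) (simp_all add: Hom_Ident)

lemma tcomp_left_right:
  assumes "A \<in> TObj F" "B \<in> TObj F" "C \<in> TObj F" "\<alpha> \<in> tracks F B C" "\<xi> \<in> tracks F A B"
  shows "tcomp F A B C \<alpha> \<xi> = Comp (Hom F A C)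
    (whiskl F A B C (Tgt (Hom F B C) \<alpha>) \<xi>) (whiskr F A B C \<alpha> (Src (Hom F A B) \<xi>))"
  using assms unfolding whiskr_def whiskl_def
  by (subst tcomp_Comp[symmetric]) (simp_all add: Hom_Ident)

lemma whisker_simps [simp]:
  assumes "A \<in> TObj F" "B \<in> TObj F" "C \<in> TObj F"
  shows "\<lbrakk>a \<in> maps F B C; \<xi> \<in> tracks F A B\<rbrakk> \<Longrightarrow> whiskl F A B C a \<xi> \<in> tracks F A C"
    and "\<lbrakk>a \<in> maps F B C; \<xi> \<in> tracks F A B\<rbrakk> \<Longrightarrow>
      Src (Hom F A C) (whiskl F A B C a \<xi>) = mcomp F A B C a (Src (Hom F A B) \<xi>)"
    and "\<lbrakk>a \<in> maps F B C; \<xi> \<in> tracks F A B\<rbrakk> \<Longrightarrow>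
      Tgt (Hom F A C) (whiskl F A B C a \<xi>) = mcomp F A B C a (Tgt (Hom F A B) \<xi>)"
    and "\<lbrakk>\<alpha> \<in> tracks F B C; x \<in> maps F A B\<rbrakk> \<Longrightarrow> whiskr F A B C \<alpha> x \<in> tracks F A C"
    and "\<lbrakk>\<alpha> \<in> tracks F B C; x \<in> maps F A B\<rbrakk> \<Longrightarrow>
      Src (Hom F A C) (whiskr F A B C \<alpha> x) = mcomp F A B C (Src (Hom F B C) \<alpha>) x"
    and "\<lbrakk>\<alpha> \<in> tracks F B C; x \<in> maps F A B\<rbrakk> \<Longrightarrow>
      Tgt (Hom F A C) (whiskr F A B C \<alpha> x) = mcomp F A B C (Tgt (Hom F B C) \<alpha>) x"
    and "\<lbrakk>a \<in> maps F B C; x \<in> maps F A B\<rbrakk> \<Longrightarrow>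
      whiskl F A B C a (idtr F A B x) = idtr F A C (mcomp F A B C a x)"
    and "\<lbrakk>a \<in> maps F B C; x \<in> maps F A B\<rbrakk> \<Longrightarrow>
      whiskr F A B C (idtr F B C a) x = idtr F A C (mcomp F A B C a x)"
  using assms by (simp_all add: whiskl_def whiskr_def)

lemma mcomp_additive: "\<lbrakk>X \<in> TObj F; A \<in> TObj F; B \<in> TObj F; x \<in> maps F X A\<rbrakk> \<Longrightarrow>
    additive_map (MGrp F A B) (MGrp F X B) (\<lambda>a. mcomp F X A B a x)"
  by (rule additive_mapI) (simp_all add: left_linear_maps)

lemma whiskr_additive: "\<lbrakk>X \<in> TObj F; A \<in> TObj F; B \<in> TObj F; x \<in> maps F X A\<rbrakk> \<Longrightarrow>
    additive_map (TGrp F A B) (TGrp F X B) (\<lambda>\<alpha>. whiskr F X A B \<alpha> x)"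
  by (rule additive_mapI) (simp_all add: carrier_TGrp, simp add: whiskr_def left_linear_tracks)

lemma whiskr_kernel_additive: "\<lbrakk>X \<in> TObj F; A \<in> TObj F; B \<in> TObj F; x \<in> maps F X A\<rbrakk> \<Longrightarrow>
    additive_map (kernel A B) (kernel X B) (\<lambda>\<alpha>. whiskr F X A B \<alpha> x)"
  by (rule additive_mapI) (simp_all add: zero_mcomp, simp add: whiskr_def left_linear_tracks)

text \<open>Additivity is in the map \<open>a\<close>; in the track it fails by the cocycle, as
  \<open>whiskl_add\<close> makes precise.\<close>

lemma whiskl_kernel_additive: "\<lbrakk>X \<in> TObj F; A \<in> TObj F; B \<in> TObj F; \<xi> \<in> carrier (kernel X A)\<rbrakk> \<Longrightarrow>
    additive_map (MGrp F A B) (kernel X B) (\<lambda>a. whiskl F X A B a \<xi>)"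
  by (rule additive_mapI) (simp_all add: mcomp_zero, simp add: whiskl_def left_linear_tracks idtr_add)

lemma whiskr_diff: "\<lbrakk>X \<in> TObj F; A \<in> TObj F; B \<in> TObj F; x \<in> maps F X A;
    \<alpha> \<in> tracks F A B; \<beta> \<in> tracks F A B\<rbrakk> \<Longrightarrow>
    whiskr F X A B (\<alpha> \<ominus>\<^bsub>TGrp F A B\<^esub> \<beta>) x = whiskr F X A B \<alpha> x \<ominus>\<^bsub>TGrp F X B\<^esub> whiskr F X A B \<beta> x"
  using additive_map_diff[OF _ _ whiskr_additive]
    abelian_group_groupoid.groups(2)[OF Hom_abelian_group] by (simp add: carrier_TGrp)

text \<open>In each of the two factorisations of the horizontal composite one whiskering involves a
  zero map, hence is an identity track; what remains are the two sides.\<close>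

lemma whisker_exchange:
  assumes [simp]: "X \<in> TObj F" "A \<in> TObj F" "B \<in> TObj F"
    and "\<xi> \<in> carrier (kernel X A)" "\<alpha> \<in> carrier (kernel A B)"
  shows "whiskl F X A B (Src (Hom F A B) \<alpha>) \<xi> = whiskr F X A B \<alpha> (Src (Hom F X A) \<xi>)"
proof -
  have [simp]: "\<alpha> \<in> tracks F A B" "Tgt (Hom F A B) \<alpha> = \<zero>\<^bsub>MGrp F A B\<^esub>"
    "\<xi> \<in> tracks F X A" "Tgt (Hom F X A) \<xi> = \<zero>\<^bsub>MGrp F X A\<^esub>"
    using assms by simp_all
  have "tcomp F X A B \<alpha> \<xi> = whiskl F X A B (Src (Hom F A B) \<alpha>) \<xi>"
    using Hom_Ident(1)[of X B "whiskl F X A B (Src (Hom F A B) \<alpha>) \<xi>"]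
    by (simp add: tcomp_right_left[of X A B] whiskr_def[where x = "\<zero>\<^bsub>_\<^esub>"] tcomp_zero mcomp_zero)
  moreover have "tcomp F X A B \<alpha> \<xi> = whiskr F X A B \<alpha> (Src (Hom F X A) \<xi>)"
    using Hom_Ident(1)[of X B "whiskr F X A B \<alpha> (Src (Hom F X A) \<xi>)"]
    by (simp add: tcomp_left_right[of X A B] whiskl_def[where a = "\<zero>\<^bsub>_\<^esub>"] zero_tcomp zero_mcomp)
  ultimately show ?thesis by simp
qed

section \<open>The linearity tracks translated to end at 0\<close>

lemma \<Gamma>_simps [simp]:
  assumes "X \<in> TObj F" "A \<in> TObj F" "B \<in> TObj F" "x \<in> maps F X A" "y \<in> maps F X A" "a \<in> maps F A B"
  shows "\<Gamma> X A B a x y \<in> tracks F X B"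
    and "Src (Hom F X B) (\<Gamma> X A B a x y) = mcomp F X A B a (madd F X A x y)"
    and "Tgt (Hom F X B) (\<Gamma> X A B a x y) = madd F X B (mcomp F X A B a x) (mcomp F X A B a y)"
  using linearity_track[OF assms] by (simp_all add: arrow_def)

lemma TGrp_abelian_group [simp]: "\<lbrakk>A \<in> TObj F; B \<in> TObj F\<rbrakk> \<Longrightarrow> abelian_group (TGrp F A B)"
  using abelian_group_groupoid.groups(2)[OF Hom_abelian_group] .

lemma cocycle_simps [simp]:
  assumes [simp]: "X \<in> TObj F" "A \<in> TObj F" "B \<in> TObj F" "x \<in> maps F X A" "y \<in> maps F X A" "a \<in> maps F A B"
  shows "cocycle X A B a x y \<in> tracks F X B"
    and "Tgt (Hom F X B) (cocycle X A B a x y) = \<zero>\<^bsub>MGrp F X B\<^esub>"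
    and "Src (Hom F X B) (cocycle X A B a x y) = mcomp F X A B a (madd F X A x y) \<ominus>\<^bsub>MGrp F X B\<^esub>
      madd F X B (mcomp F X A B a x) (mcomp F X A B a y)"
  by (simp_all add: cocycle_def Hom_arrow M_simps)

lemma \<Gamma>_eq:
  assumes [simp]: "X \<in> TObj F" "A \<in> TObj F" "B \<in> TObj F" "x \<in> maps F X A" "y \<in> maps F X A" "a \<in> maps F A B"
  shows "\<Gamma> X A B a x y = cocycle X A B a x y \<oplus>\<^bsub>TGrp F X B\<^esub>
    (idtr F X B (mcomp F X A B a x) \<oplus>\<^bsub>TGrp F X B\<^esub> idtr F X B (mcomp F X A B a y))"
  by (simp add: cocycle_def idtr_add abelian_group.minus_add_cancel)

text \<open>Composing after a linearity track is adding its cocycle, which turns equations between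
  composites into equations in the track group.\<close>

lemma Comp_\<Gamma>_left:
  assumes [simp]: "X \<in> TObj F" "A \<in> TObj F" "B \<in> TObj F" "x \<in> maps F X A" "y \<in> maps F X A" "a \<in> maps F A B"
    and "\<alpha> \<in> tracks F X B" "Src (Hom F X B) \<alpha> = madd F X B (mcomp F X A B a x) (mcomp F X A B a y)"
  shows "Comp (Hom F X B) \<alpha> (\<Gamma> X A B a x y) = \<alpha> \<oplus>\<^bsub>TGrp F X B\<^esub> cocycle X A B a x y"
  using assms(7,8) by (simp add: Hom_Comp_eq cocycle_def)

lemma cocycle_additive:
  assumes [simp]: "X \<in> TObj F" "A \<in> TObj F" "B \<in> TObj F" "x \<in> maps F X A" "y \<in> maps F X A"
  shows "additive_map (MGrp F A B) (kernel X B) (\<lambda>a. cocycle X A B a x y)"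
proof (rule additive_mapI)
  interpret Q: abelian_group "TGrp F X B" by simp
  fix a b assume "a \<in> carrier (MGrp F A B)" "b \<in> carrier (MGrp F A B)"
  then show "cocycle X A B (madd F A B a b) x y = cocycle X A B a x y \<oplus>\<^bsub>kernel X B\<^esub> cocycle X A B b x y"
    by (simp add: cocycle_def left_linearity left_linear_maps idtr_add Q.group_simps)
qed simp

lemma cocycle_sym:
  assumes [simp]: "X \<in> TObj F" "A \<in> TObj F" "B \<in> TObj F" "x \<in> maps F X A" "y \<in> maps F X A" "a \<in> maps F A B"
  shows "cocycle X A B a x y = cocycle X A B a y x"
  by (simp add: cocycle_def symmetry[of X A B x y] M_simps)

lemma cocycle_precomp:
  assumes [simp]: "W \<in> TObj F" "X \<in> TObj F" "A \<in> TObj F" "B \<in> TObj F" "z \<in> maps F W X"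
    "x \<in> maps F X A" "y \<in> maps F X A" "a \<in> maps F A B"
  shows "cocycle W A B a (mcomp F W X A x z) (mcomp F W X A y z) = whiskr F W X B (cocycle X A B a x y) z"
  by (simp add: cocycle_def precomposition whiskr_diff left_linear_maps mcomp_assoc)

text \<open>The associativity equation of linearity tracks with composition rewritten as addition;
  after expansion by \<open>\<Gamma>_eq\<close> the identity tracks of the three summands
  cancel.\<close>

lemma cocycle_cocycle:
  assumes [simp]: "X \<in> TObj F" "A \<in> TObj F" "B \<in> TObj F" "x \<in> maps F X A" "y \<in> maps F X A"
    "z \<in> maps F X A" "a \<in> maps F A B"
  shows "cocycle X A B a x y \<oplus>\<^bsub>TGrp F X B\<^esub> cocycle X A B a (madd F X A x y) z =
    cocycle X A B a y z \<oplus>\<^bsub>TGrp F X B\<^esub> cocycle X A B a x (madd F X A y z)"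
proof -
  interpret Q: abelian_group "TGrp F X B" by simp
  let ?i = "\<lambda>x. idtr F X B (mcomp F X A B a x)"
  have "(\<Gamma> X A B a x y \<oplus>\<^bsub>TGrp F X B\<^esub> ?i z) \<oplus>\<^bsub>TGrp F X B\<^esub> cocycle X A B a (madd F X A x y) z =
      (?i x \<oplus>\<^bsub>TGrp F X B\<^esub> \<Gamma> X A B a y z) \<oplus>\<^bsub>TGrp F X B\<^esub> cocycle X A B a x (madd F X A y z)"
    using associativity[of X A B x y z a] by (simp add: Comp_\<Gamma>_left Hom_arrow)
  then have "(cocycle X A B a x y \<oplus>\<^bsub>TGrp F X B\<^esub> cocycle X A B a (madd F X A x y) z) \<oplus>\<^bsub>TGrp F X B\<^esub>
        (?i x \<oplus>\<^bsub>TGrp F X B\<^esub> ?i y \<oplus>\<^bsub>TGrp F X B\<^esub> ?i z) =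
      (cocycle X A B a y z \<oplus>\<^bsub>TGrp F X B\<^esub> cocycle X A B a x (madd F X A y z)) \<oplus>\<^bsub>TGrp F X B\<^esub>
        (?i x \<oplus>\<^bsub>TGrp F X B\<^esub> ?i y \<oplus>\<^bsub>TGrp F X B\<^esub> ?i z)"
    by (simp add: \<Gamma>_eq Q.a_ac)
  then show ?thesis by (subst (asm) Q.add.right_cancel) simp_all
qed

text \<open>Precomposition with the zero map shows that the cocycle vanishes at two zeros; the
  cocycle identity at \<open>x\<close>, 0, 0 then gives the claim.\<close>

lemma cocycle_zero:
  assumes [simp]: "X \<in> TObj F" "A \<in> TObj F" "B \<in> TObj F" "x \<in> maps F X A" "a \<in> maps F A B"
  shows "cocycle X A B a x \<zero>\<^bsub>MGrp F X A\<^esub> = \<zero>\<^bsub>TGrp F X B\<^esub>"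
proof -
  interpret Q: abelian_group "TGrp F X B" by simp
  let ?z = "\<zero>\<^bsub>MGrp F X A\<^esub>"
  have "cocycle X A B a (mcomp F X X A ?z \<zero>\<^bsub>MGrp F X X\<^esub>) (mcomp F X X A ?z \<zero>\<^bsub>MGrp F X X\<^esub>) =
      whiskr F X X B (cocycle X A B a ?z ?z) \<zero>\<^bsub>MGrp F X X\<^esub>"
    by (rule cocycle_precomp) simp_all
  also have "\<dots> = idtr F X B \<zero>\<^bsub>MGrp F X B\<^esub>"
    by (simp add: whiskr_def tcomp_zero)
  also have "\<dots> = \<zero>\<^bsub>TGrp F X B\<^esub>"
    by (simp add: idtr_zero)
  finally have "cocycle X A B a ?z ?z = \<zero>\<^bsub>TGrp F X B\<^esub>" by (simp add: mcomp_zero)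
  then have "cocycle X A B a x ?z \<oplus>\<^bsub>TGrp F X B\<^esub> cocycle X A B a x ?z = cocycle X A B a x ?z"
    using cocycle_cocycle[of X A B x ?z ?z a] by simp
  then show ?thesis by simp
qed

lemma symmetric_cocycle_cocycle:
  assumes [simp]: "X \<in> TObj F" "A \<in> TObj F" "B \<in> TObj F" "a \<in> maps F A B"
  shows "symmetric_cocycle (MGrp F X A) (kernel X B) (cocycle X A B a)"
proof (intro symmetric_cocycle.intro symmetric_cocycle_axioms.intro MGrp_abelian_group kernel_abelian_group)
  show "cocycle X A B a x y = cocycle X A B a y x"
    if "x \<in> carrier (MGrp F X A)" "y \<in> carrier (MGrp F X A)" for x y
    using that by (intro cocycle_sym) simp_all
qed (simp_all add: cocycle_zero cocycle_cocycle)

text \<open>Naturality in the right variables for \<open>\<xi>\<close> ending at 0 and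
  \<open>\<eta>\<close> ending anywhere: the linearity track at the targets is an identity by
  normalisation, and the one at the sources contributes the cocycle. The target of
  \<open>\<eta>\<close> is left free because \<open>\<eta>\<close> is later an identity
  track.\<close>

lemma whiskl_add:
  assumes [simp]: "X \<in> TObj F" "A \<in> TObj F" "B \<in> TObj F" "a \<in> maps F A B"
    and \<xi>: "\<xi> \<in> carrier (kernel X A)" and \<eta> [simp]: "\<eta> \<in> tracks F X A"
  shows "whiskl F X A B a (\<xi> \<oplus>\<^bsub>TGrp F X A\<^esub> \<eta>) = whiskl F X A B a \<xi> \<oplus>\<^bsub>TGrp F X B\<^esub> whiskl F X A B a \<eta>
    \<oplus>\<^bsub>TGrp F X B\<^esub> cocycle X A B a (Src (Hom F X A) \<xi>) (Src (Hom F X A) \<eta>)"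
proof -
  interpret Q: abelian_group "TGrp F X B" by simp
  have [simp]: "\<xi> \<in> tracks F X A" "Tgt (Hom F X A) \<xi> = \<zero>\<^bsub>MGrp F X A\<^esub>" using \<xi> by simp_all
  let ?y = "Tgt (Hom F X A) \<eta>"
  have \<Gamma>: "\<Gamma> X A B a \<zero>\<^bsub>MGrp F X A\<^esub> ?y = idtr F X B (mcomp F X A B a ?y)"
    using cocycle_zero[of X A B ?y a] cocycle_sym[of X A B "\<zero>\<^bsub>MGrp F X A\<^esub>" ?y a]
    by (simp add: \<Gamma>_eq mcomp_zero idtr_zero)
  have "Comp (Hom F X B) (idtr F X B (mcomp F X A B a ?y)) (whiskl F X A B a (\<xi> \<oplus>\<^bsub>TGrp F X A\<^esub> \<eta>)) =
      whiskl F X A B a (\<xi> \<oplus>\<^bsub>TGrp F X A\<^esub> \<eta>)"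
    using Hom_Ident(1)[of X B "whiskl F X A B a (\<xi> \<oplus>\<^bsub>TGrp F X A\<^esub> \<eta>)"] by (simp add: Hom_arrow)
  then show ?thesis
    using naturality_right[of X A B a \<xi> "Src (Hom F X A) \<xi>" "\<zero>\<^bsub>MGrp F X A\<^esub>" \<eta> "Src (Hom F X A) \<eta>" ?y]
    by (simp add: arrow_def \<Gamma> Comp_\<Gamma>_left Hom_arrow)
qed

text \<open>Naturality in the left variable for a track ending at the zero map, whose linearity
  track is an identity because the cocycle is additive in the map.\<close>

lemma whiskr_add:
  assumes [simp]: "X \<in> TObj F" "A \<in> TObj F" "B \<in> TObj F" "x \<in> maps F X A" "y \<in> maps F X A"
    and \<alpha>: "\<alpha> \<in> carrier (kernel A B)"
  shows "whiskr F X A B \<alpha> (madd F X A x y) = whiskr F X A B \<alpha> x \<oplus>\<^bsub>TGrp F X B\<^esub> whiskr F X A B \<alpha> y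
    \<oplus>\<^bsub>TGrp F X B\<^esub> cocycle X A B (Src (Hom F A B) \<alpha>) x y"
proof -
  have [simp]: "\<alpha> \<in> tracks F A B" "Tgt (Hom F A B) \<alpha> = \<zero>\<^bsub>MGrp F A B\<^esub>" using \<alpha> by simp_all
  have "cocycle X A B \<zero>\<^bsub>MGrp F A B\<^esub> x y = \<zero>\<^bsub>TGrp F X B\<^esub>"
    using additive_map_zero[OF MGrp_abelian_group kernel_abelian_group cocycle_additive[of X A B x y]] by simp
  then have \<Gamma>: "\<Gamma> X A B \<zero>\<^bsub>MGrp F A B\<^esub> x y = idtr F X B \<zero>\<^bsub>MGrp F X B\<^esub>"
    by (simp add: \<Gamma>_eq zero_mcomp idtr_zero abelian_monoid.l_zero[OF abelian_group.axioms(1)])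
  have "Comp (Hom F X B) (idtr F X B \<zero>\<^bsub>MGrp F X B\<^esub>) (whiskr F X A B \<alpha> (madd F X A x y)) =
      whiskr F X A B \<alpha> (madd F X A x y)"
    using Hom_Ident(1)[of X B "whiskr F X A B \<alpha> (madd F X A x y)"] by (simp add: zero_mcomp)
  then show ?thesis
    using naturality_left[of X A B x y \<alpha> "Src (Hom F A B) \<alpha>" "\<zero>\<^bsub>MGrp F A B\<^esub>"]
    by (simp add: arrow_def \<Gamma> Comp_\<Gamma>_left Hom_arrow)
qed

text \<open>Whiskering by \<open>b\<close> is applied to a linearity track, that is, to a cocycle
  plus an identity track, and \<open>whiskl_add\<close> produces the third summand.\<close>

lemma cocycle_postcomp:
  assumes [simp]: "X \<in> TObj F" "A \<in> TObj F" "B \<in> TObj F" "C \<in> TObj F" "x \<in> maps F X A" "y \<in> maps F X A"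
    "a \<in> maps F A B" "b \<in> maps F B C"
  shows "cocycle X A C (mcomp F A B C b a) x y =
    cocycle X B C b (mcomp F X A B a x) (mcomp F X A B a y) \<oplus>\<^bsub>TGrp F X C\<^esub>
    whiskl F X B C b (cocycle X A B a x y) \<oplus>\<^bsub>TGrp F X C\<^esub>
    cocycle X B C b (madd F X B (mcomp F X A B a x) (mcomp F X A B a y)) (Src (Hom F X B) (cocycle X A B a x y))"
proof -
  interpret Q: abelian_group "TGrp F X C" by simp
  let ?s = "madd F X B (mcomp F X A B a x) (mcomp F X A B a y)"
  have "\<Gamma> X A B a x y = cocycle X A B a x y \<oplus>\<^bsub>TGrp F X B\<^esub> idtr F X B ?s"
    by (simp add: \<Gamma>_eq idtr_add)
  then have w: "whiskl F X B C b (\<Gamma> X A B a x y) = whiskl F X B C b (cocycle X A B a x y) \<oplus>\<^bsub>TGrp F X C\<^esub>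
      idtr F X C (mcomp F X B C b ?s) \<oplus>\<^bsub>TGrp F X C\<^esub>
      cocycle X B C b (Src (Hom F X B) (cocycle X A B a x y)) ?s"
    by (simp add: whiskl_add del: cocycle_simps(3))
  have sym: "cocycle X B C b (Src (Hom F X B) (cocycle X A B a x y)) ?s =
      cocycle X B C b ?s (Src (Hom F X B) (cocycle X A B a x y))"
    by (rule cocycle_sym) simp_all
  have eq: "\<Gamma> X A C (mcomp F A B C b a) x y =
      \<Gamma> X B C b (mcomp F X A B a x) (mcomp F X A B a y) \<oplus>\<^bsub>TGrp F X C\<^esub>
      (whiskl F X B C b (\<Gamma> X A B a x y) \<ominus>\<^bsub>TGrp F X C\<^esub> idtr F X C (mcomp F X B C b ?s))"
    by (simp add: postcomposition Hom_Comp_eq)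
  show ?thesis
    unfolding cocycle_def[of X A C] eq w sym
    by (simp add: \<Gamma>_eq[of X B C] mcomp_assoc idtr_add Q.group_simps del: cocycle_simps(3))
qed

lemma whisker_assoc:
  assumes [simp]: "A \<in> TObj F" "B \<in> TObj F" "C \<in> TObj F" "D \<in> TObj F"
  shows "\<lbrakk>x \<in> maps F A B; y \<in> maps F B C; \<alpha> \<in> tracks F C D\<rbrakk> \<Longrightarrow>
      whiskr F A B D (whiskr F B C D \<alpha> y) x = whiskr F A C D \<alpha> (mcomp F A B C y x)"
    and "\<lbrakk>\<alpha> \<in> tracks F A B; y \<in> maps F B C; z \<in> maps F C D\<rbrakk> \<Longrightarrow>
      whiskl F A B D (mcomp F B C D z y) \<alpha> = whiskl F A C D z (whiskl F A B C y \<alpha>)"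
    and "\<lbrakk>x \<in> maps F A B; \<alpha> \<in> tracks F B C; z \<in> maps F C D\<rbrakk> \<Longrightarrow>
      whiskr F A B D (whiskl F B C D z \<alpha>) x = whiskl F A C D z (whiskr F A B C \<alpha> x)"
  by (simp_all add: whiskr_def whiskl_def tcomp_assoc flip: tcomp_idtr)

lemma whisker_unit:
  assumes "A \<in> TObj F" "B \<in> TObj F" "\<alpha> \<in> tracks F A B"
  shows "whiskr F A A B \<alpha> (unit_map F A) = \<alpha>" "whiskl F A B B (unit_map F B) \<alpha> = \<alpha>"
  using assms by (simp_all add: whiskr_def whiskl_def tcomp_unit_left tcomp_unit_right)

text \<open>The torsion conditions stay as assumptions so that the integral and the modular case
  share all other verifications.\<close>

lemma linearity_cocycle_cocycle:
  assumes M: "\<And>A B x. \<lbrakk>A \<in> TObj F; B \<in> TObj F; x \<in> maps F A B\<rbrakk> \<Longrightarrow>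
      [N] \<cdot>\<^bsub>MGrp F A B\<^esub> x = \<zero>\<^bsub>MGrp F A B\<^esub>"
    and K: "\<And>A B k. \<lbrakk>A \<in> TObj F; B \<in> TObj F; k \<in> carrier (kernel A B)\<rbrakk> \<Longrightarrow>
      [N] \<cdot>\<^bsub>kernel A B\<^esub> k = \<zero>\<^bsub>kernel A B\<^esub>"
    and T: "\<And>X A B a e. \<lbrakk>X \<in> TObj F; A \<in> TObj F; B \<in> TObj F; a \<in> maps F A B;
        e \<in> carrier (twisted_sum (MGrp F X A) (kernel X B) (cocycle X A B a))\<rbrakk> \<Longrightarrow>
      [N] \<cdot>\<^bsub>twisted_sum (MGrp F X A) (kernel X B) (cocycle X A B a)\<^esub> e =
        \<zero>\<^bsub>twisted_sum (MGrp F X A) (kernel X B) (cocycle X A B a)\<^esub>"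
  shows "linearity_cocycle N (TObj F) (MGrp F) kernel source (mcomp F) (whiskl F) (whiskr F) (unit_map F) cocycle"
proof (rule linearity_cocycle.intro)
  show "torsion_group N (MGrp F A B)" "torsion_group N (kernel A B)"
    if "A \<in> TObj F" "B \<in> TObj F" for A B
    using that by (simp_all add: torsion_group_def torsion_group_axioms_def M K MGrp_abelian_group
        kernel_abelian_group del: kernel_simps)
  show "additive_map (kernel A B) (MGrp F A B) (source A B)" if "A \<in> TObj F" "B \<in> TObj F" for A B
    using that by (intro additive_mapI) (simp_all add: source_def Hom_arrow)
  have "madd F X B (source X B (cocycle X A B a x y)) (madd F X B (mcomp F X A B a x) (mcomp F X A B a y)) = z"
    if "z = mcomp F X A B a (madd F X A x y)" "X \<in> TObj F" "A \<in> TObj F" "B \<in> TObj F"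
    "x \<in> carrier (MGrp F X A)" "y \<in> carrier (MGrp F X A)" "a \<in> carrier (MGrp F A B)" for X A B x y a z
    using that by (simp add: source_def abelian_group.minus_add_cancel MGrp_abelian_group)
  then show "mcomp F X A B a (madd F X A x y) =
      madd F X B (source X B (cocycle X A B a x y)) (madd F X B (mcomp F X A B a x) (mcomp F X A B a y))"
    if "X \<in> TObj F" "A \<in> TObj F" "B \<in> TObj F"
    "x \<in> carrier (MGrp F X A)" "y \<in> carrier (MGrp F X A)" "a \<in> carrier (MGrp F A B)" for X A B x y a
    using that by metis
  show "whiskl F X A B a (k \<oplus>\<^bsub>kernel X A\<^esub> l) = whiskl F X A B a k \<oplus>\<^bsub>kernel X B\<^esub> whiskl F X A B a l
      \<oplus>\<^bsub>kernel X B\<^esub> cocycle X A B a (source X A k) (source X A l)"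
    if "X \<in> TObj F" "A \<in> TObj F" "B \<in> TObj F" "k \<in> carrier (kernel X A)" "l \<in> carrier (kernel X A)"
      "a \<in> carrier (MGrp F A B)" for X A B k l a
    using that whiskl_add[of X A B a k l] by (simp add: source_def)
qed (simp_all add: T mcomp_additive whiskr_kernel_additive whiskl_kernel_additive cocycle_additive
  unit_closed mcomp_assoc mcomp_unit_left mcomp_unit_right symmetric_cocycle_cocycle cocycle_precomp
  cocycle_postcomp whiskr_add whisker_exchange source_def del: kernel_simps,
  simp_all add: whisker_assoc whisker_unit)

end

section \<open>The track category of a truncated DG-category\<close>

context truncated_dg_category
begin

lemma Deg_groups [simp]:
  assumes "A \<in> DObj \<B>" "B \<in> DObj \<B>"
  shows "abelian_group (Deg0 \<B> A B)" "abelian_group (Deg1 \<B> A B)"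
  using Deg0_module[OF assms] Deg1_module[OF assms] by (simp_all add: module_def)

lemmas Deg_ops [simp] =
  Deg_groups[THEN abelian_group.axioms(1), THEN abelian_monoid.a_closed]
  Deg_groups[THEN abelian_group.axioms(1), THEN abelian_monoid.zero_closed]
  Deg_groups[THEN abelian_group.axioms(1), THEN abelian_monoid.l_zero]
  Deg_groups[THEN abelian_group.axioms(1), THEN abelian_monoid.r_zero]
  Deg_groups[THEN abelian_group.a_inv_closed]

lemma linear_additive: "is_linear_map R M L f \<Longrightarrow> additive_map M L f"
  by (simp add: is_linear_map_def additive_map_def)

lemma bdry_additive:
  "\<lbrakk>A \<in> DObj \<B>; B \<in> DObj \<B>\<rbrakk> \<Longrightarrow> additive_map (Deg1 \<B> A B) (Deg0 \<B> A B) (bdry \<B> A B)"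
  by (rule linear_additive[OF bdry_linear])

lemma dcomp_additive:
  assumes "A \<in> DObj \<B>" "B \<in> DObj \<B>" "C \<in> DObj \<B>"
  shows "x \<in> carrier (Deg0 \<B> B C) \<Longrightarrow> additive_map (Deg0 \<B> A B) (Deg0 \<B> A C) (dcomp00 \<B> A B C x)"
    and "y \<in> carrier (Deg0 \<B> A B) \<Longrightarrow> additive_map (Deg0 \<B> B C) (Deg0 \<B> A C) (\<lambda>x. dcomp00 \<B> A B C x y)"
    and "x \<in> carrier (Deg0 \<B> B C) \<Longrightarrow> additive_map (Deg1 \<B> A B) (Deg1 \<B> A C) (dcomp01 \<B> A B C x)"
    and "b \<in> carrier (Deg1 \<B> A B) \<Longrightarrow> additive_map (Deg0 \<B> B C) (Deg1 \<B> A C) (\<lambda>x. dcomp01 \<B> A B C x b)"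
    and "a \<in> carrier (Deg1 \<B> B C) \<Longrightarrow> additive_map (Deg0 \<B> A B) (Deg1 \<B> A C) (dcomp10 \<B> A B C a)"
    and "y \<in> carrier (Deg0 \<B> A B) \<Longrightarrow> additive_map (Deg1 \<B> B C) (Deg1 \<B> A C) (\<lambda>a. dcomp10 \<B> A B C a y)"
  using dcomp00_bilinear[OF assms] dcomp01_bilinear[OF assms] dcomp10_bilinear[OF assms]
  by (simp_all add: is_bilinear_map_def linear_additive)

lemmas dclosed [simp] = additive_map_closed[OF bdry_additive] additive_map_closed[OF dcomp_additive(1)]
  additive_map_closed[OF dcomp_additive(3)] additive_map_closed[OF dcomp_additive(5)]

lemmas dcomp_zero [simp] =
  additive_map_zero[OF Deg_groups(2) Deg_groups(1) bdry_additive]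
  additive_map_zero[OF Deg_groups(1) Deg_groups(1) dcomp_additive(1)]
  additive_map_zero[OF Deg_groups(1) Deg_groups(1) dcomp_additive(2)]
  additive_map_zero[OF Deg_groups(2) Deg_groups(2) dcomp_additive(3)]
  additive_map_zero[OF Deg_groups(1) Deg_groups(2) dcomp_additive(4)]
  additive_map_zero[OF Deg_groups(1) Deg_groups(2) dcomp_additive(5)]
  additive_map_zero[OF Deg_groups(2) Deg_groups(2) dcomp_additive(6)]

lemmas dcomp_add =
  additive_map_add[OF bdry_additive] dcomp_additive[THEN additive_map_add]

lemma bdry_minus: "\<lbrakk>A \<in> DObj \<B>; B \<in> DObj \<B>; x \<in> carrier (Deg1 \<B> A B)\<rbrakk> \<Longrightarrow>
    bdry \<B> A B (\<ominus>\<^bsub>Deg1 \<B> A B\<^esub> x) = \<ominus>\<^bsub>Deg0 \<B> A B\<^esub> bdry \<B> A B x"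
  by (rule additive_map_minus[OF Deg_groups(2) Deg_groups(1) bdry_additive])

lemma groupoid_\<Theta>_Hom:
  assumes [simp]: "A \<in> DObj \<B>" "B \<in> DObj \<B>"
  shows "groupoid (\<Theta>_Hom \<B> A B)"
proof -
  interpret D0: abelian_group "Deg0 \<B> A B" by simp
  interpret D1: abelian_group "Deg1 \<B> A B" by simp
  have cat: "category (\<Theta>_Hom \<B> A B)"
    by unfold_locales (auto simp: \<Theta>_Hom_def dcomp_add D0.a_ac D1.a_ac)
  have "is_invertible (\<Theta>_Hom \<B> A B) f" if "f \<in> Arr (\<Theta>_Hom \<B> A B)" for f
  proof -
    obtain x1 x0 where "f = (x1, x0)" by (cases f)
    then have f: "f = (x1, x0)" "x1 \<in> carrier (Deg1 \<B> A B)" "x0 \<in> carrier (Deg0 \<B> A B)"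
      using that by (auto simp: \<Theta>_Hom_def)
    have "\<ominus>\<^bsub>Deg0 \<B> A B\<^esub> bdry \<B> A B x1 \<oplus>\<^bsub>Deg0 \<B> A B\<^esub> (bdry \<B> A B x1 \<oplus>\<^bsub>Deg0 \<B> A B\<^esub> x0) = x0"
      using f by (simp add: D0.a_assoc[symmetric] D0.l_neg)
    then show ?thesis
      unfolding is_invertible_def using f
      by (intro conjI exI[of _ "(\<ominus>\<^bsub>Deg1 \<B> A B\<^esub> x1, bdry \<B> A B x1 \<oplus>\<^bsub>Deg0 \<B> A B\<^esub> x0)"])
         (auto simp: \<Theta>_Hom_def arrow_def bdry_minus D1.l_neg D1.r_neg)
  qed
  then show ?thesis using cat by (simp add: groupoid_def groupoid_axioms_def)
qed

text \<open>The substantial point is interchange. Expanding both sides leaves a product of two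
  elements of degree 1, once with the boundary taken of the left factor and once of the right; these
  agree by \<open>bdry_exchange\<close>.\<close>

lemma \<Theta>_comp_functor:
  assumes [simp]: "A \<in> DObj \<B>" "B \<in> DObj \<B>" "C \<in> DObj \<B>"
  shows "is_functor (prod_category (\<Theta>_Hom \<B> B C) (\<Theta>_Hom \<B> A B)) (\<Theta>_Hom \<B> A C)
    (\<lambda>(a, x). mcomp (\<Theta> \<B>) A B C a x) (\<lambda>(\<alpha>, \<xi>). tcomp (\<Theta> \<B>) A B C \<alpha> \<xi>)"
proof -
  interpret D0: abelian_group "Deg0 \<B> A C" by simp
  interpret D1: abelian_group "Deg1 \<B> A C" by simp
  interpret G: groupoid "\<Theta>_Hom \<B> B C" by (rule groupoid_\<Theta>_Hom) simp_all
  interpret H: groupoid "\<Theta>_Hom \<B> A B" by (rule groupoid_\<Theta>_Hom) simp_all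
  interpret K: groupoid "\<Theta>_Hom \<B> A C" by (rule groupoid_\<Theta>_Hom) simp_all
  have "category (prod_category (\<Theta>_Hom \<B> B C) (\<Theta>_Hom \<B> A B))"
    by unfold_locales (auto simp: prod_category_def G.Src_closed G.Tgt_closed G.Ident_closed G.Src_Ident
      G.Tgt_Ident G.Comp_closed G.Src_Comp G.Tgt_Comp G.Comp_Ident_right G.Comp_Ident_left G.Comp_assoc
      H.Src_closed H.Tgt_closed H.Ident_closed H.Src_Ident H.Tgt_Ident H.Comp_closed H.Src_Comp
      H.Tgt_Comp H.Comp_Ident_right H.Comp_Ident_left H.Comp_assoc)
  then show ?thesis
    using K.category_axioms
    by (auto simp: is_functor_def prod_category_def arrow_def \<Theta>_Hom_def \<Theta>_def dcomp_add
        bdry_dcomp01 bdry_dcomp10 bdry_exchange D0.a_ac D1.a_ac)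
qed

lemma track_category_\<Theta>: "track_category (\<Theta> \<B>)"
proof (rule track_category.intro)
  fix A B C assume "A \<in> TObj (\<Theta> \<B>)" "B \<in> TObj (\<Theta> \<B>)" "C \<in> TObj (\<Theta> \<B>)"
  then show "is_functor (prod_category (Hom (\<Theta> \<B>) B C) (Hom (\<Theta> \<B>) A B)) (Hom (\<Theta> \<B>) A C)
      (\<lambda>(a, x). mcomp (\<Theta> \<B>) A B C a x) (\<lambda>(\<alpha>, \<xi>). tcomp (\<Theta> \<B>) A B C \<alpha> \<xi>)"
    using \<Theta>_comp_functor[of A B C] by (simp add: \<Theta>_def)
next
  fix A B C D \<xi> \<eta> \<zeta>
  assume "A \<in> TObj (\<Theta> \<B>)" "B \<in> TObj (\<Theta> \<B>)" "C \<in> TObj (\<Theta> \<B>)" "D \<in> TObj (\<Theta> \<B>)"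
    and t: "\<xi> \<in> tracks (\<Theta> \<B>) A B" "\<eta> \<in> tracks (\<Theta> \<B>) B C" "\<zeta> \<in> tracks (\<Theta> \<B>) C D"
  then have [simp]: "A \<in> DObj \<B>" "B \<in> DObj \<B>" "C \<in> DObj \<B>" "D \<in> DObj \<B>"
    by (simp_all add: \<Theta>_def)
  interpret D1: abelian_group "Deg1 \<B> A D" by simp
  show "tcomp (\<Theta> \<B>) A B D (tcomp (\<Theta> \<B>) B C D \<zeta> \<eta>) \<xi> = tcomp (\<Theta> \<B>) A C D \<zeta> (tcomp (\<Theta> \<B>) A B C \<eta> \<xi>)"
    using t by (auto simp: \<Theta>_def \<Theta>_Hom_def dcomp_add assoc000 assoc001 assoc010 assoc100
        bdry_dcomp01 bdry_dcomp10 D1.a_ac)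
qed (auto simp: \<Theta>_def groupoid_\<Theta>_Hom, auto simp: \<Theta>_Hom_def assoc000 dunit_closed dunit_left0
    dunit_right0 dunit_left1 dunit_right1)

end

section \<open>A criterion for equivalences\<close>

context category
begin

lemma arrow_Comp: "\<lbrakk>arrow C f x y; arrow C g y z\<rbrakk> \<Longrightarrow> arrow C (Comp C g f) x z"
  by (simp add: arrow_def Comp_closed Src_Comp Tgt_Comp)

lemma arrow_Ident: "x \<in> Obj C \<Longrightarrow> arrow C (Ident C x) x x"
  by (simp add: arrow_def Ident_closed Src_Ident Tgt_Ident)

lemma arrow_Ident_left: "arrow C f x y \<Longrightarrow> Comp C (Ident C y) f = f"
  by (auto simp: arrow_def Comp_Ident_left)

lemma arrow_Ident_right: "arrow C f x y \<Longrightarrow> Comp C f (Ident C x) = f"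
  by (auto simp: arrow_def Comp_Ident_right)

lemma arrow_assoc: "\<lbrakk>arrow C f x y; arrow C g y z; arrow C h z w\<rbrakk> \<Longrightarrow>
    Comp C (Comp C h g) f = Comp C h (Comp C g f)"
  by (auto simp: arrow_def Comp_assoc)

lemma arrow_Obj: "arrow C f x y \<Longrightarrow> x \<in> Obj C \<and> y \<in> Obj C"
  by (auto simp: arrow_def Src_closed Tgt_closed)

end

lemma is_functor_comp:
  assumes "is_functor C D Fo Fa" "is_functor D E Go Ga"
  shows "is_functor C E (Go \<circ> Fo) (Ga \<circ> Fa)"
  using assms unfolding is_functor_def arrow_def by auto

lemma is_functor_id: "category C \<Longrightarrow> is_functor C C id id"
  by (simp add: is_functor_def arrow_def)

lemma is_functor_arrow: "\<lbrakk>is_functor C D Fo Fa; arrow C f x y\<rbrakk> \<Longrightarrow> arrow D (Fa f) (Fo x) (Fo y)"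
  by (auto simp: is_functor_def arrow_def)

lemma is_functor_Comp: "\<lbrakk>is_functor C D Fo Fa; arrow C f x y; arrow C g y z\<rbrakk> \<Longrightarrow>
    Fa (Comp C g f) = Comp D (Fa g) (Fa f)"
  by (auto simp: is_functor_def arrow_def)

text \<open>\<open>is_equivalence\<close> demands a quasi-inverse with unit and counit. It is built
  by choice: objects and isomorphisms \<open>\<epsilon>\<close> from essential surjectivity, arrows
  as unique lifts.\<close>

lemma fully_faithful_essentially_surjective_equivalence:
  assumes F: "is_functor C D Fo Fa"
    and ff: "\<And>x y g. \<lbrakk>x \<in> Obj C; y \<in> Obj C; arrow D g (Fo x) (Fo y)\<rbrakk> \<Longrightarrow> \<exists>!f. arrow C f x y \<and> Fa f = g"
    and es: "\<And>z. z \<in> Obj D \<Longrightarrow> \<exists>x e. x \<in> Obj C \<and> arrow D e (Fo x) z \<and> is_invertible D e"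
  shows "is_equivalence C D Fo Fa"
proof -
  interpret C: category C using F by (simp add: is_functor_def)
  interpret D: category D using F by (simp add: is_functor_def)
  have "\<exists>x e e'. x \<in> Obj C \<and> arrow D e (Fo x) z \<and> arrow D e' z (Fo x) \<and>
      Comp D e' e = Ident D (Fo x) \<and> Comp D e e' = Ident D z" if z: "z \<in> Obj D" for z
  proof -
    obtain x e where "x \<in> Obj C" "arrow D e (Fo x) z" "is_invertible D e" using es[OF z] by blast
    moreover from this obtain e' where "arrow D e' z (Fo x)"
      "Comp D e' e = Ident D (Fo x)" "Comp D e e' = Ident D z"
      by (auto simp: is_invertible_def arrow_def)
    ultimately show ?thesis by blast
  qed
  then obtain Go \<epsilon> \<epsilon>' where GE: "\<forall>z\<in>Obj D. Go z \<in> Obj C \<and> arrow D (\<epsilon> z) (Fo (Go z)) z \<and>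
      arrow D (\<epsilon>' z) z (Fo (Go z)) \<and> Comp D (\<epsilon>' z) (\<epsilon> z) = Ident D (Fo (Go z)) \<and>
      Comp D (\<epsilon> z) (\<epsilon>' z) = Ident D z"
    by metis
  then have Go: "Go z \<in> Obj C" and \<epsilon>: "arrow D (\<epsilon> z) (Fo (Go z)) z" and \<epsilon>': "arrow D (\<epsilon>' z) z (Fo (Go z))"
    and \<epsilon>'\<epsilon>: "Comp D (\<epsilon>' z) (\<epsilon> z) = Ident D (Fo (Go z))" and \<epsilon>\<epsilon>': "Comp D (\<epsilon> z) (\<epsilon>' z) = Ident D z"
    if "z \<in> Obj D" for z using that by blast+
  have Fo: "Fo x \<in> Obj D" if "x \<in> Obj C" for x using F that by (auto simp: is_functor_def)
  have Fa_Ident: "Fa (Ident C x) = Ident D (Fo x)" if "x \<in> Obj C" for x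
    using F that by (auto simp: is_functor_def)
  have inj: "f = f'" if "arrow C f x y" "arrow C f' x y" "Fa f = Fa f'" for f f' x y
    using ff[of x y "Fa f"] that C.arrow_Obj[OF that(1)] is_functor_arrow[OF F that(1)] by metis
  \<comment> \<open>The unique lift of \<open>g\<close> conjugated by the chosen isomorphisms;
    naturality of \<open>\<epsilon>\<close> forces this value.\<close>
  define Ga where "Ga g = (THE f. arrow C f (Go (Src D g)) (Go (Tgt D g)) \<and>
      Fa f = Comp D (\<epsilon>' (Tgt D g)) (Comp D g (\<epsilon> (Src D g))))" for g
  have Ga: "arrow C (Ga g) (Go z) (Go w) \<and> Fa (Ga g) = Comp D (\<epsilon>' w) (Comp D g (\<epsilon> z))"
    if g: "arrow D g z w" for g z w
  proof -
    have zw: "z \<in> Obj D" "w \<in> Obj D" "Src D g = z" "Tgt D g = w"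
      using D.arrow_Obj[OF g] g by (auto simp: arrow_def)
    have "arrow D (Comp D (\<epsilon>' w) (Comp D g (\<epsilon> z))) (Fo (Go z)) (Fo (Go w))"
      using g zw \<epsilon> \<epsilon>' by (meson D.arrow_Comp)
    from theI'[OF ff[OF Go Go this]] zw show ?thesis by (simp add: Ga_def)
  qed
  note Ga_arrow = Ga[THEN conjunct1] and Fa_Ga = Ga[THEN conjunct2]
  have \<epsilon>_Fa_Ga: "Comp D (\<epsilon> w) (Fa (Ga g)) = Comp D g (\<epsilon> z)" if g: "arrow D g z w" for g z w
  proof -
    have zw: "z \<in> Obj D" "w \<in> Obj D" using D.arrow_Obj[OF g] by auto
    have ge: "arrow D (Comp D g (\<epsilon> z)) (Fo (Go z)) w" by (rule D.arrow_Comp[OF \<epsilon>[OF zw(1)] g])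
    have "Comp D (\<epsilon> w) (Comp D (\<epsilon>' w) (Comp D g (\<epsilon> z))) = Comp D (Comp D (\<epsilon> w) (\<epsilon>' w)) (Comp D g (\<epsilon> z))"
      by (rule D.arrow_assoc[OF ge \<epsilon>'[OF zw(2)] \<epsilon>[OF zw(2)], symmetric])
    then show ?thesis using Fa_Ga[OF g] D.arrow_Ident_left[OF ge] by (simp add: \<epsilon>\<epsilon>' zw)
  qed
  \<comment> \<open>\<open>\<epsilon> w\<close> is left cancellable. Together with
    \<open>inj\<close>, an equation of arrows in \<open>C\<close> may be tested after applying
    \<open>Fa\<close> and composing with \<open>\<epsilon>\<close>.\<close>
  have \<epsilon>_cancel: "h = h'" if "arrow D h u (Fo (Go w))" "arrow D h' u (Fo (Go w))" "w \<in> Obj D"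
    "Comp D (\<epsilon> w) h = Comp D (\<epsilon> w) h'" for h h' u w
    using D.arrow_assoc[OF that(1) \<epsilon>[OF that(3)] \<epsilon>'[OF that(3)]]
      D.arrow_assoc[OF that(2) \<epsilon>[OF that(3)] \<epsilon>'[OF that(3)]]
      D.arrow_Ident_left[OF that(1)] D.arrow_Ident_left[OF that(2)] that(4) \<epsilon>'\<epsilon>[OF that(3)] by simp
  have G: "is_functor D C Go Ga"
    unfolding is_functor_def
  proof (intro conjI ballI impI)
    show "category D" "category C" by (rule D.category_axioms C.category_axioms)+
    show "Go z \<in> Obj C" if "z \<in> Obj D" for z by (rule Go[OF that])
    show "arrow C (Ga g) (Go (Src D g)) (Go (Tgt D g))" if "g \<in> Arr D" for g
      by (rule Ga_arrow) (use that in \<open>simp add: arrow_def\<close>)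
    show "Ga (Ident D z) = Ident C (Go z)" if z: "z \<in> Obj D" for z
    proof (rule inj[OF Ga_arrow[OF D.arrow_Ident[OF z]] C.arrow_Ident[OF Go[OF z]]])
      show "Fa (Ga (Ident D z)) = Fa (Ident C (Go z))"
        using z by (simp add: Fa_Ga[OF D.arrow_Ident[OF z]] D.arrow_Ident_left[OF \<epsilon>[OF z]] \<epsilon>'\<epsilon> Fa_Ident Go)
    qed
    fix f g assume "f \<in> Arr D" "g \<in> Arr D" "Tgt D f = Src D g"
    then obtain x y z where f: "arrow D f x y" and g: "arrow D g y z" by (auto simp: arrow_def)
    have x: "x \<in> Obj D" and z: "z \<in> Obj D" and y: "y \<in> Obj D" using f g D.arrow_Obj by blast+
    note gf = D.arrow_Comp[OF f g]
    note FF = is_functor_arrow[OF F Ga_arrow[OF f]] is_functor_arrow[OF F Ga_arrow[OF g]]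
    show "Ga (Comp D g f) = Comp C (Ga g) (Ga f)"
    proof (rule inj[OF Ga_arrow[OF gf] C.arrow_Comp[OF Ga_arrow[OF f] Ga_arrow[OF g]]],
        rule \<epsilon>_cancel[OF _ _ z])
      show "arrow D (Fa (Ga (Comp D g f))) (Fo (Go x)) (Fo (Go z))"
        by (rule is_functor_arrow[OF F Ga_arrow[OF gf]])
      show "arrow D (Fa (Comp C (Ga g) (Ga f))) (Fo (Go x)) (Fo (Go z))"
        by (rule is_functor_arrow[OF F C.arrow_Comp[OF Ga_arrow[OF f] Ga_arrow[OF g]]])
      have "Comp D (\<epsilon> z) (Fa (Comp C (Ga g) (Ga f))) = Comp D (Comp D (\<epsilon> z) (Fa (Ga g))) (Fa (Ga f))"
        by (simp add: is_functor_Comp[OF F Ga_arrow[OF f] Ga_arrow[OF g]] D.arrow_assoc[OF FF \<epsilon>[OF z]])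
      also have "\<dots> = Comp D g (Comp D (\<epsilon> y) (Fa (Ga f)))"
        by (simp add: \<epsilon>_Fa_Ga[OF g] D.arrow_assoc[OF FF(1) \<epsilon>[OF y] g])
      also have "\<dots> = Comp D (Comp D g f) (\<epsilon> x)"
        by (simp add: \<epsilon>_Fa_Ga[OF f] D.arrow_assoc[OF \<epsilon>[OF x] f g])
      finally show "Comp D (\<epsilon> z) (Fa (Ga (Comp D g f))) = Comp D (\<epsilon> z) (Fa (Comp C (Ga g) (Ga f)))"
        by (simp add: \<epsilon>_Fa_Ga[OF gf])
    qed
  qed
  have inv: "is_invertible D (\<epsilon> z)" if "z \<in> Obj D" for z
    using \<epsilon>[OF that] \<epsilon>'[OF that] \<epsilon>'\<epsilon>[OF that] \<epsilon>\<epsilon>'[OF that]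
    by (auto simp: is_invertible_def arrow_def)
  have counit: "natural_iso D D (Fo \<circ> Go) (Fa \<circ> Ga) id id \<epsilon>"
    unfolding natural_iso_def
  proof (intro conjI ballI)
    show "is_functor D D (Fo \<circ> Go) (Fa \<circ> Ga)" by (rule is_functor_comp[OF G F])
    show "is_functor D D id id" by (rule is_functor_id[OF D.category_axioms])
    show "Comp D (\<epsilon> (Tgt D f)) ((Fa \<circ> Ga) f) = Comp D (id f) (\<epsilon> (Src D f))" if "f \<in> Arr D" for f
      using \<epsilon>_Fa_Ga[of f "Src D f" "Tgt D f"] that by (simp add: arrow_def)
  qed (use \<epsilon> inv in auto)
  \<comment> \<open>The unit is the lift of the inverse of the counit, and its own inverse is the
    lift of the counit.\<close>
  have "\<exists>u u'. arrow C u x (Go (Fo x)) \<and> arrow C u' (Go (Fo x)) x \<and> Fa u = \<epsilon>' (Fo x) \<and> Fa u' = \<epsilon> (Fo x)"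
    if "x \<in> Obj C" for x
    using ff[of x "Go (Fo x)" "\<epsilon>' (Fo x)"] ff[of "Go (Fo x)" x "\<epsilon> (Fo x)"] that Fo Go \<epsilon> \<epsilon>' by metis
  then obtain \<eta> \<eta>' where \<eta>\<eta>': "\<forall>x\<in>Obj C. arrow C (\<eta> x) x (Go (Fo x)) \<and> arrow C (\<eta>' x) (Go (Fo x)) x \<and>
      Fa (\<eta> x) = \<epsilon>' (Fo x) \<and> Fa (\<eta>' x) = \<epsilon> (Fo x)"
    by metis
  then have \<eta>: "arrow C (\<eta> x) x (Go (Fo x))" and \<eta>': "arrow C (\<eta>' x) (Go (Fo x)) x"
    and Fa_\<eta>: "Fa (\<eta> x) = \<epsilon>' (Fo x)" and Fa_\<eta>': "Fa (\<eta>' x) = \<epsilon> (Fo x)" if "x \<in> Obj C" for x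
    using that by blast+
  have unit: "natural_iso C C id id (Go \<circ> Fo) (Ga \<circ> Fa) \<eta>"
    unfolding natural_iso_def
  proof (intro conjI ballI)
    show "is_functor C C (Go \<circ> Fo) (Ga \<circ> Fa)" by (rule is_functor_comp[OF F G])
    show "is_functor C C id id" by (rule is_functor_id[OF C.category_axioms])
    fix x assume x: "x \<in> Obj C"
    show "arrow C (\<eta> x) (id x) ((Go \<circ> Fo) x)" using \<eta>[OF x] by simp
    have "Comp C (\<eta>' x) (\<eta> x) = Ident C x"
      by (rule inj[OF C.arrow_Comp[OF \<eta>[OF x] \<eta>'[OF x]] C.arrow_Ident[OF x]])
         (simp add: is_functor_Comp[OF F \<eta>[OF x] \<eta>'[OF x]] Fa_\<eta> Fa_\<eta>' \<epsilon>\<epsilon>' Fo Fa_Ident x)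
    moreover have "Comp C (\<eta> x) (\<eta>' x) = Ident C (Go (Fo x))"
      by (rule inj[OF C.arrow_Comp[OF \<eta>'[OF x] \<eta>[OF x]] C.arrow_Ident[OF Go[OF Fo[OF x]]]])
         (simp add: is_functor_Comp[OF F \<eta>'[OF x] \<eta>[OF x]] Fa_\<eta> Fa_\<eta>' \<epsilon>'\<epsilon> Fo Go Fa_Ident x)
    ultimately show "is_invertible C (\<eta> x)"
      using \<eta>[OF x] \<eta>'[OF x] by (auto simp: is_invertible_def arrow_def)
  next
    fix f assume "f \<in> Arr C"
    then obtain x y where f: "arrow C f x y" by (auto simp: arrow_def)
    then have x: "x \<in> Obj C" and y: "y \<in> Obj C" using C.arrow_Obj by blast+
    note Ff = is_functor_arrow[OF F f]
    have "Comp C (\<eta> y) f = Comp C (Ga (Fa f)) (\<eta> x)"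
    proof (rule inj[OF C.arrow_Comp[OF f \<eta>[OF y]] C.arrow_Comp[OF \<eta>[OF x] Ga_arrow[OF Ff]]],
        rule \<epsilon>_cancel[OF _ _ Fo[OF y]])
      show "arrow D (Fa (Comp C (\<eta> y) f)) (Fo x) (Fo (Go (Fo y)))"
        by (rule is_functor_arrow[OF F C.arrow_Comp[OF f \<eta>[OF y]]])
      show "arrow D (Fa (Comp C (Ga (Fa f)) (\<eta> x))) (Fo x) (Fo (Go (Fo y)))"
        by (rule is_functor_arrow[OF F C.arrow_Comp[OF \<eta>[OF x] Ga_arrow[OF Ff]]])
      note e = \<epsilon>[OF Fo[OF y]] \<epsilon>'[OF Fo[OF y]] \<epsilon>[OF Fo[OF x]] \<epsilon>'[OF Fo[OF x]]
      have "Comp D (\<epsilon> (Fo y)) (Fa (Comp C (\<eta> y) f)) = Fa f"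
        by (simp add: is_functor_Comp[OF F f \<eta>[OF y]] Fa_\<eta> y D.arrow_assoc[OF Ff e(2,1), symmetric]
            \<epsilon>\<epsilon>' Fo D.arrow_Ident_left[OF Ff])
      also have "\<dots> = Comp D (Comp D (\<epsilon> (Fo y)) (Fa (Ga (Fa f)))) (\<epsilon>' (Fo x))"
        by (simp add: \<epsilon>_Fa_Ga[OF Ff] D.arrow_assoc[OF e(4,3) Ff] \<epsilon>\<epsilon>' Fo x D.arrow_Ident_right[OF Ff])
      also have "\<dots> = Comp D (\<epsilon> (Fo y)) (Fa (Comp C (Ga (Fa f)) (\<eta> x)))"
        by (simp add: is_functor_Comp[OF F \<eta>[OF x] Ga_arrow[OF Ff]] Fa_\<eta> x
            D.arrow_assoc[OF e(4) is_functor_arrow[OF F Ga_arrow[OF Ff]] e(1)])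
      finally show "Comp D (\<epsilon> (Fo y)) (Fa (Comp C (\<eta> y) f)) =
          Comp D (\<epsilon> (Fo y)) (Fa (Comp C (Ga (Fa f)) (\<eta> x)))" .
    qed
    then show "Comp C (\<eta> (Tgt C f)) (id f) = Comp C ((Ga \<circ> Fa) f) (\<eta> (Src C f))"
      using f by (simp add: arrow_def)
  qed
  show ?thesis unfolding is_equivalence_def using F G unit counit by blast
qed


section \<open>Homotopy categories\<close>

lemma (in category) is_invertible_Ident:
  assumes x: "x \<in> Obj C"
  shows "is_invertible C (Ident C x)"
  unfolding is_invertible_def
  using arrow_Ident[OF x] arrow_Ident_left[OF arrow_Ident[OF x]]
  by (intro conjI exI[of _ "Ident C x"]) (simp_all add: Src_Ident Tgt_Ident x arrow_def)

lemma groupoid_conn_equiv: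
  assumes "groupoid G"
  shows "equiv (Obj G) (conn G)"
proof -
  interpret groupoid G by fact
  show ?thesis
  proof (rule equivI)
    show "conn G \<subseteq> Obj G \<times> Obj G" by (auto simp: conn_def)
    show "refl_on (Obj G) (conn G)"
      using arrow_Ident by (auto simp: refl_on_def conn_def)
    show "sym (conn G)"
    proof (rule symI)
      fix x y assume "(x, y) \<in> conn G"
      then obtain f where "arrow G f x y" "x \<in> Obj G" "y \<in> Obj G" by (auto simp: conn_def)
      with Arr_iso[of f] show "(y, x) \<in> conn G"
        by (auto simp: conn_def is_invertible_def arrow_def)
    qed
    show "trans (conn G)"
      by (rule transI) (use arrow_Comp in \<open>fastforce simp: conn_def\<close>)
  qed
qed

context track_category
begin

abbreviation hclass :: "'o \<Rightarrow> 'o \<Rightarrow> 'm \<Rightarrow> 'm set" where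
  "hclass A B x \<equiv> conn (Hom T A B) `` {x}"

lemma conn_equiv: "\<lbrakk>A \<in> TObj T; B \<in> TObj T\<rbrakk> \<Longrightarrow> equiv (maps T A B) (conn (Hom T A B))"
  by (rule groupoid_conn_equiv[OF groupoid_Hom])

lemma mcomp_closed:
  "\<lbrakk>A \<in> TObj T; B \<in> TObj T; C \<in> TObj T; a \<in> maps T B C; x \<in> maps T A B\<rbrakk> \<Longrightarrow>
    mcomp T A B C a x \<in> maps T A C"
  using comp_functor[of A B C] by (auto simp: is_functor_def prod_category_def)

lemma mcomp_conn:
  assumes "A \<in> TObj T" "B \<in> TObj T" "C \<in> TObj T"
    "(a, a') \<in> conn (Hom T B C)" "(x, x') \<in> conn (Hom T A B)"
  shows "(mcomp T A B C a x, mcomp T A B C a' x') \<in> conn (Hom T A C)"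
proof -
  obtain \<alpha> \<xi> where "arrow (Hom T B C) \<alpha> a a'" "arrow (Hom T A B) \<xi> x x'"
    and m: "a \<in> maps T B C" "a' \<in> maps T B C" "x \<in> maps T A B" "x' \<in> maps T A B"
    using assms(4,5) by (auto simp: conn_def)
  then have "arrow (prod_category (Hom T B C) (Hom T A B)) (\<alpha>, \<xi>) (a, x) (a', x')"
    by (simp add: arrow_def prod_category_def)
  from is_functor_arrow[OF comp_functor[OF assms(1-3)] this]
  show ?thesis using m assms(1-3) by (auto simp: conn_def mcomp_closed)
qed

lemma hclass_eq: "\<lbrakk>A \<in> TObj T; B \<in> TObj T; (x, y) \<in> conn (Hom T A B)\<rbrakk> \<Longrightarrow> hclass A B x = hclass A B y"
  by (rule equiv_class_eq[OF conn_equiv])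

text \<open>Composition respects connectedness in both arguments, so all classes in the union
  coincide, and the union is over nonempty sets.\<close>

lemma hclass_mcomp:
  assumes "A \<in> TObj T" "B \<in> TObj T" "C \<in> TObj T" "a \<in> maps T B C" "x \<in> maps T A B"
  shows "(\<Union>b\<in>hclass B C a. \<Union>y\<in>hclass A B x. hclass A C (mcomp T A B C b y)) =
    hclass A C (mcomp T A B C a x)"
proof -
  have "hclass A C (mcomp T A B C b y) = hclass A C (mcomp T A B C a x)"
    if "b \<in> hclass B C a" "y \<in> hclass A B x" for b y
    by (rule sym, rule hclass_eq[OF assms(1,3)], rule mcomp_conn) (use assms that in auto)
  moreover have "a \<in> hclass B C a" "x \<in> hclass A B x"
    using equiv_class_self[OF conn_equiv] assms by auto
  ultimately show ?thesis by blast
qed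

lemma homotopy_category_simps:
  "Obj (homotopy_category T) = TObj T"
  "Src (homotopy_category T) (A, B, c) = A"
  "Tgt (homotopy_category T) (A, B, c) = B"
  "Ident (homotopy_category T) A = (A, A, hclass A A (unit_map T A))"
  by (simp_all add: homotopy_category_def)

lemma homotopy_category_arr:
  "\<lbrakk>A \<in> TObj T; B \<in> TObj T; x \<in> maps T A B\<rbrakk> \<Longrightarrow> (A, B, hclass A B x) \<in> Arr (homotopy_category T)"
  by (simp add: homotopy_category_def quotientI)

lemma homotopy_category_arrE:
  assumes "f \<in> Arr (homotopy_category T)"
  obtains A B x where "A \<in> TObj T" "B \<in> TObj T" "x \<in> maps T A B" "f = (A, B, hclass A B x)"
  using assms by (auto simp: homotopy_category_def elim!: quotientE)

lemma homotopy_category_comp: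
  "\<lbrakk>A \<in> TObj T; B \<in> TObj T; C \<in> TObj T; a \<in> maps T B C; x \<in> maps T A B\<rbrakk> \<Longrightarrow>
    Comp (homotopy_category T) (B, C, hclass B C a) (A, B, hclass A B x) =
      (A, C, hclass A C (mcomp T A B C a x))"
  using hclass_mcomp by (simp add: homotopy_category_def)

lemma category_homotopy_category: "category (homotopy_category T)"
proof (rule category.intro)
  fix f g h
  assume "f \<in> Arr (homotopy_category T)" "g \<in> Arr (homotopy_category T)" "h \<in> Arr (homotopy_category T)"
    "Tgt (homotopy_category T) f = Src (homotopy_category T) g"
    "Tgt (homotopy_category T) g = Src (homotopy_category T) h"
  then show "Comp (homotopy_category T) (Comp (homotopy_category T) h g) f =
      Comp (homotopy_category T) h (Comp (homotopy_category T) g f)"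
    by (elim homotopy_category_arrE)
       (auto simp: homotopy_category_simps homotopy_category_comp mcomp_closed mcomp_assoc)
qed (auto elim!: homotopy_category_arrE simp: homotopy_category_simps homotopy_category_comp
    homotopy_category_arr unit_closed mcomp_closed mcomp_unit_left mcomp_unit_right)

end

text \<open>For a functor that is the identity on objects everything is decided on hom-groupoids:
  \<open>es\<close> yields fullness on homotopy classes, and reflection of connectedness yields
  faithfulness. In \<open>es\<close> any track will do, since tracks are invertible.\<close>

lemma DK_equivalence_id:
  assumes F: "is_track_functor S T id Fm Ft" and TObj: "TObj T = TObj S"
    and ff: "\<And>A B x y g. \<lbrakk>A \<in> TObj S; B \<in> TObj S; x \<in> maps S A B; y \<in> maps S A B;
      arrow (Hom T A B) g (Fm A B x) (Fm A B y)\<rbrakk> \<Longrightarrow> \<exists>!f. arrow (Hom S A B) f x y \<and> Ft A B f = g"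
    and es: "\<And>A B z. \<lbrakk>A \<in> TObj S; B \<in> TObj S; z \<in> maps T A B\<rbrakk> \<Longrightarrow>
      \<exists>x e. x \<in> maps S A B \<and> arrow (Hom T A B) e (Fm A B x) z"
  shows "DK_equivalence S T id Fm Ft"
proof -
  interpret S: track_category S using F by (simp add: is_track_functor_def)
  interpret T: track_category T using F by (simp add: is_track_functor_def)
  have func: "is_functor (Hom S A B) (Hom T A B) (Fm A B) (Ft A B)" if "A \<in> TObj S" "B \<in> TObj S" for A B
    using F that by (simp add: is_track_functor_def)
  have Fm: "Fm A B x \<in> maps T A B" if "A \<in> TObj S" "B \<in> TObj S" "x \<in> maps S A B" for A B x
    using func[OF that(1,2)] that(3) by (simp add: is_functor_def)
  have loc: "is_equivalence (Hom S A B) (Hom T A B) (Fm A B) (Ft A B)"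
    if AB: "A \<in> TObj S" "B \<in> TObj S" for A B
  proof (rule fully_faithful_essentially_surjective_equivalence[OF func[OF AB] ff[OF AB]])
    fix z assume "z \<in> maps T A B"
    from es[OF AB this] obtain x e where "x \<in> maps S A B" "arrow (Hom T A B) e (Fm A B x) z" by blast
    moreover from this have "is_invertible (Hom T A B) e"
      using groupoid.Arr_iso[OF T.groupoid_Hom] AB TObj by (simp add: arrow_def)
    ultimately show "\<exists>x e. x \<in> maps S A B \<and> arrow (Hom T A B) e (Fm A B x) z \<and>
        is_invertible (Hom T A B) e"
      by blast
  qed
  let ?h = "homotopy_functor_arr T id Fm"
  \<comment> \<open>A track between images lifts, so connectedness is reflected as well as
    preserved.\<close>
  have conn: "(Fm A B x, Fm A B y) \<in> conn (Hom T A B) \<longleftrightarrow> (x, y) \<in> conn (Hom S A B)"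
    if AB: "A \<in> TObj S" "B \<in> TObj S" "x \<in> maps S A B" "y \<in> maps S A B" for A B x y
    using that Fm is_functor_arrow[OF func[OF AB(1,2)]] ff[OF AB]
    by (auto simp: conn_def) metis+
  have h: "?h (A, B, S.hclass A B x) = (A, B, T.hclass A B (Fm A B x))"
    if AB: "A \<in> TObj S" "B \<in> TObj S" "x \<in> maps S A B" for A B x
  proof -
    have "T.hclass A B (Fm A B y) = T.hclass A B (Fm A B x)" if "y \<in> S.hclass A B x" for y
    proof -
      have "(x, y) \<in> conn (Hom S A B)" "y \<in> maps S A B" using that by (auto simp: conn_def)
      then have "(Fm A B x, Fm A B y) \<in> conn (Hom T A B)" using conn AB by blast
      then show ?thesis using T.hclass_eq[of A B] AB TObj by metis
    qed
    moreover have "x \<in> S.hclass A B x" using equiv_class_self[OF S.conn_equiv] AB by auto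
    ultimately have "conn (Hom T A B) `` (Fm A B ` S.hclass A B x) = T.hclass A B (Fm A B x)"
      by blast
    then show ?thesis by (simp add: homotopy_functor_arr_def)
  qed
  have hfun: "is_functor (homotopy_category S) (homotopy_category T) id ?h"
    unfolding is_functor_def
  proof (intro conjI ballI impI)
    show "category (homotopy_category S)" "category (homotopy_category T)"
      by (rule S.category_homotopy_category T.category_homotopy_category)+
    show "id A \<in> Obj (homotopy_category T)" if "A \<in> Obj (homotopy_category S)" for A
      using that by (simp add: S.homotopy_category_simps T.homotopy_category_simps TObj)
    show "arrow (homotopy_category T) (?h f) (id (Src (homotopy_category S) f)) (id (Tgt (homotopy_category S) f))"
      if "f \<in> Arr (homotopy_category S)" for f
      using that by (elim S.homotopy_category_arrE)
        (simp add: h arrow_def S.homotopy_category_simps T.homotopy_category_simps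
          T.homotopy_category_arr TObj Fm)
    show "?h (Ident (homotopy_category S) A) = Ident (homotopy_category T) (id A)"
      if "A \<in> Obj (homotopy_category S)" for A
      using that F by (simp add: h S.homotopy_category_simps T.homotopy_category_simps S.unit_closed
        is_track_functor_def)
    show "?h (Comp (homotopy_category S) g f) = Comp (homotopy_category T) (?h g) (?h f)"
      if "f \<in> Arr (homotopy_category S)" "g \<in> Arr (homotopy_category S)"
        "Tgt (homotopy_category S) f = Src (homotopy_category S) g" for f g
      using that F by (elim S.homotopy_category_arrE)
        (auto simp: h S.homotopy_category_simps S.homotopy_category_comp T.homotopy_category_comp
          S.mcomp_closed TObj Fm is_track_functor_def)
  qed
  have "is_equivalence (homotopy_category S) (homotopy_category T) id ?h"
  proof (rule fully_faithful_essentially_surjective_equivalence[OF hfun])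
    fix A B g assume "A \<in> Obj (homotopy_category S)" "B \<in> Obj (homotopy_category S)"
      and g: "arrow (homotopy_category T) g (id A) (id B)"
    then have AB: "A \<in> TObj S" "B \<in> TObj S" by (simp_all add: S.homotopy_category_simps)
    obtain u where u: "u \<in> maps T A B" "g = (A, B, T.hclass A B u)"
      using g by (auto simp: arrow_def T.homotopy_category_simps elim!: T.homotopy_category_arrE)
    from es[OF AB u(1)] obtain x e where x: "x \<in> maps S A B" "arrow (Hom T A B) e (Fm A B x) u" by blast
    have "(Fm A B x, u) \<in> conn (Hom T A B)" using x u(1) Fm[OF AB x(1)] by (auto simp: conn_def)
    then have gx: "g = ?h (A, B, S.hclass A B x)"
      using T.hclass_eq[of A B] AB TObj h[OF AB x(1)] u(2) by simp
    show "\<exists>!f. arrow (homotopy_category S) f A B \<and> ?h f = g"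
    proof (rule ex1I[of _ "(A, B, S.hclass A B x)"])
      show "arrow (homotopy_category S) (A, B, S.hclass A B x) A B \<and> ?h (A, B, S.hclass A B x) = g"
        using gx AB x(1) by (simp add: arrow_def S.homotopy_category_simps S.homotopy_category_arr)
      fix f assume f: "arrow (homotopy_category S) f A B \<and> ?h f = g"
      then obtain y where y: "y \<in> maps S A B" "f = (A, B, S.hclass A B y)"
        by (auto simp: arrow_def S.homotopy_category_simps elim!: S.homotopy_category_arrE)
      have "T.hclass A B (Fm A B x) = T.hclass A B (Fm A B y)"
        using f gx h[OF AB x(1)] h[OF AB y(1)] y(2) by simp
      then have "(Fm A B x, Fm A B y) \<in> conn (Hom T A B)"
        using eq_equiv_class_iff[OF T.conn_equiv] AB TObj Fm x(1) y(1) by metis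
      then have "(x, y) \<in> conn (Hom S A B)" using conn AB x(1) y(1) by blast
      then show "f = (A, B, S.hclass A B x)" using S.hclass_eq[of A B] AB y(2) by metis
    qed
  next
    fix A assume "A \<in> Obj (homotopy_category T)"
    then have A: "A \<in> TObj S" by (simp add: T.homotopy_category_simps TObj)
    interpret H: category "homotopy_category T" by (rule T.category_homotopy_category)
    have "A \<in> Obj (homotopy_category T)" by (simp add: T.homotopy_category_simps TObj A)
    from H.arrow_Ident[OF this] H.is_invertible_Ident[OF this]
    show "\<exists>x e. x \<in> Obj (homotopy_category S) \<and> arrow (homotopy_category T) e (id x) A \<and>
        is_invertible (homotopy_category T) e"
      using A
      by (intro exI[of _ A] exI[of _ "Ident (homotopy_category T) A"]) (simp add: S.homotopy_category_simps)
  qed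
  then show ?thesis using F loc by (simp add: DK_equivalence_def)
qed

text \<open>The zigzag has a single step: its intermediate category is \<open>T\<close> itself and
  the remaining chain is empty.\<close>

lemma weakly_equivalentI: "DK_equivalence S T Fo Fm Ft \<Longrightarrow> weakly_equivalent S T"
  unfolding weakly_equivalent_def DK_linked_def by blast

section \<open>The comparison track functor\<close>

context left_linear_with_linearity_tracks
begin

text \<open>Subtraction in \<open>kernel\<close> uses the inverses of that record, subtraction of
  tracks those of \<open>TGrp\<close>. An element \<open>m\<close> with \<open>l + m = 0\<close>
  translates between the two.\<close>

lemma kernel_minus_eq:
  assumes "A \<in> TObj F" "B \<in> TObj F" "k \<in> carrier (kernel A B)" "l \<in> carrier (kernel A B)"
    "m \<in> carrier (kernel A B)" and eq: "\<zero>\<^bsub>TGrp F A B\<^esub> = l \<oplus>\<^bsub>TGrp F A B\<^esub> m"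
  shows "k \<ominus>\<^bsub>kernel A B\<^esub> l = k \<oplus>\<^bsub>TGrp F A B\<^esub> m"
proof -
  interpret K: abelian_group "kernel A B" using assms by (simp add: kernel_abelian_group)
  have "k = k \<oplus>\<^bsub>kernel A B\<^esub> m \<oplus>\<^bsub>kernel A B\<^esub> l"
    using K.a_assoc[of k m l] K.a_comm[of m l] K.r_zero[of k] assms(3-5) eq by (simp del: kernel_simps(1))
  then have "k \<ominus>\<^bsub>kernel A B\<^esub> l = k \<oplus>\<^bsub>kernel A B\<^esub> m"
    using assms(3-5) by (simp add: K.minus_eq_iff del: kernel_simps)
  then show ?thesis by simp
qed

context
  fixes N :: int and R :: "int ring"
  assumes lin: "linearity_cocycle N (TObj F) (MGrp F) kernel source (mcomp F) (whiskl F) (whiskr F) (unit_map F) cocycle"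
    and R: "integers_mod N R"
begin

interpretation L: linearity_cocycle N "TObj F" "MGrp F" kernel source "mcomp F" "whiskl F" "whiskr F" "unit_map F" cocycle
  by (rule lin)

interpretation DG: truncated_dg_category R L.dg
  by (rule L.truncated_dg_category_dg[OF R])

text \<open>The free component is forced: a track of the target category starts at its boundary plus
  its target, so the boundary must be the difference of the two generators.\<close>

definition track_map :: "'o \<Rightarrow> 'o \<Rightarrow> 't \<Rightarrow> (('m \<Rightarrow> int) \<times> 't) \<times> ('m \<Rightarrow> int)" where
  "track_map A B \<alpha> =
    ((single N (Src (Hom F A B) \<alpha>) \<ominus>\<^bsub>L.free A B\<^esub> single N (Tgt (Hom F A B) \<alpha>),
      \<alpha> \<ominus>\<^bsub>TGrp F A B\<^esub> idtr F A B (Tgt (Hom F A B) \<alpha>)), single N (Tgt (Hom F A B) \<alpha>))"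

text \<open>Strictness on tracks rests on one coincidence. Whiskering \<open>\<xi>\<close>, that is,
  \<open>l\<close> plus an identity, by \<open>a\<close> produces a cocycle term through
  \<open>whiskl_add\<close>; the defect of \<open>a\<close> at \<open>[x] - [x']\<close>, which
  \<open>comp01\<close> subtracts, is the negative of that term.\<close>

lemma track_map_tcomp:
  assumes [simp]: "A \<in> TObj F" "B \<in> TObj F" "C \<in> TObj F" "\<alpha> \<in> tracks F B C" "\<xi> \<in> tracks F A B"
  shows "track_map A C (tcomp F A B C \<alpha> \<xi>) = tcomp (\<Theta> L.dg) A B C (track_map B C \<alpha>) (track_map A B \<xi>)"
proof -
  interpret free: abelian_group "L.free A C" by (rule free_group_abelian_group)
  interpret freeBC: abelian_group "L.free B C" by (rule free_group_abelian_group)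
  interpret freeAB: abelian_group "L.free A B" by (rule free_group_abelian_group)
  interpret Q: abelian_group "TGrp F A C" by simp
  interpret Q': abelian_group "TGrp F A B" by simp
  interpret H1: abelian_group "L.hom1 A C" by (rule L.hom1_group) simp_all
  define a a' x x' where "a = Src (Hom F B C) \<alpha>" and "a' = Tgt (Hom F B C) \<alpha>"
    and "x = Src (Hom F A B) \<xi>" and "x' = Tgt (Hom F A B) \<xi>"
  have [simp]: "a \<in> maps F B C" "a' \<in> maps F B C" "x \<in> maps F A B" "x' \<in> maps F A B"
    by (simp_all add: a_def a'_def x_def x'_def)
  define k l where "k = \<alpha> \<ominus>\<^bsub>TGrp F B C\<^esub> idtr F B C a'" and "l = \<xi> \<ominus>\<^bsub>TGrp F A B\<^esub> idtr F A B x'"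
  have k [simp]: "k \<in> carrier (kernel B C)" and dk: "source B C k = a \<ominus>\<^bsub>MGrp F B C\<^esub> a'"
    and l [simp]: "l \<in> carrier (kernel A B)" and dl: "source A B l = x \<ominus>\<^bsub>MGrp F A B\<^esub> x'"
    by (simp_all add: k_def l_def Hom_arrow source_def M_simps flip: a_def a'_def x_def x'_def)
  let ?u = "single N a \<ominus>\<^bsub>L.free B C\<^esub> single N a'" and ?v = "single N x \<ominus>\<^bsub>L.free A B\<^esub> single N x'"
  have uk: "(?u, k) \<in> carrier (L.hom1 B C)" and vl: "(?v, l) \<in> carrier (L.hom1 A B)"
    by (simp_all add: L.hom1_simps L.ev_simps dk dl del: kernel_simps)
  \<comment> \<open>The composite in \<open>\<Theta>\<close> acts on the right factor by the target
    \<open>[a']\<close> and by the boundary \<open>[a] - [a']\<close>. Together this is the action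
    of \<open>[a]\<close>, matching the whiskering by the source of \<open>\<alpha>\<close> in
    \<open>tcomp_right_left\<close>.\<close>
  have "single N a' \<oplus>\<^bsub>L.free B C\<^esub> ?u = single N a"
    using freeBC.minus_add_cancel[of "single N a" "single N a'"]
    by (simp add: freeBC.a_comm)
  then have c01: "L.comp01 A B C (single N a') (?v, l) \<oplus>\<^bsub>L.hom1 A C\<^esub> L.comp01 A B C ?u (?v, l) =
      L.comp01 A B C (single N a) (?v, l)"
    using vl by (simp flip: L.comp01_simps(1))
  have c: "tcomp (\<Theta> L.dg) A B C ((?u, k), single N a') ((?v, l), single N x') =
      (L.comp10 A B C (?u, k) (single N x') \<oplus>\<^bsub>L.hom1 A C\<^esub> L.comp01 A B C (single N a) (?v, l),
        single N (mcomp F A B C a' x'))"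
    using uk vl
    by (simp add: \<Theta>_def L.dg_def H1.a_assoc L.comp10_closed L.comp01_closed c01)
  \<comment> \<open>The generator \<open>[x]\<close> has no defect; writing it as
    \<open>([x] - [x']) + [x']\<close> computes the defect of the difference.\<close>
  have "\<zero>\<^bsub>kernel A C\<^esub> = L.defect A B C a (?v \<oplus>\<^bsub>L.free A B\<^esub> single N x')"
    by (simp add: freeAB.minus_add_cancel L.defect_single)
  also have "\<dots> = L.defect A B C a ?v \<oplus>\<^bsub>kernel A C\<^esub> cocycle A B C a (source A B l) x'"
    using L.defect_closed[of A B C a ?v] by (simp add: L.defect_add L.defect_single L.ev_simps dl)
  finally have defect: "whiskl F A B C a l \<ominus>\<^bsub>kernel A C\<^esub> L.defect A B C a ?v =
      whiskl F A B C a l \<oplus>\<^bsub>TGrp F A C\<^esub> cocycle A B C a (source A B l) x'"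
    using L.defect_closed[of A B C a ?v] l
    by (intro kernel_minus_eq) (simp_all add: mcomp_zero source_def)
  have "\<xi> = l \<oplus>\<^bsub>TGrp F A B\<^esub> idtr F A B x'" by (simp add: l_def Q'.minus_add_cancel)
  then have w: "whiskl F A B C a \<xi> = whiskl F A B C a l \<oplus>\<^bsub>TGrp F A C\<^esub> idtr F A C (mcomp F A B C a x')
      \<oplus>\<^bsub>TGrp F A C\<^esub> cocycle A B C a (source A B l) x'"
    using whiskl_add[of A B C a l "idtr F A B x'"] l by (simp add: source_def del: kernel_simps)
  have t: "tcomp F A B C \<alpha> \<xi> = whiskr F A B C \<alpha> x' \<oplus>\<^bsub>TGrp F A C\<^esub>
      (whiskl F A B C a \<xi> \<ominus>\<^bsub>TGrp F A C\<^esub> idtr F A C (mcomp F A B C a x'))"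
    by (simp add: tcomp_right_left Hom_Comp_eq flip: a_def x'_def)
  have wr: "whiskr F A B C k x' = whiskr F A B C \<alpha> x' \<ominus>\<^bsub>TGrp F A C\<^esub> idtr F A C (mcomp F A B C a' x')"
    by (simp add: k_def whiskr_diff)
  have "tcomp F A B C \<alpha> \<xi> \<ominus>\<^bsub>TGrp F A C\<^esub> idtr F A C (mcomp F A B C a' x') =
      whiskr F A B C k x' \<oplus>\<^bsub>TGrp F A C\<^esub>
        (whiskl F A B C a l \<oplus>\<^bsub>TGrp F A C\<^esub> cocycle A B C a (source A B l) x')"
    using l unfolding t w wr by (simp add: Q.group_simps source_def)
  moreover have "L.comp00 A B C ?u (single N x') \<oplus>\<^bsub>L.free A C\<^esub> L.comp00 A B C (single N a) ?v =
      single N (mcomp F A B C a x) \<ominus>\<^bsub>L.free A C\<^esub> single N (mcomp F A B C a' x')"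
    by (simp add: a_minus_def L.comp00_simps)
       (simp add: free.group_simps flip: a_minus_def)
  ultimately show ?thesis
    unfolding track_map_def[of B] track_map_def[of A B]
    by (simp add: c track_map_def L.comp10_single L.comp01_single defect L.hom1_simps
        k[unfolded kernel_simps] flip: a_def a'_def x_def x'_def k_def l_def)
qed

lemma is_functor_track_map:
  assumes [simp]: "A \<in> TObj F" "B \<in> TObj F"
  shows "is_functor (Hom F A B) (\<Theta>_Hom L.dg A B) (single N) (track_map A B)"
proof -
  interpret G: abelian_group_groupoid "Hom F A B" "MGrp F A B" "TGrp F A B"
    by (rule Hom_abelian_group) simp_all
  interpret free: abelian_group "L.free A B" by (rule free_group_abelian_group)
  interpret D: groupoid "\<Theta>_Hom L.dg A B"
    by (rule DG.groupoid_\<Theta>_Hom) (simp_all add: L.dg_def)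
  show ?thesis
    unfolding is_functor_def
  proof (intro conjI ballI impI G.category_axioms D.category_axioms)
    fix \<alpha> assume [simp]: "\<alpha> \<in> tracks F A B"
    show "arrow (\<Theta>_Hom L.dg A B) (track_map A B \<alpha>) (single N (Src (Hom F A B) \<alpha>))
        (single N (Tgt (Hom F A B) \<alpha>))"
      by (simp add: arrow_def \<Theta>_Hom_def L.dg_def track_map_def free.minus_add_cancel L.hom1_simps
          L.ev_simps source_def Hom_arrow M_simps)
    fix \<beta> assume [simp]: "\<beta> \<in> tracks F A B" and eq: "Tgt (Hom F A B) \<alpha> = Src (Hom F A B) \<beta>"
    show "track_map A B (Comp (Hom F A B) \<beta> \<alpha>) =
        Comp (\<Theta>_Hom L.dg A B) (track_map A B \<beta>) (track_map A B \<alpha>)"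
      by (simp add: track_map_def \<Theta>_Hom_def L.dg_def L.hom1_simps G.Src_Comp G.Tgt_Comp eq)
         (simp add: G.Comp_eq eq G.Q.group_simps free.group_simps)
  next
    fix x assume "x \<in> maps F A B"
    then show "track_map A B (idtr F A B x) = Ident (\<Theta>_Hom L.dg A B) (single N x)"
      by (simp add: track_map_def \<Theta>_Hom_def L.dg_def L.hom1_simps free.minus_self G.Q.minus_self)
  qed (simp add: \<Theta>_Hom_def L.dg_def)
qed

lemma \<Theta>_dg_simps:
  "TObj (\<Theta> L.dg) = TObj F" "Hom (\<Theta> L.dg) = \<Theta>_Hom L.dg" "mcomp (\<Theta> L.dg) = L.comp00"
  "unit_map (\<Theta> L.dg) A = single N (unit_map F A)"
  by (simp_all add: \<Theta>_def L.dg_def)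

lemma is_track_functor_track_map: "is_track_functor F (\<Theta> L.dg) id (\<lambda>A B. single N) track_map"
  unfolding is_track_functor_def
  by (intro conjI ballI track_category_axioms DG.track_category_\<Theta>)
     (simp_all add: \<Theta>_dg_simps track_map_tcomp is_functor_track_map)

text \<open>Between generators the free component of a track is determined by its two ends, so
  tracks on both sides correspond through the \<open>kernel\<close> component. Every formal sum is
  joined to the generator of its evaluation.\<close>

lemma DK_equivalence_track_map: "DK_equivalence F (\<Theta> L.dg) id (\<lambda>A B. single N) track_map"
proof (rule DK_equivalence_id[OF is_track_functor_track_map])
  show "TObj (\<Theta> L.dg) = TObj F" by (simp add: \<Theta>_def L.dg_def)
next
  fix A B x y g
  assume [simp]: "A \<in> TObj F" "B \<in> TObj F" "x \<in> maps F A B" "y \<in> maps F A B"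
    and "arrow (Hom (\<Theta> L.dg) A B) g (single N x) (single N y)"
  interpret free: abelian_group "L.free A B" by (rule free_group_abelian_group)
  interpret M: abelian_group "MGrp F A B" by (rule MGrp_abelian_group) simp_all
  interpret Q: abelian_group "TGrp F A B" by simp
  obtain w k where g: "g = ((w, k), single N y)" and w [simp]: "w \<in> carrier (L.free A B)"
    and k: "k \<in> carrier (kernel A B)" and ev: "source A B k = L.ev A B w"
    and wx: "w \<oplus>\<^bsub>L.free A B\<^esub> single N y = single N x"
    using \<open>arrow (Hom (\<Theta> L.dg) A B) g (single N x) (single N y)\<close>
    by (cases g) (auto simp: \<Theta>_def \<Theta>_Hom_def L.dg_def arrow_def L.hom1_simps)
  have k' [simp]: "k \<in> tracks F A B" "Tgt (Hom F A B) k = \<zero>\<^bsub>MGrp F A B\<^esub>" using k by simp_all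
  have "L.ev A B (w \<oplus>\<^bsub>L.free A B\<^esub> single N y) = x" by (simp add: wx)
  then have src: "madd F A B (Src (Hom F A B) k) y = x"
    by (simp add: L.ev_simps ev[symmetric], simp add: source_def)
  show "\<exists>!\<alpha>. arrow (Hom F A B) \<alpha> x y \<and> track_map A B \<alpha> = g"
  \<comment> \<open>Inverse of the translation: the part of \<open>g\<close> that ends at 0 is moved
    back to end at \<open>y\<close>.\<close>
  proof (rule ex1I[of _ "tadd F A B k (idtr F A B y)"])
    have "single N x \<ominus>\<^bsub>L.free A B\<^esub> single N y = w" by (simp add: free.minus_eq_iff wx)
    then show "arrow (Hom F A B) (tadd F A B k (idtr F A B y)) x y \<and>
        track_map A B (tadd F A B k (idtr F A B y)) = g"
      by (simp add: arrow_def Hom_arrow src track_map_def g Q.minus_eq_iff)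
  next
    fix \<alpha> assume \<alpha>: "arrow (Hom F A B) \<alpha> x y \<and> track_map A B \<alpha> = g"
    then have "\<alpha> \<in> tracks F A B" "\<alpha> \<ominus>\<^bsub>TGrp F A B\<^esub> idtr F A B y = k"
      by (auto simp: arrow_def track_map_def g)
    then show "\<alpha> = tadd F A B k (idtr F A B y)" by (simp add: Q.minus_eq_iff)
  qed
next
  fix A B u assume [simp]: "A \<in> TObj F" "B \<in> TObj F" and "u \<in> maps (\<Theta> L.dg) A B"
  then have u [simp]: "u \<in> carrier (L.free A B)" by (simp add: \<Theta>_def \<Theta>_Hom_def L.dg_def)
  interpret free: abelian_group "L.free A B" by (rule free_group_abelian_group)
  have [simp]: "L.ev A B u \<in> maps F A B" using L.ev_closed[of A B u] by simp
  \<comment> \<open>The difference \<open>[ev u] - u\<close> evaluates to 0, the source of the zero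
    track, so the pair lies in \<open>hom1\<close>.\<close>
  let ?e = "((single N (L.ev A B u) \<ominus>\<^bsub>L.free A B\<^esub> u, \<zero>\<^bsub>TGrp F A B\<^esub>), u)"
  have "arrow (Hom (\<Theta> L.dg) A B) ?e (single N (L.ev A B u)) u"
    by (simp add: \<Theta>_def \<Theta>_Hom_def L.dg_def arrow_def L.hom1_simps free.minus_add_cancel L.ev_simps
        source_def M_simps)
  then show "\<exists>x e. x \<in> maps F A B \<and> arrow (Hom (\<Theta> L.dg) A B) e (single N x) u"
    by (intro exI[of _ "L.ev A B u"] exI[of _ ?e]) simp
qed

lemma weakly_equivalent_truncated_dg_category:
  "\<exists>\<B> :: ('o, int, 'm \<Rightarrow> int, ('m \<Rightarrow> int) \<times> 't) dg_category.
    truncated_dg_category R \<B> \<and> weakly_equivalent F (\<Theta> \<B>)"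
  using DG.truncated_dg_category_axioms weakly_equivalentI[OF DK_equivalence_track_map] by blast

end

section \<open>Torsion of tracks and of the twisted sums\<close>

lemma kernel_torsion:
  assumes M: "\<And>A B x. \<lbrakk>A \<in> TObj F; B \<in> TObj F; x \<in> maps F A B\<rbrakk> \<Longrightarrow>
      [(n::int)] \<cdot>\<^bsub>MGrp F A B\<^esub> x = \<zero>\<^bsub>MGrp F A B\<^esub>"
    and AB: "A \<in> TObj F" "B \<in> TObj F" and k: "k \<in> carrier (kernel A B)"
  shows "[n] \<cdot>\<^bsub>kernel A B\<^esub> k = \<zero>\<^bsub>kernel A B\<^esub>"
proof -
  note add = whiskl_kernel_additive[OF AB(1,2,2) k]
  note groups = MGrp_abelian_group[OF AB(2,2)] kernel_abelian_group[OF AB]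
  have u: "unit_map F B \<in> carrier (MGrp F B B)" using AB by (simp add: unit_closed)
  have "[n] \<cdot>\<^bsub>kernel A B\<^esub> whiskl F A B B (unit_map F B) k =
      whiskl F A B B ([n] \<cdot>\<^bsub>MGrp F B B\<^esub> unit_map F B) k"
    by (rule additive_map_int_pow[OF groups add u, symmetric])
  also have "\<dots> = whiskl F A B B \<zero>\<^bsub>MGrp F B B\<^esub> k" by (simp only: M AB unit_closed)
  also have "\<dots> = \<zero>\<^bsub>kernel A B\<^esub>" by (rule additive_map_zero[OF groups add])
  finally show ?thesis using AB k by (simp add: whisker_unit)
qed

text \<open>For \<open>N = 0\<close> each torsion condition only says that the zeroth multiple is
  zero.\<close>

lemma linearity_cocycle_int:
  "linearity_cocycle 0 (TObj F) (MGrp F) kernel source (mcomp F) (whiskl F) (whiskr F) (unit_map F) cocycle"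
  by (rule linearity_cocycle_cocycle) (simp_all add: add_pow_def twisted_sum_simps)

text \<open>The square appears because the twisted sum is an extension of one \<open>n\<close>-torsion group by
  another.\<close>

lemma linearity_cocycle_torsion:
  assumes M: "\<And>A B x. \<lbrakk>A \<in> TObj F; B \<in> TObj F; x \<in> maps F A B\<rbrakk> \<Longrightarrow>
      [(n::int)] \<cdot>\<^bsub>MGrp F A B\<^esub> x = \<zero>\<^bsub>MGrp F A B\<^esub>"
  shows "linearity_cocycle (n * n) (TObj F) (MGrp F) kernel source (mcomp F) (whiskl F) (whiskr F)
    (unit_map F) cocycle"
proof (rule linearity_cocycle_cocycle)
  show "[(n * n)] \<cdot>\<^bsub>MGrp F A B\<^esub> x = \<zero>\<^bsub>MGrp F A B\<^esub>"
    if "A \<in> TObj F" "B \<in> TObj F" "x \<in> maps F A B" for A B x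
    using that abelian_group.int_add_pow_mult[OF MGrp_abelian_group]
      abelian_group.int_add_pow_of_zero[OF MGrp_abelian_group] by (simp add: M)
  show "[(n * n)] \<cdot>\<^bsub>kernel A B\<^esub> k = \<zero>\<^bsub>kernel A B\<^esub>"
    if "A \<in> TObj F" "B \<in> TObj F" "k \<in> carrier (kernel A B)" for A B k
    using that abelian_group.int_add_pow_mult[OF kernel_abelian_group]
      abelian_group.int_add_pow_of_zero[OF kernel_abelian_group]
    by (simp add: kernel_torsion[OF M] del: kernel_simps)
  show "[(n * n)] \<cdot>\<^bsub>twisted_sum (MGrp F X A) (kernel X B) (cocycle X A B a)\<^esub> e =
      \<zero>\<^bsub>twisted_sum (MGrp F X A) (kernel X B) (cocycle X A B a)\<^esub>"
    if "X \<in> TObj F" "A \<in> TObj F" "B \<in> TObj F" "a \<in> maps F A B"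
      "e \<in> carrier (twisted_sum (MGrp F X A) (kernel X B) (cocycle X A B a))" for X A B a e
    by (rule symmetric_cocycle.twisted_sum_torsion[OF symmetric_cocycle_cocycle])
       (use that M kernel_torsion[OF M] in \<open>simp_all del: kernel_simps\<close>)
qed

end

theorem theoremB:
  fixes F :: "('o, 'm, 't) linear_track_category"
    and \<Gamma> :: "'o \<Rightarrow> 'o \<Rightarrow> 'o \<Rightarrow> 'm \<Rightarrow> 'm \<Rightarrow> 'm \<Rightarrow> 't"
  assumes "left_linear_track_category F"
    and "linearity_tracks F \<Gamma>"
  shows "(\<exists>\<B> :: ('o, int, 'm \<Rightarrow> int, ('m \<Rightarrow> int) \<times> 't) dg_category.
            truncated_dg_category \<Z> \<B> \<and> weakly_equivalent F (\<Theta> \<B>)) \<and>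
         (\<forall>p :: nat. Factorial_Ring.prime p \<longrightarrow>
            (\<forall>A\<in>TObj F. \<forall>B\<in>TObj F. \<forall>x\<in>maps F A B.
               [p] \<cdot>\<^bsub>MGrp F A B\<^esub> x = \<zero>\<^bsub>MGrp F A B\<^esub>) \<longrightarrow>
            (\<exists>\<B> :: ('o, int, 'm \<Rightarrow> int, ('m \<Rightarrow> int) \<times> 't) dg_category.
               truncated_dg_category (residue_ring (int (p\<^sup>2))) \<B> \<and>
               weakly_equivalent F (\<Theta> \<B>)))"
proof (intro conjI allI impI)
  interpret left_linear_with_linearity_tracks F \<Gamma>
    using assms by (simp add: left_linear_with_linearity_tracks_def)
  show "\<exists>\<B> :: ('o, int, 'm \<Rightarrow> int, ('m \<Rightarrow> int) \<times> 't) dg_category.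
      truncated_dg_category \<Z> \<B> \<and> weakly_equivalent F (\<Theta> \<B>)"
    by (rule weakly_equivalent_truncated_dg_category[OF linearity_cocycle_int integers_mod_int])
  fix p :: nat
  assume p: "Factorial_Ring.prime p"
    and tors: "\<forall>A\<in>TObj F. \<forall>B\<in>TObj F. \<forall>x\<in>maps F A B. [p] \<cdot>\<^bsub>MGrp F A B\<^esub> x = \<zero>\<^bsub>MGrp F A B\<^esub>"
  \<comment> \<open>The hypothesis speaks of natural multiples, the construction of integer
    multiples.\<close>
  have "[(int p)] \<cdot>\<^bsub>MGrp F A B\<^esub> x = \<zero>\<^bsub>MGrp F A B\<^esub>"
    if "A \<in> TObj F" "B \<in> TObj F" "x \<in> maps F A B" for A B x
    using tors that by (simp add: add_pow_def int_pow_int)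
  note lin = linearity_cocycle_torsion[OF this]
  have "1 < int p * int p" using prime_gt_1_nat[OF p] by (simp add: less_1_mult)
  from weakly_equivalent_truncated_dg_category[OF lin integers_mod_residue_ring[OF this]]
  show "\<exists>\<B> :: ('o, int, 'm \<Rightarrow> int, ('m \<Rightarrow> int) \<times> 't) dg_category.
      truncated_dg_category (residue_ring (int (p\<^sup>2))) \<B> \<and> weakly_equivalent F (\<Theta> \<B>)"
    by (simp add: power2_eq_square)
qed

end
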